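(* Let $\theta\in\mathbb{R}$. The defect ideal $J=\langle 1-uu^*,1-vv^*\rangle$ of $\mathcal{T}*_\theta\mathcal{T}$ is isomorphic to $(C(S^1)*_{\mathbb{C}}\mathbb{C}^2)\otimes\mathcal{K}$ via $(uv)^i\bar u\leftrightarrow\bar u\otimes x_i$ and $(uv)^i\bar p\leftrightarrow\bar p\otimes x_i$ for $i\in\mathbb{N}_0$, where on the left-hand sides $\bar u:=u(1-vv^* )+(1-uu^* )v^*$ and $\bar p:=v(1-uu^* )v^*$ are elements of $\mathcal{T}*_\theta\mathcal{T}$, and on the right-hand sides $\bar u,\bar p$ are the generators of $C(S^1)*_{\mathbb{C}}\mathbb{C}^2$.
   Context: Put $\lambda=e^{2\pi i\theta}$. The free twist of two isometries $\mathcal{T}*_\theta\mathcal{T}$ is the universal unital $C^*$-algebra generated by two isometries $u$ and $v$ such that $uv=\lambda vu$. $\langle\cdot\rangle$ denotes the closed two-sided ideal generated by the given elements. The unital free product $C(S^1)*_{\mathbb{C}}\mathbb{C}^2$ is viewed as the universal unital $C^*$-algebra generated by a unitary $\bar u$ and a projection $\bar p$. $\mathcal{K}$ is the algebra of compact operators on a separable infinite-dimensional Hilbert space, viewed as the universal $C^*$-algebra generated by elements $x_i$, $i\in\mathbb{N}_0$, with relations $x_i^*x_j=\delta_{ij}x_0$ for all $i,j\in\mathbb{N}_0$ (so $x_0$ is a minimal projection, and $x_i$ is the matrix unit $e_{i0}$). *)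

theory Defs
  imports "HOL-Analysis.Abstract_Metric_Spaces" "HOL-Algebra.Ideal" "HOL-Algebra.Module"
begin

section \<open>C*-algebras on explicit carriers\<close>

text \<open>
  Ideals, subalgebras and the test algebras of a universal property are all needed as algebras in
  their own right, so a C*-algebra is a structure on a carrier set.  It need not be unital: as
  for \<^locale>\<open>Module.module\<close>, the field \<open>one\<close> of the record is meaningless unless
  \<open>unital_cstar_algebra\<close> is assumed.
\<close>

definition complex_ring :: "complex ring" where
  "complex_ring = \<lparr>carrier = UNIV, mult = (*), one = 1, zero = 0, add = (+)\<rparr>"

lemma complex_ring_simps [simp]:
  "carrier complex_ring = UNIV"
  "mult complex_ring = (*)"
  "one complex_ring = 1"
  "zero complex_ring = 0"
  "add complex_ring = (+)"
  by (simp_all add: complex_ring_def)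

lemma cring_complex_ring: "cring complex_ring"
proof -
  have "\<exists>y. y + x = 0 \<and> x + y = 0" for x :: complex
    by (rule exI[of _ "- x"]) simp
  then have "abelian_group complex_ring"
    by (intro abelian_groupI) (auto simp: add.assoc add.commute)
  moreover have "Group.comm_monoid complex_ring"
    by (intro comm_monoidI) (auto simp: mult.assoc mult.commute)
  ultimately show ?thesis
    by (intro cringI) (auto simp: distrib_right)
qed

record 'a cstar = "(complex, 'a) module" +
  adj :: "'a \<Rightarrow> 'a"
  cnorm :: "'a \<Rightarrow> real"

text \<open>The distance is set to 0 off the carrier, as \<^locale>\<open>Metric_space\<close> requires symmetry and
  nonnegativity on the whole type.\<close>

definition cdist :: "('a, 'm) cstar_scheme \<Rightarrow> 'a \<Rightarrow> 'a \<Rightarrow> real" where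
  "cdist A x y = (if x \<in> carrier A \<and> y \<in> carrier A then cnorm A (x \<ominus>\<^bsub>A\<^esub> y) else 0)"

abbreviation norm_topology :: "('a, 'm) cstar_scheme \<Rightarrow> 'a topology" where
  "norm_topology A \<equiv> Metric_space.mtopology (carrier A) (cdist A)"

locale cstar_algebra = Module.module complex_ring A for A (structure) +
  assumes mult_closed: "\<lbrakk>x \<in> carrier A; y \<in> carrier A\<rbrakk> \<Longrightarrow> x \<otimes> y \<in> carrier A"
    and mult_assoc: "\<lbrakk>x \<in> carrier A; y \<in> carrier A; z \<in> carrier A\<rbrakk>
      \<Longrightarrow> (x \<otimes> y) \<otimes> z = x \<otimes> (y \<otimes> z)"
    and mult_add_left: "\<lbrakk>x \<in> carrier A; y \<in> carrier A; z \<in> carrier A\<rbrakk>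
      \<Longrightarrow> (x \<oplus> y) \<otimes> z = x \<otimes> z \<oplus> y \<otimes> z"
    and mult_add_right: "\<lbrakk>x \<in> carrier A; y \<in> carrier A; z \<in> carrier A\<rbrakk>
      \<Longrightarrow> z \<otimes> (x \<oplus> y) = z \<otimes> x \<oplus> z \<otimes> y"
    and smult_mult_left: "\<lbrakk>x \<in> carrier A; y \<in> carrier A\<rbrakk> \<Longrightarrow> (c \<odot> x) \<otimes> y = c \<odot> (x \<otimes> y)"
    and smult_mult_right: "\<lbrakk>x \<in> carrier A; y \<in> carrier A\<rbrakk> \<Longrightarrow> x \<otimes> (c \<odot> y) = c \<odot> (x \<otimes> y)"
    and adj_closed: "x \<in> carrier A \<Longrightarrow> adj A x \<in> carrier A"
    and adj_adj: "x \<in> carrier A \<Longrightarrow> adj A (adj A x) = x"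
    and adj_add: "\<lbrakk>x \<in> carrier A; y \<in> carrier A\<rbrakk> \<Longrightarrow> adj A (x \<oplus> y) = adj A x \<oplus> adj A y"
    and adj_smult: "x \<in> carrier A \<Longrightarrow> adj A (c \<odot> x) = cnj c \<odot> adj A x"
    and adj_mult: "\<lbrakk>x \<in> carrier A; y \<in> carrier A\<rbrakk> \<Longrightarrow> adj A (x \<otimes> y) = adj A y \<otimes> adj A x"
    and cnorm_eq_0_iff: "x \<in> carrier A \<Longrightarrow> cnorm A x = 0 \<longleftrightarrow> x = \<zero>"
    and cnorm_triangle: "\<lbrakk>x \<in> carrier A; y \<in> carrier A\<rbrakk> \<Longrightarrow> cnorm A (x \<oplus> y) \<le> cnorm A x + cnorm A y"
    and cnorm_smult: "x \<in> carrier A \<Longrightarrow> cnorm A (c \<odot> x) = cmod c * cnorm A x"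
    and cnorm_mult: "\<lbrakk>x \<in> carrier A; y \<in> carrier A\<rbrakk> \<Longrightarrow> cnorm A (x \<otimes> y) \<le> cnorm A x * cnorm A y"
    and cstar_identity: "x \<in> carrier A \<Longrightarrow> cnorm A (adj A x \<otimes> x) = (cnorm A x)\<^sup>2"
    and complete: "Metric_space.mcomplete (carrier A) (cdist A)"

locale unital_cstar_algebra = cstar_algebra +
  assumes one_closed: "\<one> \<in> carrier A"
    and one_mult: "x \<in> carrier A \<Longrightarrow> \<one> \<otimes> x = x"
    and mult_one: "x \<in> carrier A \<Longrightarrow> x \<otimes> \<one> = x"

lemma (in cstar_algebra) Metric_space_cdist: "Metric_space (carrier A) (cdist A)"
proof
  have neg: "\<ominus> x = (-1) \<odot> x" if "x \<in> carrier A" for x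
  proof -
    have "x \<oplus> (-1) \<odot> x = (1 + -1) \<odot> x"
      using that smult_l_distr[of 1 "-1" x] smult_one[of x] by (simp del: add_uminus_conv_diff)
    also have "\<dots> = \<zero>"
      using that smult_l_null[of x] by simp
    finally have "x \<oplus> (-1) \<odot> x = \<zero>" .
    then show ?thesis
      using that smult_closed[of "-1" x] by (metis M.minus_unique M.a_comm M.minus_equality UNIV_I complex_ring_simps(1))
  qed
  have nneg: "cnorm A (\<ominus> x) = cnorm A x" if "x \<in> carrier A" for x
    using that by (simp add: neg cnorm_smult)
  have nonneg: "0 \<le> cnorm A x" if x: "x \<in> carrier A" for x
  proof -
    have "cnorm A (x \<oplus> \<ominus> x) \<le> cnorm A x + cnorm A (\<ominus> x)"
      using x by (intro cnorm_triangle) auto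
    moreover have "cnorm A (x \<oplus> \<ominus> x) = 0"
      using x by (simp add: M.r_neg cnorm_eq_0_iff)
    ultimately show ?thesis
      using nneg[OF x] by simp
  qed
  fix x y z
  show "0 \<le> cdist A x y"
    by (auto simp: cdist_def intro!: nonneg M.minus_closed)
  have "\<ominus> (x \<ominus> y) = y \<ominus> x" if "x \<in> carrier A" "y \<in> carrier A"
    using that by (simp add: a_minus_def M.minus_add M.a_comm)
  then show "cdist A x y = cdist A y x"
    using nneg[of "x \<ominus> y"] by (auto simp: cdist_def)
  assume x: "x \<in> carrier A" and y: "y \<in> carrier A"
  have "x \<ominus> y = \<zero> \<longleftrightarrow> x = y"
    using x y M.minus_equality[of x "\<ominus> y"] by (auto simp: a_minus_def M.r_neg)
  then show "cdist A x y = 0 \<longleftrightarrow> x = y"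
    using x y by (simp add: cdist_def cnorm_eq_0_iff)
  assume z: "z \<in> carrier A"
  have "x \<ominus> z = (x \<ominus> y) \<oplus> (y \<ominus> z)"
    using x y z by (simp add: a_minus_def M.a_assoc M.r_neg1)
  then show "cdist A x z \<le> cdist A x y + cdist A y z"
    using x y z cnorm_triangle[of "x \<ominus> y" "y \<ominus> z"] by (simp add: cdist_def)
qed

lemma (in unital_cstar_algebra) ring_axioms_unital: "ring A"
  by (intro ringI M.abelian_group_axioms monoidI)
    (auto simp: mult_closed mult_assoc mult_add_left mult_add_right one_closed one_mult mult_one)

definition cstar_subalgebra :: "'a set \<Rightarrow> ('a, 'm) cstar_scheme \<Rightarrow> bool" where
  "cstar_subalgebra H A \<longleftrightarrow>
     submodule H complex_ring A \<and>
     (\<forall>x\<in>H. \<forall>y\<in>H. x \<otimes>\<^bsub>A\<^esub> y \<in> H) \<and>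
     (\<forall>x\<in>H. adj A x \<in> H) \<and>
     closedin (norm_topology A) H"

definition cstar_generated_by :: "('a, 'm) cstar_scheme \<Rightarrow> 'a set \<Rightarrow> bool" where
  "cstar_generated_by A S \<longleftrightarrow>
     S \<subseteq> carrier A \<and> (\<forall>H. cstar_subalgebra H A \<and> S \<subseteq> H \<longrightarrow> H = carrier A)"

text \<open>As \<open>A\<close> is unital, ring ideals are automatically linear subspaces.\<close>

definition closed_ideal_generated :: "('a, 'm) cstar_scheme \<Rightarrow> 'a set \<Rightarrow> 'a set" where
  "closed_ideal_generated A S = \<Inter>{I. ideal I A \<and> closedin (norm_topology A) I \<and> S \<subseteq> I}"

definition star_hom :: "('a, 'm) cstar_scheme \<Rightarrow> ('b, 'n) cstar_scheme \<Rightarrow> ('a \<Rightarrow> 'b) \<Rightarrow> bool" where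
  "star_hom A D h \<longleftrightarrow>
     h \<in> carrier A \<rightarrow> carrier D \<and>
     (\<forall>x\<in>carrier A. \<forall>y\<in>carrier A.
        h (x \<oplus>\<^bsub>A\<^esub> y) = h x \<oplus>\<^bsub>D\<^esub> h y \<and> h (x \<otimes>\<^bsub>A\<^esub> y) = h x \<otimes>\<^bsub>D\<^esub> h y) \<and>
     (\<forall>c. \<forall>x\<in>carrier A. h (c \<odot>\<^bsub>A\<^esub> x) = c \<odot>\<^bsub>D\<^esub> h x) \<and>
     (\<forall>x\<in>carrier A. h (adj A x) = adj D (h x))"

definition unital_star_hom :: "('a, 'm) cstar_scheme \<Rightarrow> ('b, 'n) cstar_scheme \<Rightarrow> ('a \<Rightarrow> 'b) \<Rightarrow> bool" where
  "unital_star_hom A D h \<longleftrightarrow> star_hom A D h \<and> h \<one>\<^bsub>A\<^esub> = \<one>\<^bsub>D\<^esub>"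

definition star_iso :: "('a, 'm) cstar_scheme \<Rightarrow> ('b, 'n) cstar_scheme \<Rightarrow> ('a \<Rightarrow> 'b) \<Rightarrow> bool" where
  "star_iso A D h \<longleftrightarrow> star_hom A D h \<and> bij_betw h (carrier A) (carrier D)"

section \<open>The three universal C*-algebras\<close>

text \<open>
  HOL cannot quantify over types inside a formula, so the test algebras of a universal property
  are the C*-algebras carried by subsets of one fixed type.  This loses nothing: a C*-algebra
  generated by countably many elements is separable, and if \<open>d\<close> enumerates a dense subset then
  \<open>x \<mapsto> (\<lambda>n. \<parallel>x - d n\<parallel>)\<close> is injective, so such an algebra is isomorphic to one carried
  by real sequences; and a homomorphism determined by the images of countably many generators takes
  values in the subalgebra they generate.  Uniqueness of the homomorphism is implied
  by the requirement that the generators generate.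
\<close>

type_synonym test_cstar = "(nat \<Rightarrow> real) cstar"

definition isometry_elem :: "('a, 'm) cstar_scheme \<Rightarrow> 'a \<Rightarrow> bool" where
  "isometry_elem A u \<longleftrightarrow> u \<in> carrier A \<and> adj A u \<otimes>\<^bsub>A\<^esub> u = \<one>\<^bsub>A\<^esub>"

definition unitary_elem :: "('a, 'm) cstar_scheme \<Rightarrow> 'a \<Rightarrow> bool" where
  "unitary_elem A u \<longleftrightarrow>
     u \<in> carrier A \<and> adj A u \<otimes>\<^bsub>A\<^esub> u = \<one>\<^bsub>A\<^esub> \<and> u \<otimes>\<^bsub>A\<^esub> adj A u = \<one>\<^bsub>A\<^esub>"

definition projection_elem :: "('a, 'm) cstar_scheme \<Rightarrow> 'a \<Rightarrow> bool" where
  "projection_elem A p \<longleftrightarrow> p \<in> carrier A \<and> adj A p = p \<and> p \<otimes>\<^bsub>A\<^esub> p = p"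

definition twisted_isometries ::
    "real \<Rightarrow> ('a, 'm) cstar_scheme \<Rightarrow> 'a \<Rightarrow> 'a \<Rightarrow> bool" where
  "twisted_isometries \<theta> A u v \<longleftrightarrow>
     isometry_elem A u \<and> isometry_elem A v \<and>
     u \<otimes>\<^bsub>A\<^esub> v = cis (2 * pi * \<theta>) \<odot>\<^bsub>A\<^esub> (v \<otimes>\<^bsub>A\<^esub> u)"

text \<open>\<open>A\<close> is the free twist of two isometries, with universal generators \<open>u\<close> and \<open>v\<close>.\<close>

definition is_free_twist :: "real \<Rightarrow> ('a, 'm) cstar_scheme \<Rightarrow> 'a \<Rightarrow> 'a \<Rightarrow> bool" where
  "is_free_twist \<theta> A u v \<longleftrightarrow>
     unital_cstar_algebra A \<and> twisted_isometries \<theta> A u v \<and> cstar_generated_by A {u, v} \<and>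
     (\<forall>(D :: test_cstar) u' v'. unital_cstar_algebra D \<and> twisted_isometries \<theta> D u' v' \<longrightarrow>
        (\<exists>h. unital_star_hom A D h \<and> h u = u' \<and> h v = v'))"

text \<open>\<open>B\<close> is the unital free product of \<open>C(S\<^sup>1)\<close> and the two-dimensional algebra
  \<open>\<complex>\<^sup>2\<close>, i.e. the universal unital C*-algebra of a unitary \<open>U\<close> and a projection \<open>P\<close>.\<close>

definition is_free_unitary_projection :: "('a, 'm) cstar_scheme \<Rightarrow> 'a \<Rightarrow> 'a \<Rightarrow> bool" where
  "is_free_unitary_projection B U P \<longleftrightarrow>
     unital_cstar_algebra B \<and> unitary_elem B U \<and> projection_elem B P \<and>
     cstar_generated_by B {U, P} \<and>
     (\<forall>(D :: test_cstar) U' P'. unital_cstar_algebra D \<and> unitary_elem D U' \<and> projection_elem D P' \<longrightarrow>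
        (\<exists>h. unital_star_hom B D h \<and> h U = U' \<and> h P = P'))"

definition matrix_column_relations :: "('a, 'm) cstar_scheme \<Rightarrow> (nat \<Rightarrow> 'a) \<Rightarrow> bool" where
  "matrix_column_relations K x \<longleftrightarrow>
     range x \<subseteq> carrier K \<and>
     (\<forall>i j. adj K (x i) \<otimes>\<^bsub>K\<^esub> x j = (if i = j then x 0 else \<zero>\<^bsub>K\<^esub>))"

text \<open>\<open>K\<close> is the algebra of compact operators, \<open>x i\<close> being the matrix unit with entry
  1 in position \<open>(i, 0)\<close>.  The universal property is the one among not necessarily unital algebras.\<close>

definition is_compacts :: "('a, 'm) cstar_scheme \<Rightarrow> (nat \<Rightarrow> 'a) \<Rightarrow> bool" where
  "is_compacts K x \<longleftrightarrow>
     cstar_algebra K \<and> matrix_column_relations K x \<and> cstar_generated_by K (range x) \<and>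
     (\<forall>(D :: test_cstar) x'. cstar_algebra D \<and> matrix_column_relations D x' \<longrightarrow>
        (\<exists>h. star_hom K D h \<and> (\<forall>i. h (x i) = x' i)))"

section \<open>Tensor products\<close>

text \<open>
  \<open>T\<close>, with the elementary tensors \<open>tens b k\<close>, is a completion of the algebraic tensor
  product of \<open>B\<close> and \<open>K\<close> in a C*-norm.  The clause on linearly independent families says that
  the algebraic tensor product embeds into \<open>T\<close>.  C*-norms on an algebraic tensor product are
  automatically cross norms, so the clause on \<open>cnorm\<close> excludes none of them.  If \<open>B\<close> or \<open>K\<close> is
  nuclear, as the compact operators are, there is only one C*-norm, and \<open>T\<close> is the C*-tensor product.
\<close>

definition is_cstar_tensor ::
    "('b, 'l) cstar_scheme \<Rightarrow> ('k, 'm) cstar_scheme \<Rightarrow> ('t, 'n) cstar_scheme \<Rightarrow>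
     ('b \<Rightarrow> 'k \<Rightarrow> 't) \<Rightarrow> bool" where
  "is_cstar_tensor B K T tens \<longleftrightarrow>
     cstar_algebra B \<and> cstar_algebra K \<and> cstar_algebra T \<and>
     (\<forall>b\<in>carrier B. \<forall>k\<in>carrier K. tens b k \<in> carrier T) \<and>
     (\<forall>b\<in>carrier B. \<forall>b'\<in>carrier B. \<forall>k\<in>carrier K.
        tens (b \<oplus>\<^bsub>B\<^esub> b') k = tens b k \<oplus>\<^bsub>T\<^esub> tens b' k) \<and>
     (\<forall>b\<in>carrier B. \<forall>k\<in>carrier K. \<forall>k'\<in>carrier K.
        tens b (k \<oplus>\<^bsub>K\<^esub> k') = tens b k \<oplus>\<^bsub>T\<^esub> tens b k') \<and>
     (\<forall>c. \<forall>b\<in>carrier B. \<forall>k\<in>carrier K.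
        tens (c \<odot>\<^bsub>B\<^esub> b) k = c \<odot>\<^bsub>T\<^esub> tens b k \<and> tens b (c \<odot>\<^bsub>K\<^esub> k) = c \<odot>\<^bsub>T\<^esub> tens b k) \<and>
     (\<forall>b\<in>carrier B. \<forall>b'\<in>carrier B. \<forall>k\<in>carrier K. \<forall>k'\<in>carrier K.
        tens b k \<otimes>\<^bsub>T\<^esub> tens b' k' = tens (b \<otimes>\<^bsub>B\<^esub> b') (k \<otimes>\<^bsub>K\<^esub> k')) \<and>
     (\<forall>b\<in>carrier B. \<forall>k\<in>carrier K. adj T (tens b k) = tens (adj B b) (adj K k)) \<and>
     (\<forall>b\<in>carrier B. \<forall>k\<in>carrier K. cnorm T (tens b k) = cnorm B b * cnorm K k) \<and>
     (\<forall>(n::nat) b k.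
        b \<in> {..<n} \<rightarrow> carrier B \<and> k \<in> {..<n} \<rightarrow> carrier K \<and>
        (\<forall>c. (\<Oplus>\<^bsub>K\<^esub>i\<in>{..<n}. c i \<odot>\<^bsub>K\<^esub> k i) = \<zero>\<^bsub>K\<^esub> \<longrightarrow> (\<forall>i<n. c i = 0)) \<and>
        (\<Oplus>\<^bsub>T\<^esub>i\<in>{..<n}. tens (b i) (k i)) = \<zero>\<^bsub>T\<^esub> \<longrightarrow>
        (\<forall>i<n. b i = \<zero>\<^bsub>B\<^esub>)) \<and>
     cstar_generated_by T {tens b k | b k. b \<in> carrier B \<and> k \<in> carrier K}"

section \<open>The defect ideal and its distinguished elements\<close>

definition defect_ideal :: "('a, 'm) cstar_scheme \<Rightarrow> 'a \<Rightarrow> 'a \<Rightarrow> 'a set" where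
  "defect_ideal A u v =
     closed_ideal_generated A {\<one>\<^bsub>A\<^esub> \<ominus>\<^bsub>A\<^esub> u \<otimes>\<^bsub>A\<^esub> adj A u, \<one>\<^bsub>A\<^esub> \<ominus>\<^bsub>A\<^esub> v \<otimes>\<^bsub>A\<^esub> adj A v}"

definition ubar :: "('a, 'm) cstar_scheme \<Rightarrow> 'a \<Rightarrow> 'a \<Rightarrow> 'a" where
  "ubar A u v =
     u \<otimes>\<^bsub>A\<^esub> (\<one>\<^bsub>A\<^esub> \<ominus>\<^bsub>A\<^esub> v \<otimes>\<^bsub>A\<^esub> adj A v) \<oplus>\<^bsub>A\<^esub> (\<one>\<^bsub>A\<^esub> \<ominus>\<^bsub>A\<^esub> u \<otimes>\<^bsub>A\<^esub> adj A u) \<otimes>\<^bsub>A\<^esub> adj A v"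

definition pbar :: "('a, 'm) cstar_scheme \<Rightarrow> 'a \<Rightarrow> 'a \<Rightarrow> 'a" where
  "pbar A u v = v \<otimes>\<^bsub>A\<^esub> (\<one>\<^bsub>A\<^esub> \<ominus>\<^bsub>A\<^esub> u \<otimes>\<^bsub>A\<^esub> adj A u) \<otimes>\<^bsub>A\<^esub> adj A v"

end

theory Submission
  imports Defs "HOL-Analysis.Urysohn"
begin

text \<open>
  Put \<open>w = u v\<close>, an isometry, and let \<open>q = 1 - w w\<^sup>*\<close>, so that the projections \<open>w\<^sup>i q w\<^sup>*\<^sup>i\<close> are pairwise
  orthogonal.  With the defects \<open>e = 1 - u u\<^sup>*\<close> and \<open>f = 1 - v v\<^sup>*\<close> one has
  \<open>q = e + u f u\<^sup>* = f + v e v\<^sup>*\<close>.  Hence \<open>q\<close> generates the defect ideal \<open>J\<close>, and in the corner at \<open>q\<close> the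
  element \<open>U'\<close> (the theorem's \<open>ubar\<close>) is unitary and \<open>P'\<close> (its \<open>pbar\<close>) is a projection, with
  \<open>u f = U' (q - P')\<close> and \<open>e v\<^sup>* = U' P'\<close>.  Moreover \<open>w\<close> commutes up to scalars with \<open>u\<close> and
  \<open>v\<close>.  So \<open>J\<close> should consist of matrices, the \<open>(i, j)\<close> entry being an element \<open>w\<^sup>i b w\<^sup>*\<^sup>j\<close> with \<open>b\<close> in
  the algebra generated by \<open>U'\<close> and \<open>P'\<close>.

  This picture is made precise by two homomorphisms.  In one direction,
  \<open>b \<otimes> x j \<mapsto> \<lambda>\<^sup>j (U (1 - P) b \<otimes> x j + U P b \<otimes> x (j + 1))\<close>, with \<open>\<lambda>\<close> the scalar of the twist, and an
  analogous formula for \<open>v\<close>, which are forced by these identities, define isometries in the multiplier algebra of \<open>T\<close>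
  (\<open>ex_twisted_isometries\<close>).  They satisfy the twisted relation, so \<open>A\<close> maps to the multipliers of \<open>T\<close>,
  and \<open>J\<close> maps into \<open>T\<close> (\<open>h_J\<close>); this is \<open>phi\<close>.  In the other direction, \<open>B\<close> maps onto the C*-algebra
  generated by \<open>U'\<close> and \<open>P'\<close> by some \<open>psi\<close>.  The composite sends \<open>b\<close> to \<open>b \<otimes> x 0\<close>, so \<open>psi\<close> is isometric, and
  \<open>phi\<close> sends \<open>w\<^sup>i psi(b) w\<^sup>*\<^sup>j\<close> to \<open>b\<close> at the matrix position \<open>(i, j)\<close> (\<open>phi_unit\<close>).

  It remains to see that \<open>phi\<close> is isometric; then its range is closed and contains a total set.
  The projections \<open>Q n = 1 - w\<^sup>n w\<^sup>*\<^sup>n\<close> form an approximate unit of \<open>J\<close> (\<open>Q_approximate_unit\<close>), and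
  every \<open>q w\<^sup>*\<^sup>i a w\<^sup>j q\<close> lies in the range of \<open>psi\<close> (\<open>corner_entries\<close>).  Therefore \<open>phi\<close> maps the corner of
  \<open>J\<close> at \<open>Q n\<close> bijectively onto the corresponding corner of \<open>T\<close> (\<open>bij_betw_phi\<close>).  The inverse is a *-homomorphism on
  a C*-algebra, hence contractive, so \<open>phi\<close> is isometric on these corners and, by approximation, on \<open>J\<close>.
  In this way no comparison of C*-norms on the tensor product is needed.

  The general theory behind the argument is kept elementary.  That *-homomorphisms are contractive
  (\<open>star_hom_contractive\<close>) is proved without spectra; a universal property stated for test algebras
  on one fixed type is transferred to algebras of every type by copying separable subalgebras
  (\<open>ex_test_copy\<close>); multipliers are pairs of a map and its adjoint.
\<close>

section \<open>Calculation in C*-algebras on carriers\<close>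

definition cstar_lim :: "('a, 'm) cstar_scheme \<Rightarrow> (nat \<Rightarrow> 'a) \<Rightarrow> 'a \<Rightarrow> bool" where
  "cstar_lim A s l \<longleftrightarrow> (\<forall>n. s n \<in> carrier A) \<and> l \<in> carrier A \<and> (\<lambda>n. cnorm A (s n \<ominus>\<^bsub>A\<^esub> l)) \<longlonglongrightarrow> 0"

definition closed_subspace :: "('a, 'm) cstar_scheme \<Rightarrow> 'a set \<Rightarrow> bool" where
  "closed_subspace A V \<longleftrightarrow> V \<subseteq> carrier A \<and> \<zero>\<^bsub>A\<^esub> \<in> V \<and> (\<forall>x\<in>V. \<forall>y\<in>V. x \<oplus>\<^bsub>A\<^esub> y \<in> V) \<and>
     (\<forall>c. \<forall>x\<in>V. c \<odot>\<^bsub>A\<^esub> x \<in> V) \<and> (\<forall>s l. (\<forall>n. s n \<in> V) \<and> cstar_lim A s l \<longrightarrow> l \<in> V)"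

context cstar_algebra
begin

sublocale MS: Metric_space "carrier A" "cdist A"
  by (rule Metric_space_cdist)

lemma mult_in [simp, intro]: "\<lbrakk>x \<in> carrier A; y \<in> carrier A\<rbrakk> \<Longrightarrow> x \<otimes> y \<in> carrier A"
  by (rule mult_closed)

lemma adj_in [simp, intro]: "x \<in> carrier A \<Longrightarrow> adj A x \<in> carrier A"
  by (rule adj_closed)

lemma smult_in [simp, intro]: "x \<in> carrier A \<Longrightarrow> c \<odot> x \<in> carrier A"
  using smult_closed[of c x] by simp

lemma smult_add_scalar: "x \<in> carrier A \<Longrightarrow> (c + d) \<odot> x = c \<odot> x \<oplus> d \<odot> x"
  using smult_l_distr[of c d x] by simp

lemma smult_add: "\<lbrakk>x \<in> carrier A; y \<in> carrier A\<rbrakk> \<Longrightarrow> c \<odot> (x \<oplus> y) = c \<odot> x \<oplus> c \<odot> y"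
  using smult_r_distr[of c x y] by simp

lemma smult_smult [simp]: "x \<in> carrier A \<Longrightarrow> c \<odot> (d \<odot> x) = (c * d) \<odot> x"
  using smult_assoc1[of c d x] by simp

lemma smult_1 [simp]: "x \<in> carrier A \<Longrightarrow> 1 \<odot> x = x"
  using smult_one[of x] by simp

lemma smult_0_left [simp]: "x \<in> carrier A \<Longrightarrow> 0 \<odot> x = \<zero>"
  using smult_l_null[of x] by simp

lemma smult_0_right [simp]: "c \<odot> \<zero> = \<zero>"
  using smult_r_null[of c] by simp

lemma uminus_eq_smult: "x \<in> carrier A \<Longrightarrow> \<ominus> x = (-1) \<odot> x"
proof -
  assume x: "x \<in> carrier A"
  have "(-1) \<odot> x \<oplus> x = ((-1) + 1) \<odot> x"
    unfolding smult_add_scalar[OF x] using x by simp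
  then show ?thesis
    using x M.minus_equality[of "(-1) \<odot> x" x] by simp
qed

lemma minus_eq_smult: "\<lbrakk>x \<in> carrier A; y \<in> carrier A\<rbrakk> \<Longrightarrow> x \<ominus> y = x \<oplus> (-1) \<odot> y"
  by (simp add: a_minus_def uminus_eq_smult)

lemma smult_minus: "\<lbrakk>x \<in> carrier A; y \<in> carrier A\<rbrakk> \<Longrightarrow> c \<odot> (x \<ominus> y) = c \<odot> x \<ominus> c \<odot> y"
  by (simp add: minus_eq_smult smult_add mult.commute)

lemma mult_zero [simp]: "x \<in> carrier A \<Longrightarrow> x \<otimes> \<zero> = \<zero>"
  using smult_mult_right[of x \<zero> 0] by simp

lemma zero_mult [simp]: "x \<in> carrier A \<Longrightarrow> \<zero> \<otimes> x = \<zero>"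
  using smult_mult_left[of \<zero> x 0] by simp

lemma mult_minus_left: "\<lbrakk>x \<in> carrier A; y \<in> carrier A; z \<in> carrier A\<rbrakk> \<Longrightarrow> (x \<ominus> y) \<otimes> z = x \<otimes> z \<ominus> y \<otimes> z"
  by (simp add: minus_eq_smult mult_add_left smult_mult_left)

lemma mult_minus_right: "\<lbrakk>x \<in> carrier A; y \<in> carrier A; z \<in> carrier A\<rbrakk> \<Longrightarrow> z \<otimes> (x \<ominus> y) = z \<otimes> x \<ominus> z \<otimes> y"
  by (simp add: minus_eq_smult mult_add_right smult_mult_right)

lemma adj_zero [simp]: "adj A \<zero> = \<zero>"
  using adj_smult[of \<zero> 0] by simp

lemma adj_minus: "\<lbrakk>x \<in> carrier A; y \<in> carrier A\<rbrakk> \<Longrightarrow> adj A (x \<ominus> y) = adj A x \<ominus> adj A y"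
  by (simp add: minus_eq_smult adj_add adj_smult)

lemma minus_self [simp]: "x \<in> carrier A \<Longrightarrow> x \<ominus> x = \<zero>"
  by (simp add: a_minus_def M.r_neg)

lemma minus_zero [simp]: "x \<in> carrier A \<Longrightarrow> x \<ominus> \<zero> = x"
  by (simp add: a_minus_def)

lemma minus_eq_zero_iff: "\<lbrakk>x \<in> carrier A; y \<in> carrier A\<rbrakk> \<Longrightarrow> x \<ominus> y = \<zero> \<longleftrightarrow> x = y"
  using M.minus_equality[of x "\<ominus> y"] by (auto simp: a_minus_def M.r_neg)

lemma add_minus_cancel: "\<lbrakk>x \<in> carrier A; y \<in> carrier A\<rbrakk> \<Longrightarrow> (x \<ominus> y) \<oplus> y = x"
  by (simp add: a_minus_def M.a_assoc M.l_neg)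

lemma minus_add_minus: "\<lbrakk>x \<in> carrier A; y \<in> carrier A; z \<in> carrier A; w \<in> carrier A\<rbrakk>
    \<Longrightarrow> (x \<oplus> y) \<ominus> (z \<oplus> w) = (x \<ominus> z) \<oplus> (y \<ominus> w)"
  by (simp add: a_minus_def M.minus_add M.a_ac)

lemma minus_telescope: "\<lbrakk>x \<in> carrier A; y \<in> carrier A; z \<in> carrier A\<rbrakk> \<Longrightarrow> (x \<ominus> y) \<oplus> (y \<ominus> z) = x \<ominus> z"
  by (simp add: a_minus_def M.a_assoc M.r_neg1)

section \<open>The norm\<close>

lemma cnorm_zero [simp]: "cnorm A \<zero> = 0"
  by (simp add: cnorm_eq_0_iff)

lemma cdist_eq: "\<lbrakk>x \<in> carrier A; y \<in> carrier A\<rbrakk> \<Longrightarrow> cdist A x y = cnorm A (x \<ominus> y)"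
  by (simp add: cdist_def)

lemma cnorm_nonneg [simp]: "x \<in> carrier A \<Longrightarrow> 0 \<le> cnorm A x"
  using MS.nonneg[of x \<zero>] by (simp add: cdist_eq)

lemma cnorm_minus_commute: "\<lbrakk>x \<in> carrier A; y \<in> carrier A\<rbrakk> \<Longrightarrow> cnorm A (x \<ominus> y) = cnorm A (y \<ominus> x)"
  using MS.commute[of x y] by (simp add: cdist_eq)

lemma cnorm_triangle_minus: "\<lbrakk>x \<in> carrier A; y \<in> carrier A\<rbrakk> \<Longrightarrow> cnorm A (x \<ominus> y) \<le> cnorm A x + cnorm A y"
  using cnorm_triangle[of x "(-1) \<odot> y"] by (simp add: minus_eq_smult cnorm_smult)

lemma cnorm_triangle_diff: "\<lbrakk>x \<in> carrier A; y \<in> carrier A\<rbrakk> \<Longrightarrow> cnorm A x \<le> cnorm A (x \<ominus> y) + cnorm A y"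
  using cnorm_triangle[of "x \<ominus> y" y] by (simp add: add_minus_cancel)

lemma cnorm_adj [simp]:
  assumes "x \<in> carrier A" shows "cnorm A (adj A x) = cnorm A x"
proof -
  have le: "cnorm A y \<le> cnorm A (adj A y)" if y: "y \<in> carrier A" for y
  proof (cases "cnorm A y = 0")
    case False
    have "cnorm A y * cnorm A y \<le> cnorm A (adj A y) * cnorm A y"
      using cstar_identity[OF y] cnorm_mult[of "adj A y" y] y by (simp add: power2_eq_square)
    then show ?thesis
      using False y cnorm_nonneg[of y] by (simp add: mult_le_cancel_right del: cnorm_nonneg)
  qed (use y in simp)
  show ?thesis
    using le[of x] le[of "adj A x"] assms by (simp add: adj_adj)
qed

lemma cnorm_projection_le_1:
  assumes "p \<in> carrier A" "adj A p = p" "p \<otimes> p = p" shows "cnorm A p \<le> 1"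
proof -
  have "cnorm A p * cnorm A p = cnorm A p"
    using cstar_identity[of p] assms by (simp add: power2_eq_square)
  then show ?thesis
    by (cases "cnorm A p = 0") auto
qed

text \<open>Partial isometries are contractions.\<close>

lemma cnorm_le_1_if_adj_mult_projection:
  assumes "a \<in> carrier A" "(adj A a \<otimes> a) \<otimes> (adj A a \<otimes> a) = adj A a \<otimes> a" shows "cnorm A a \<le> 1"
proof -
  have "cnorm A (adj A a \<otimes> a) \<le> 1"
    using assms by (intro cnorm_projection_le_1) (simp_all add: adj_mult adj_adj)
  then show ?thesis
    using cstar_identity[of a] assms(1) by (simp add: power_le_one_iff)
qed

section \<open>Limits of sequences\<close>

lemma cstar_limD: "cstar_lim A s l \<Longrightarrow> s n \<in> carrier A" "cstar_lim A s l \<Longrightarrow> l \<in> carrier A"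
  "cstar_lim A s l \<Longrightarrow> (\<lambda>n. cnorm A (s n \<ominus> l)) \<longlonglongrightarrow> 0"
  by (auto simp: cstar_lim_def)

lemma cstar_limI:
  assumes "\<And>n. s n \<in> carrier A" "l \<in> carrier A" "\<And>n. cnorm A (s n \<ominus> l) \<le> e n" "e \<longlonglongrightarrow> 0"
  shows "cstar_lim A s l"
  unfolding cstar_lim_def
  using assms by (auto intro!: tendsto_sandwich[OF _ _ tendsto_const assms(4)] always_eventually)

lemma limitin_iff_cstar_lim:
  assumes "\<And>n. s n \<in> carrier A"
  shows "limitin MS.mtopology s l sequentially \<longleftrightarrow> cstar_lim A s l"
  unfolding MS.limit_metric_sequentially cstar_lim_def LIMSEQ_def
  using assms by (auto simp: cdist_eq dist_real_def)

lemma closedin_iff_seq: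
  "closedin (norm_topology A) H \<longleftrightarrow>
     H \<subseteq> carrier A \<and> (\<forall>s l. (\<forall>n. s n \<in> H) \<and> cstar_lim A s l \<longrightarrow> l \<in> H)"
  unfolding MS.metric_closedin_iff_sequentially_closed
  by (intro conj_cong refl iff_allI) (auto simp: image_subset_iff cstar_limD(1) limitin_iff_cstar_lim subset_iff)

lemma cauchy_imp_cstar_lim:
  assumes s: "\<And>n. s n \<in> carrier A"
    and "\<And>e. e > 0 \<Longrightarrow> \<exists>N. \<forall>m\<ge>N. \<forall>n\<ge>N. cnorm A (s m \<ominus> s n) < e"
  obtains l where "cstar_lim A s l"
proof -
  have "MS.MCauchy s"
    unfolding MS.MCauchy_def using assms by (auto simp: cdist_eq)
  then show ?thesis
    using complete limitin_iff_cstar_lim[of s] s that unfolding MS.mcomplete_def by blast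
qed

lemma cstar_lim_cauchy:
  assumes "cstar_lim A s l" "e > 0"
  shows "\<exists>N. \<forall>m\<ge>N. \<forall>n\<ge>N. cnorm A (s m \<ominus> s n) < e"
proof -
  have "MS.MCauchy s"
    using assms(1) limitin_iff_cstar_lim[of s l] MS.convergent_imp_MCauchy[of s] cstar_limD(1)[OF assms(1)] by auto
  then show ?thesis
    using assms unfolding MS.MCauchy_def by (auto simp: cdist_eq image_subset_iff)
qed

lemma cstar_lim_unique:
  assumes "cstar_lim A s l" "cstar_lim A s l'" shows "l = l'"
  using assms limitin_iff_cstar_lim[of s] MS.limitin_metric_unique[of s l sequentially l']
  by (auto simp: cstar_limD)

lemma cstar_lim_const: "l \<in> carrier A \<Longrightarrow> cstar_lim A (\<lambda>_. l) l"
  by (simp add: cstar_lim_def)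

lemma cstar_lim_eventually_const:
  assumes "\<And>n. s n \<in> carrier A" "l \<in> carrier A" "\<And>n. n \<ge> N \<Longrightarrow> s n = l"
  shows "cstar_lim A s l"
  unfolding cstar_lim_def using assms
  by (auto intro!: tendsto_eventually eventually_sequentiallyI[of N])

text \<open>Continuity of a map at one point.  The estimate is only asked for differences with the limit, and for linear
  \<open>h\<close> it is boundedness of \<open>h\<close>.\<close>

lemma cstar_lim_linear_bounded:
  assumes s: "cstar_lim A s l" and B: "cstar_algebra B"
    and h: "\<And>x. x \<in> carrier A \<Longrightarrow> h x \<in> carrier B"
    and bd: "\<And>x. x \<in> carrier A \<Longrightarrow> cnorm B (h x \<ominus>\<^bsub>B\<^esub> h l) \<le> C * cnorm A (x \<ominus> l)"
  shows "cstar_lim B (\<lambda>n. h (s n)) (h l)"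
proof -
  interpret B: cstar_algebra B by (rule B)
  show ?thesis
  proof (rule B.cstar_limI)
    show "(\<lambda>n. C * cnorm A (s n \<ominus> l)) \<longlonglongrightarrow> 0"
      using tendsto_mult_left[OF cstar_limD(3)[OF s], of C] by simp
  qed (use cstar_limD[OF s] h bd in auto)
qed

lemma cstar_lim_add:
  assumes "cstar_lim A s l" "cstar_lim A t m" shows "cstar_lim A (\<lambda>n. s n \<oplus> t n) (l \<oplus> m)"
proof (rule cstar_limI)
  note [simp] = cstar_limD(1,2)[OF assms(1)] cstar_limD(1,2)[OF assms(2)]
  show "cnorm A (s n \<oplus> t n \<ominus> (l \<oplus> m)) \<le> cnorm A (s n \<ominus> l) + cnorm A (t n \<ominus> m)" for n
    by (simp add: minus_add_minus cnorm_triangle)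
  show "(\<lambda>n. cnorm A (s n \<ominus> l) + cnorm A (t n \<ominus> m)) \<longlonglongrightarrow> 0"
    using tendsto_add[OF cstar_limD(3)[OF assms(1)] cstar_limD(3)[OF assms(2)]] by simp
qed (use assms in \<open>auto simp: cstar_limD\<close>)

lemma cstar_lim_mult_left:
  assumes "cstar_lim A s l" "a \<in> carrier A" shows "cstar_lim A (\<lambda>n. a \<otimes> s n) (a \<otimes> l)"
  by (rule cstar_lim_linear_bounded[OF assms(1) cstar_algebra_axioms, where C = "cnorm A a"])
    (use assms cstar_limD[OF assms(1)] in \<open>auto simp flip: mult_minus_right intro!: cnorm_mult\<close>)

lemma cstar_lim_mult_right:
  assumes "cstar_lim A s l" "a \<in> carrier A" shows "cstar_lim A (\<lambda>n. s n \<otimes> a) (l \<otimes> a)"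
  by (rule cstar_lim_linear_bounded[OF assms(1) cstar_algebra_axioms, where C = "cnorm A a"])
    (use assms cstar_limD[OF assms(1)] in
      \<open>auto simp flip: mult_minus_left intro!: order_trans[OF cnorm_mult]\<close>)

lemma cstar_lim_smult:
  assumes "cstar_lim A s l" shows "cstar_lim A (\<lambda>n. c \<odot> s n) (c \<odot> l)"
  by (rule cstar_lim_linear_bounded[OF assms(1) cstar_algebra_axioms, where C = "cmod c"])
    (use assms cstar_limD[OF assms(1)] in \<open>auto simp flip: smult_minus simp: cnorm_smult\<close>)

lemma cstar_lim_adj:
  assumes "cstar_lim A s l" shows "cstar_lim A (\<lambda>n. adj A (s n)) (adj A l)"
  by (rule cstar_lim_linear_bounded[OF assms(1) cstar_algebra_axioms, where C = 1])
    (use assms cstar_limD[OF assms(1)] in \<open>auto simp flip: adj_minus\<close>)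

lemma cstar_lim_norm:
  assumes "cstar_lim A s l" shows "(\<lambda>n. cnorm A (s n)) \<longlonglongrightarrow> cnorm A l"
proof (rule Lim_transform2[where f = "\<lambda>_. cnorm A l"])
  note [simp] = cstar_limD(1,2)[OF assms]
  show "(\<lambda>n. cnorm A l - cnorm A (s n)) \<longlonglongrightarrow> 0"
  proof (rule tendsto_rabs_zero_cancel, rule tendsto_sandwich[OF _ _ tendsto_const cstar_limD(3)[OF assms]])
    have "\<bar>cnorm A l - cnorm A (s n)\<bar> \<le> cnorm A (s n \<ominus> l)" for n
      using cnorm_triangle_diff[of l "s n"] cnorm_triangle_diff[of "s n" l] cnorm_minus_commute[of l "s n"]
      by simp
    then show "\<forall>\<^sub>F n in sequentially. \<bar>cnorm A l - cnorm A (s n)\<bar> \<le> cnorm A (s n \<ominus> l)"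
      by simp
  qed simp
qed simp

lemma cstar_lim_norm_le:
  assumes "cstar_lim A s l" "\<And>n. cnorm A (s n) \<le> C" shows "cnorm A l \<le> C"
  using LIMSEQ_le_const2[OF cstar_lim_norm[OF assms(1)]] assms(2) by blast

section \<open>Closed subspaces, subalgebras and ideals\<close>

lemma closed_subspaceI:
  assumes "V \<subseteq> carrier A" "\<zero> \<in> V" "\<And>x y. x \<in> V \<Longrightarrow> y \<in> V \<Longrightarrow> x \<oplus> y \<in> V"
    "\<And>c x. x \<in> V \<Longrightarrow> c \<odot> x \<in> V" "\<And>s l. (\<And>n. s n \<in> V) \<Longrightarrow> cstar_lim A s l \<Longrightarrow> l \<in> V"
  shows "closed_subspace A V"
  using assms unfolding closed_subspace_def by blast

lemma closed_subspaceD: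
  assumes "closed_subspace A V"
  shows "V \<subseteq> carrier A" "x \<in> V \<Longrightarrow> x \<in> carrier A" "\<zero> \<in> V" "x \<in> V \<Longrightarrow> y \<in> V \<Longrightarrow> x \<oplus> y \<in> V"
    "x \<in> V \<Longrightarrow> c \<odot> x \<in> V" "x \<in> V \<Longrightarrow> y \<in> V \<Longrightarrow> x \<ominus> y \<in> V"
    "(\<And>n. s n \<in> V) \<Longrightarrow> cstar_lim A s l \<Longrightarrow> l \<in> V"
proof -
  show *: "V \<subseteq> carrier A" "\<zero> \<in> V" "x \<in> V \<Longrightarrow> y \<in> V \<Longrightarrow> x \<oplus> y \<in> V"
    "x \<in> V \<Longrightarrow> c \<odot> x \<in> V" "(\<And>n. s n \<in> V) \<Longrightarrow> cstar_lim A s l \<Longrightarrow> l \<in> V"  for x y c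
    using assms unfolding closed_subspace_def by blast+
  then show "x \<in> V \<Longrightarrow> x \<in> carrier A" by blast
  show "x \<ominus> y \<in> V" if "x \<in> V" "y \<in> V"
    using *(1) *(3)[OF that(1) *(4)[OF that(2), of "-1"]] that by (simp add: minus_eq_smult subset_iff)
qed

lemma closed_subspace_carrier: "closed_subspace A (carrier A)"
  by (rule closed_subspaceI) (auto dest: cstar_limD)

lemma closed_subspace_zero: "closed_subspace A {\<zero>}"
proof (rule closed_subspaceI)
  fix s l assume s: "\<And>n. s n \<in> {\<zero>}" and l: "cstar_lim A s l"
  have "s = (\<lambda>_. \<zero>)" using s by auto
  then show "l \<in> {\<zero>}"
    using cstar_lim_unique[OF l, of \<zero>] by (simp add: cstar_lim_const)
qed auto

lemma closed_subspace_Int: "closed_subspace A V \<Longrightarrow> closed_subspace A W \<Longrightarrow> closed_subspace A (V \<inter> W)"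
  unfolding closed_subspace_def by blast

lemma closed_subspace_All:
  assumes "\<And>i. closed_subspace A (V i)" shows "closed_subspace A {x. \<forall>i. x \<in> V i}"
  by (rule closed_subspaceI) (auto simp: closed_subspaceD(3-5)[OF assms] dest: closed_subspaceD(2)[OF assms]
     intro: closed_subspaceD(7)[OF assms])

text \<open>The index set must be nonempty because an empty intersection would not be contained in the carrier.\<close>

lemma closed_subspace_Ball:
  assumes "S \<noteq> {}" and V: "\<And>i. i \<in> S \<Longrightarrow> closed_subspace A (V i)"
  shows "closed_subspace A {x. \<forall>i\<in>S. x \<in> V i}"
proof (rule closed_subspaceI)
  show "{x. \<forall>i\<in>S. x \<in> V i} \<subseteq> carrier A"
    using assms(1) closed_subspaceD(1)[OF V] by blast
  show "l \<in> {x. \<forall>i\<in>S. x \<in> V i}" if "\<And>n. s n \<in> {x. \<forall>i\<in>S. x \<in> V i}" "cstar_lim A s l" for s l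
    using that closed_subspaceD(7)[OF V, of _ s l] by blast
qed (use closed_subspaceD(3-5)[OF V] in auto)

lemma closed_subspace_preimage:
  assumes B: "cstar_algebra B" and V: "closed_subspace B V"
    and h: "\<And>x. x \<in> carrier A \<Longrightarrow> h x \<in> carrier B"
    and add: "\<And>x y. x \<in> carrier A \<Longrightarrow> y \<in> carrier A \<Longrightarrow> h (x \<oplus> y) = h x \<oplus>\<^bsub>B\<^esub> h y"
    and smult: "\<And>c x. x \<in> carrier A \<Longrightarrow> h (c \<odot> x) = c \<odot>\<^bsub>B\<^esub> h x"
    and bd: "\<And>x. x \<in> carrier A \<Longrightarrow> cnorm B (h x) \<le> C * cnorm A x"
  shows "closed_subspace A {x \<in> carrier A. h x \<in> V}"
proof -
  interpret B: cstar_algebra B by (rule B)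
  note V = B.closed_subspaceD[OF V]
  have h0: "h \<zero> = \<zero>\<^bsub>B\<^esub>"
    using smult[of \<zero> 0] h[of \<zero>] by simp
  have hm: "h (x \<ominus> y) = h x \<ominus>\<^bsub>B\<^esub> h y" if "x \<in> carrier A" "y \<in> carrier A" for x y
    using that by (simp add: minus_eq_smult B.minus_eq_smult add smult h)
  show ?thesis
  proof (rule closed_subspaceI)
    fix s l assume s: "\<And>n. s n \<in> {x \<in> carrier A. h x \<in> V}" and l: "cstar_lim A s l"
    have "cstar_lim B (\<lambda>n. h (s n)) (h l)"
      by (rule cstar_lim_linear_bounded[OF l B, where C = C]) (use h bd cstar_limD(2)[OF l] in \<open>auto simp flip: hm\<close>)
    then show "l \<in> {x \<in> carrier A. h x \<in> V}"
      using V(7)[of "\<lambda>n. h (s n)" "h l"] s cstar_limD(2)[OF l] by auto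
  qed (auto simp: h0 add smult V)
qed

lemma closed_subspace_mult_left:
  assumes "closed_subspace A V" "a \<in> carrier A"
  shows "closed_subspace A {x \<in> carrier A. a \<otimes> x \<in> V}"
  by (rule closed_subspace_preimage[OF cstar_algebra_axioms assms(1), where C = "cnorm A a"])
    (use assms in \<open>auto simp: mult_add_right smult_mult_right cnorm_mult\<close>)

lemma closed_subspace_mult_right:
  assumes "closed_subspace A V" "a \<in> carrier A"
  shows "closed_subspace A {x \<in> carrier A. x \<otimes> a \<in> V}"
  by (rule closed_subspace_preimage[OF cstar_algebra_axioms assms(1), where C = "cnorm A a"])
    (use assms in \<open>auto simp: mult_add_left smult_mult_left intro!: order_trans[OF cnorm_mult]\<close>)

lemma closed_subspace_adj:
  assumes "closed_subspace A V"
  shows "closed_subspace A {x \<in> carrier A. adj A x \<in> V}"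
proof (rule closed_subspaceI)
  fix s l assume s: "\<And>n. s n \<in> {x \<in> carrier A. adj A x \<in> V}" and l: "cstar_lim A s l"
  then show "l \<in> {x \<in> carrier A. adj A x \<in> V}"
    using closed_subspaceD(7)[OF assms _ cstar_lim_adj[OF l]] cstar_limD(2)[OF l] by auto
qed (use closed_subspaceD[OF assms] in \<open>auto simp: adj_add adj_smult\<close>)

lemma cstar_subalgebra_iff:
  "cstar_subalgebra H A \<longleftrightarrow>
     closed_subspace A H \<and> (\<forall>x\<in>H. \<forall>y\<in>H. x \<otimes> y \<in> H) \<and> (\<forall>x\<in>H. adj A x \<in> H)"
proof
  assume "cstar_subalgebra H A"
  then have *: "submodule H complex_ring A" "closedin (norm_topology A) H"
    "\<forall>x\<in>H. \<forall>y\<in>H. x \<otimes> y \<in> H" "\<forall>x\<in>H. adj A x \<in> H"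
    by (auto simp: cstar_subalgebra_def)
  interpret H: submodule H complex_ring A by (rule *(1))
  have "closed_subspace A H"
    using *(2) H.subset H.one_closed H.m_closed H.smult_closed
    unfolding closed_subspace_def closedin_iff_seq by auto
  then show "closed_subspace A H \<and> (\<forall>x\<in>H. \<forall>y\<in>H. x \<otimes> y \<in> H) \<and> (\<forall>x\<in>H. adj A x \<in> H)"
    using * by blast
next
  assume H: "closed_subspace A H \<and> (\<forall>x\<in>H. \<forall>y\<in>H. x \<otimes> y \<in> H) \<and> (\<forall>x\<in>H. adj A x \<in> H)"
  then have V: "closed_subspace A H" by blast
  have "submodule H complex_ring A"
    by (rule submoduleI) (use closed_subspaceD[OF V] in \<open>auto simp: uminus_eq_smult subset_iff\<close>)
  moreover have "closedin (norm_topology A) H"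
    using V unfolding closed_subspace_def closedin_iff_seq by auto
  ultimately show "cstar_subalgebra H A"
    using H by (auto simp: cstar_subalgebra_def)
qed

lemma cstar_subalgebraI:
  assumes "closed_subspace A H" "\<And>x y. x \<in> H \<Longrightarrow> y \<in> H \<Longrightarrow> x \<otimes> y \<in> H" "\<And>x. x \<in> H \<Longrightarrow> adj A x \<in> H"
  shows "cstar_subalgebra H A"
  using assms by (auto simp: cstar_subalgebra_iff)

lemma cstar_subalgebraD:
  assumes "cstar_subalgebra H A"
  shows "closed_subspace A H" "x \<in> H \<Longrightarrow> y \<in> H \<Longrightarrow> x \<otimes> y \<in> H" "x \<in> H \<Longrightarrow> adj A x \<in> H"
  using assms by (auto simp: cstar_subalgebra_iff)

lemma cstar_subalgebra_carrier: "cstar_subalgebra (carrier A) A"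
  by (simp add: cstar_subalgebra_iff closed_subspace_carrier)

lemma cstar_subalgebra_corner:
  assumes p: "p \<in> carrier A" "adj A p = p" "p \<otimes> p = p"
  shows "cstar_subalgebra {x \<in> carrier A. p \<otimes> x = x \<and> x \<otimes> p = x} A"
proof (rule cstar_subalgebraI)
  have "closed_subspace A ({x \<in> carrier A. x \<ominus> p \<otimes> x \<in> {\<zero>}} \<inter> {x \<in> carrier A. x \<ominus> x \<otimes> p \<in> {\<zero>}})"
  proof (intro closed_subspace_Int)
    have C: "cnorm A (x \<ominus> p \<otimes> x) \<le> (1 + cnorm A p) * cnorm A x" "cnorm A (x \<ominus> x \<otimes> p) \<le> (1 + cnorm A p) * cnorm A x"
      if "x \<in> carrier A" for x
      using that p(1) cnorm_triangle_minus[of x "p \<otimes> x"] cnorm_triangle_minus[of x "x \<otimes> p"]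
        cnorm_mult[of x p] cnorm_mult[of p x] by (auto simp: algebra_simps)
    show "closed_subspace A {x \<in> carrier A. x \<ominus> p \<otimes> x \<in> {\<zero>}}"
      by (rule closed_subspace_preimage[OF cstar_algebra_axioms closed_subspace_zero, where C = "1 + cnorm A p"])
        (use p(1) C in \<open>auto simp: mult_add_right smult_mult_right minus_add_minus smult_minus\<close>)
    show "closed_subspace A {x \<in> carrier A. x \<ominus> x \<otimes> p \<in> {\<zero>}}"
      by (rule closed_subspace_preimage[OF cstar_algebra_axioms closed_subspace_zero, where C = "1 + cnorm A p"])
        (use p(1) C in \<open>auto simp: mult_add_left smult_mult_left minus_add_minus smult_minus\<close>)
  qed
  moreover have "{x \<in> carrier A. x \<ominus> p \<otimes> x \<in> {\<zero>}} \<inter> {x \<in> carrier A. x \<ominus> x \<otimes> p \<in> {\<zero>}}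
      = {x \<in> carrier A. p \<otimes> x = x \<and> x \<otimes> p = x}"
    using p(1) by (auto simp: minus_eq_zero_iff)
  ultimately show "closed_subspace A {x \<in> carrier A. p \<otimes> x = x \<and> x \<otimes> p = x}" by simp
  fix x y assume x: "x \<in> {x \<in> carrier A. p \<otimes> x = x \<and> x \<otimes> p = x}"
  then show "adj A x \<in> {x \<in> carrier A. p \<otimes> x = x \<and> x \<otimes> p = x}"
    using p adj_mult[of p x] adj_mult[of x p] by auto
  assume y: "y \<in> {x \<in> carrier A. p \<otimes> x = x \<and> x \<otimes> p = x}"
  show "x \<otimes> y \<in> {x \<in> carrier A. p \<otimes> x = x \<and> x \<otimes> p = x}"
    using x y p(1) by (auto simp: mult_assoc) (simp flip: mult_assoc)
qed

lemma generated_eqI: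
  assumes "cstar_generated_by A S" "cstar_subalgebra H A" "S \<subseteq> H" "x \<in> carrier A" shows "x \<in> H"
  using assms by (auto simp: cstar_generated_by_def)

text \<open>A closed subspace that the generators and their adjoints multiply into itself is a left ideal,
  because the elements that do so form a C*-subalgebra.\<close>

lemma left_stable:
  assumes gen: "cstar_generated_by A S" and L: "closed_subspace A L"
    and S: "\<And>s y. s \<in> S \<Longrightarrow> y \<in> L \<Longrightarrow> s \<otimes> y \<in> L" "\<And>s y. s \<in> S \<Longrightarrow> y \<in> L \<Longrightarrow> adj A s \<otimes> y \<in> L"
    and "a \<in> carrier A" "y \<in> L"
  shows "a \<otimes> y \<in> L"
proof -
  define W where "W = {x. \<forall>y\<in>L. x \<in> {x \<in> carrier A. x \<otimes> y \<in> L}}"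
  have "closed_subspace A W"
    unfolding W_def using closed_subspaceD(2,3)[OF L]
    by (intro closed_subspace_Ball closed_subspace_mult_right L) auto
  then have "cstar_subalgebra (W \<inter> {x \<in> carrier A. adj A x \<in> W}) A"
    using closed_subspaceD(2)[OF L]
    by (intro cstar_subalgebraI closed_subspace_Int closed_subspace_adj)
      (auto simp: W_def adj_adj adj_mult mult_assoc)
  moreover have "S \<subseteq> W \<inter> {x \<in> carrier A. adj A x \<in> W}"
    using S gen by (auto simp: W_def cstar_generated_by_def subset_iff)
  ultimately show ?thesis
    using generated_eqI[OF gen] assms(5,6) W_def by blast
qed

text \<open>If products and adjoints of generators stay in the closed linear span of the generators, then that
  span is a C*-subalgebra, hence everything.\<close>

lemma closed_subspace_total:
  assumes gen: "cstar_generated_by A S" and V: "closed_subspace A V" and "S \<subseteq> V"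
    and S0: "\<And>W x y. closed_subspace A W \<Longrightarrow> S \<subseteq> W \<Longrightarrow> x \<in> S \<Longrightarrow> y \<in> S \<Longrightarrow> x \<otimes> y \<in> W \<and> adj A x \<in> W"
    and "x \<in> carrier A"
  shows "x \<in> V"
proof -
  have SA: "S \<subseteq> carrier A" using gen by (simp add: cstar_generated_by_def)
  define Z where "Z = {z. \<forall>W\<in>{W. closed_subspace A W \<and> S \<subseteq> W}. z \<in> W}"
  have Z: "closed_subspace A Z"
    unfolding Z_def by (intro closed_subspace_Ball) (use V assms(3) in auto)
  have SZ: "S \<subseteq> Z" by (auto simp: Z_def)
  have ZW: "Z \<subseteq> W" if "closed_subspace A W" "S \<subseteq> W" for W using that by (auto simp: Z_def)
  have "Z \<subseteq> {x \<in> carrier A. x \<otimes> y \<in> Z}" if "y \<in> S" for y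
    using that SA S0[OF Z SZ] by (intro ZW closed_subspace_mult_right Z) auto
  then have "Z \<subseteq> {y \<in> carrier A. x \<otimes> y \<in> Z}" if "x \<in> Z" for x
    using that SA closed_subspaceD(2)[OF Z] by (intro ZW closed_subspace_mult_left Z) auto
  moreover have "Z \<subseteq> {x \<in> carrier A. adj A x \<in> Z}"
    using SA S0[OF Z SZ] by (intro ZW closed_subspace_adj Z) auto
  ultimately have "cstar_subalgebra Z A"
    by (intro cstar_subalgebraI Z) auto
  then show ?thesis
    using generated_eqI[OF gen _ SZ] ZW[OF V] assms by blast
qed

end

section \<open>Contractivity of *-homomorphisms\<close>

context cstar_algebra
begin

lemma square_minus_square:
  assumes "x \<in> carrier A" "y \<in> carrier A"
  shows "x \<otimes> x \<ominus> y \<otimes> y = x \<otimes> (x \<ominus> y) \<oplus> (x \<ominus> y) \<otimes> y"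
  using assms by (simp add: mult_minus_left mult_minus_right minus_telescope)

text \<open>A square root without functional calculus, and without a unit: the last equation says
  \<open>(1 - s)\<^sup>2 = 1 - a\<^sup>2\<close>.  On the ball of radius \<open>1/2\<close> the map \<open>s \<mapsto> (s\<^sup>2 + a\<^sup>2)/2\<close> is a contraction, and it
  preserves the self-adjoint elements of \<open>H\<close> that commute with \<open>a\<close>, so Banach's theorem applies.\<close>

lemma ex_contraction_fixpoint:
  assumes H: "cstar_subalgebra H A" and a: "a \<in> H" "adj A a = a" "cnorm A a \<le> 1/2"
  obtains s where "s \<in> H" "adj A s = s" "s \<otimes> a = a \<otimes> s" "2 \<odot> s = s \<otimes> s \<oplus> a \<otimes> a"
proof -
  note cl = closed_subspaceD[OF cstar_subalgebraD(1)[OF H]]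
  have aA [simp]: "a \<in> carrier A" using a cl by blast
  define X where "X = {s \<in> H. adj A s = s \<and> s \<otimes> a = a \<otimes> s \<and> cnorm A s \<le> 1/2}"
  define f where "f s = (1/2) \<odot> (s \<otimes> s \<oplus> a \<otimes> a)" for s
  have XA: "s \<in> carrier A" if "s \<in> X" for s using that cl(2) by (simp add: X_def)
  have sq: "cnorm A (s \<otimes> s) \<le> 1/4" if "s \<in> carrier A" "cnorm A s \<le> 1/2" for s
    using cnorm_mult[of s s] that mult_mono[of "cnorm A s" "1/2" "cnorm A s" "1/2"] by simp
  have fX: "f s \<in> X" if s: "s \<in> X" for s
  proof -
    note sA = XA[OF s]
    have "cnorm A (f s) = 1/2 * cnorm A (s \<otimes> s \<oplus> a \<otimes> a)"
      unfolding f_def using sA by (subst cnorm_smult) auto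
    also have "\<dots> \<le> 1/2 * (1/4 + 1/4)"
      using sq[of s] sq[of a] cnorm_triangle[of "s \<otimes> s" "a \<otimes> a"] sA s a by (auto simp: X_def)
    finally have "cnorm A (f s) \<le> 1/2" by simp
    moreover have "f s \<otimes> a = a \<otimes> f s"
    proof -
      have sa: "s \<otimes> a = a \<otimes> s" using s by (simp add: X_def)
      have "s \<otimes> s \<otimes> a = s \<otimes> (a \<otimes> s)" using sA by (simp add: mult_assoc sa)
      also have "\<dots> = s \<otimes> a \<otimes> s" using sA by (simp add: mult_assoc)
      also have "\<dots> = a \<otimes> (s \<otimes> s)" using sA by (simp add: mult_assoc sa)
      finally have "s \<otimes> s \<otimes> a = a \<otimes> (s \<otimes> s)" .
      then show ?thesis
        unfolding f_def using sA
        by (simp add: smult_mult_left smult_mult_right mult_add_left mult_add_right mult_assoc)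
    qed
    moreover have "f s \<in> H" "adj A (f s) = f s"
      using s a cl(4,5) cstar_subalgebraD(2)[OF H] sA unfolding f_def X_def
      by (auto simp: adj_smult adj_add adj_mult)
    ultimately show ?thesis by (simp add: X_def)
  qed
  have con: "cdist A (f s) (f t) \<le> 1/2 * cdist A s t" if s: "s \<in> X" and t: "t \<in> X" for s t
  proof -
    note [simp] = XA[OF s] XA[OF t]
    have n: "cnorm A s \<le> 1/2" "cnorm A t \<le> 1/2" using s t by (auto simp: X_def)
    have "f s \<ominus> f t = (1/2) \<odot> (s \<otimes> (s \<ominus> t) \<oplus> (s \<ominus> t) \<otimes> t)"
      unfolding f_def by (simp flip: smult_minus add: minus_add_minus square_minus_square)
    then have "cnorm A (f s \<ominus> f t) = 1/2 * cnorm A (s \<otimes> (s \<ominus> t) \<oplus> (s \<ominus> t) \<otimes> t)"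
      by (simp add: cnorm_smult)
    also have "\<dots> \<le> 1/2 * (cnorm A s * cnorm A (s \<ominus> t) + cnorm A (s \<ominus> t) * cnorm A t)"
      using cnorm_triangle[of "s \<otimes> (s \<ominus> t)" "(s \<ominus> t) \<otimes> t"] cnorm_mult[of s "s \<ominus> t"] cnorm_mult[of "s \<ominus> t" t]
      by simp
    also have "\<dots> \<le> 1/2 * (1/2 * cnorm A (s \<ominus> t) + cnorm A (s \<ominus> t) * (1/2))"
      using n by (intro mult_left_mono add_mono mult_right_mono) auto
    finally show ?thesis by (simp add: cdist_eq f_def)
  qed
  have closed: "closedin MS.mtopology X"
    unfolding closedin_iff_seq
  proof (intro conjI allI impI)
    show "X \<subseteq> carrier A" using XA by blast
    fix s l assume "(\<forall>n. s n \<in> X) \<and> cstar_lim A s l"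
    then have s: "\<And>n. s n \<in> X" and l: "cstar_lim A s l" by blast+
    have "adj A l = l"
      using cstar_lim_adj[OF l] s by (intro cstar_lim_unique[OF _ l]) (simp add: X_def)
    moreover have "l \<otimes> a = a \<otimes> l"
      using cstar_lim_mult_left[OF l aA] cstar_lim_mult_right[OF l aA] s
      by (intro cstar_lim_unique[of "\<lambda>n. a \<otimes> s n"]) (simp_all add: X_def)
    moreover have "l \<in> H" using cl(7)[OF _ l] s by (simp add: X_def)
    moreover have "cnorm A l \<le> 1/2" by (rule cstar_lim_norm_le[OF l]) (use s in \<open>simp add: X_def\<close>)
    ultimately show "l \<in> X" by (simp add: X_def)
  qed
  have XM: "Metric_space X (cdist A)" using XA by (intro MS.subspace) blast
  have XC: "Metric_space.mcomplete X (cdist A)"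
    by (rule Submetric.closedin_mcomplete_imp_mcomplete[OF Submetric.intro[OF Metric_space_cdist Submetric_axioms.intro] closed complete]) (use XA in blast)
  obtain s where "s \<in> X" "f s = s"
  proof (rule Metric_space.Banach_fixedpoint_thm[OF XM XC, of f "1/2"])
    show "X \<noteq> {}" using cl(3) by (auto simp: X_def intro!: exI[of _ \<zero>])
  qed (use fX con in auto)
  moreover have "2 \<odot> f s = s \<otimes> s \<oplus> a \<otimes> a"
    unfolding f_def using XA[OF \<open>s \<in> X\<close>] by simp
  ultimately show ?thesis
    using that[of s] by (simp add: X_def)
qed

end

lemma star_homD:
  assumes "star_hom A B h"
  shows "x \<in> carrier A \<Longrightarrow> h x \<in> carrier B"
    "x \<in> carrier A \<Longrightarrow> y \<in> carrier A \<Longrightarrow> h (x \<oplus>\<^bsub>A\<^esub> y) = h x \<oplus>\<^bsub>B\<^esub> h y"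
    "x \<in> carrier A \<Longrightarrow> y \<in> carrier A \<Longrightarrow> h (x \<otimes>\<^bsub>A\<^esub> y) = h x \<otimes>\<^bsub>B\<^esub> h y"
    "x \<in> carrier A \<Longrightarrow> h (c \<odot>\<^bsub>A\<^esub> x) = c \<odot>\<^bsub>B\<^esub> h x"
    "x \<in> carrier A \<Longrightarrow> h (adj A x) = adj B (h x)"
  using assms by (auto simp: star_hom_def)

lemma star_homI:
  assumes "\<And>x. x \<in> carrier A \<Longrightarrow> h x \<in> carrier B"
    "\<And>x y. x \<in> carrier A \<Longrightarrow> y \<in> carrier A \<Longrightarrow> h (x \<oplus>\<^bsub>A\<^esub> y) = h x \<oplus>\<^bsub>B\<^esub> h y"
    "\<And>x y. x \<in> carrier A \<Longrightarrow> y \<in> carrier A \<Longrightarrow> h (x \<otimes>\<^bsub>A\<^esub> y) = h x \<otimes>\<^bsub>B\<^esub> h y"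
    "\<And>c x. x \<in> carrier A \<Longrightarrow> h (c \<odot>\<^bsub>A\<^esub> x) = c \<odot>\<^bsub>B\<^esub> h x"
    "\<And>x. x \<in> carrier A \<Longrightarrow> h (adj A x) = adj B (h x)"
  shows "star_hom A B h"
  using assms by (auto simp: star_hom_def)

lemma star_hom_comp: "star_hom A B h \<Longrightarrow> star_hom B C k \<Longrightarrow> star_hom A C (\<lambda>x. k (h x))"
  by (rule star_homI) (simp_all add: star_homD)

text \<open>Used to remove the constant from a bound: the C*-identity turns a bound with a constant into bounds for all
  iterated squares of a self-adjoint element.\<close>

lemma le_if_iterated_squares_le:
  fixes r m C :: real
  assumes "0 \<le> m" "\<And>n. r ^ (2 ^ n) \<le> C * m ^ (2 ^ n)"
  shows "r \<le> m"
proof (rule ccontr)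
  assume "\<not> r \<le> m"
  then have "m < r" by simp
  show False
  proof (cases "m = 0")
    case True
    then show False using assms(2)[of 0] \<open>m < r\<close> by simp
  next
    case False
    then have m: "m > 0" using assms(1) by simp
    have "(r / m) ^ (2 ^ n) \<le> C" for n
      using assms(2)[of n] m by (simp add: power_divide divide_le_eq)
    moreover obtain k where "C < (r / m) ^ k"
      using real_arch_pow[of "r / m" C] m \<open>m < r\<close> by auto
    moreover have "(r / m) ^ k \<le> (r / m) ^ (2 ^ k)"
      using m \<open>m < r\<close> by (intro power_increasing) auto
    ultimately show False by (meson leD le_less_trans less_le_trans)
  qed
qed

text \<open>For self-adjoint \<open>a\<close> of norm at most \<open>1/2\<close>, let \<open>s\<close> be the fixed point found above, \<open>b = h a\<close> and
  \<open>t = h s\<close>.  Then \<open>1 - t + \<i> b\<close> is formally unitary, that is, \<open>z = \<i> b - t\<close> satisfies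
  \<open>z\<^sup>* z = - (z + z\<^sup>*)\<close>.  This bounds \<open>z\<close>, hence also \<open>b\<close>, which is a combination of \<open>z\<close> and \<open>z\<^sup>*\<close>.  So \<open>h\<close> is
  bounded on self-adjoint elements; taking iterated squares brings the bound down to 1, and the
  C*-identity extends it to all elements.\<close>

theorem star_hom_contractive:
  assumes "cstar_algebra A" "cstar_algebra B" and H: "cstar_subalgebra H A"
    and h: "star_hom (A\<lparr>carrier := H\<rparr>) B h" and x: "x \<in> H"
  shows "cnorm B (h x) \<le> cnorm A x"
proof -
  interpret A: cstar_algebra A by fact
  interpret B: cstar_algebra B by fact
  note cl = A.closed_subspaceD[OF A.cstar_subalgebraD(1)[OF H]]
  note H' = A.cstar_subalgebraD(2,3)[OF H]
  note h = star_homD[OF h, simplified]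
  have bd: "cnorm B (h a) \<le> 2" if a: "a \<in> H" "adj A a = a" "cnorm A a \<le> 1/2" for a
  proof -
    obtain s where s: "s \<in> H" "adj A s = s" "s \<otimes>\<^bsub>A\<^esub> a = a \<otimes>\<^bsub>A\<^esub> s" "2 \<odot>\<^bsub>A\<^esub> s = s \<otimes>\<^bsub>A\<^esub> s \<oplus>\<^bsub>A\<^esub> a \<otimes>\<^bsub>A\<^esub> a"
      using A.ex_contraction_fixpoint[OF H a] by blast
    define b where "b = h a"
    define t where "t = h s"
    have [simp]: "b \<in> carrier B" "t \<in> carrier B" using a s h by (auto simp: b_def t_def)
    have adjs: "adj B b = b" "adj B t = t" using h(5) a s by (auto simp: b_def t_def) (metis, metis)
    have tb: "t \<otimes>\<^bsub>B\<^esub> b = b \<otimes>\<^bsub>B\<^esub> t" using h(3) a s by (auto simp: b_def t_def) (metis)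
    have t2: "2 \<odot>\<^bsub>B\<^esub> t = t \<otimes>\<^bsub>B\<^esub> t \<oplus>\<^bsub>B\<^esub> b \<otimes>\<^bsub>B\<^esub> b"
      using h(2,3,4) a s H' by (metis b_def t_def)
    define z where "z = \<i> \<odot>\<^bsub>B\<^esub> b \<oplus>\<^bsub>B\<^esub> (-1) \<odot>\<^bsub>B\<^esub> t"
    have [simp]: "z \<in> carrier B" by (simp add: z_def)
    have az: "adj B z = (-\<i>) \<odot>\<^bsub>B\<^esub> b \<oplus>\<^bsub>B\<^esub> (-1) \<odot>\<^bsub>B\<^esub> t"
      by (simp add: z_def B.adj_add B.adj_smult adjs)
    have "adj B z \<otimes>\<^bsub>B\<^esub> z = b \<otimes>\<^bsub>B\<^esub> b \<oplus>\<^bsub>B\<^esub> (-\<i>) \<odot>\<^bsub>B\<^esub> (b \<otimes>\<^bsub>B\<^esub> t) \<oplus>\<^bsub>B\<^esub> (\<i> \<odot>\<^bsub>B\<^esub> (b \<otimes>\<^bsub>B\<^esub> t) \<oplus>\<^bsub>B\<^esub> t \<otimes>\<^bsub>B\<^esub> t)"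
      unfolding az unfolding z_def
      by (simp add: B.mult_add_left B.mult_add_right B.smult_mult_left B.smult_mult_right B.smult_add tb)
    also have "\<dots> = b \<otimes>\<^bsub>B\<^esub> b \<oplus>\<^bsub>B\<^esub> ((\<i> \<odot>\<^bsub>B\<^esub> (b \<otimes>\<^bsub>B\<^esub> t) \<oplus>\<^bsub>B\<^esub> (-\<i>) \<odot>\<^bsub>B\<^esub> (b \<otimes>\<^bsub>B\<^esub> t)) \<oplus>\<^bsub>B\<^esub> t \<otimes>\<^bsub>B\<^esub> t)"
      by (simp add: B.M.a_ac)
    also have "\<dots> = 2 \<odot>\<^bsub>B\<^esub> t"
      by (simp flip: B.smult_add_scalar add: t2 B.M.a_ac)
    finally have zz: "adj B z \<otimes>\<^bsub>B\<^esub> z = 2 \<odot>\<^bsub>B\<^esub> t" .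
    have "z \<oplus>\<^bsub>B\<^esub> adj B z = (\<i> \<odot>\<^bsub>B\<^esub> b \<oplus>\<^bsub>B\<^esub> (-\<i>) \<odot>\<^bsub>B\<^esub> b) \<oplus>\<^bsub>B\<^esub> ((-1) \<odot>\<^bsub>B\<^esub> t \<oplus>\<^bsub>B\<^esub> (-1) \<odot>\<^bsub>B\<^esub> t)"
      unfolding az unfolding z_def by (simp add: B.M.a_ac)
    also have "\<dots> = (-2) \<odot>\<^bsub>B\<^esub> t"
      by (simp flip: B.smult_add_scalar)
    finally have "cnorm B (z \<oplus>\<^bsub>B\<^esub> adj B z) = cnorm B (2 \<odot>\<^bsub>B\<^esub> t)"
      by (simp add: B.cnorm_smult)
    then have "(cnorm B z)\<^sup>2 = cnorm B (z \<oplus>\<^bsub>B\<^esub> adj B z)"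
      using B.cstar_identity[of z] zz by simp
    also have "\<dots> \<le> 2 * cnorm B z"
      using B.cnorm_triangle[of z "adj B z"] by simp
    finally have z2: "cnorm B z \<le> 2"
      using B.cnorm_nonneg[of z] by (cases "cnorm B z = 0") (auto simp: power2_eq_square mult_le_cancel_right simp del: B.cnorm_nonneg)
    have "z \<ominus>\<^bsub>B\<^esub> adj B z = (\<i> \<odot>\<^bsub>B\<^esub> b \<oplus>\<^bsub>B\<^esub> \<i> \<odot>\<^bsub>B\<^esub> b) \<oplus>\<^bsub>B\<^esub> ((-1) \<odot>\<^bsub>B\<^esub> t \<oplus>\<^bsub>B\<^esub> 1 \<odot>\<^bsub>B\<^esub> t)"
      unfolding az unfolding z_def
      by (simp add: B.minus_eq_smult B.smult_add B.M.a_ac del: B.smult_1)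
    also have "\<dots> = (2 * \<i>) \<odot>\<^bsub>B\<^esub> b"
      by (simp flip: B.smult_add_scalar del: B.smult_1)
    finally have "2 * cnorm B b = cnorm B (z \<ominus>\<^bsub>B\<^esub> adj B z)"
      by (simp add: B.cnorm_smult norm_mult)
    also have "\<dots> \<le> 4"
      using B.cnorm_triangle_minus[of z "adj B z"] z2 by simp
    finally show ?thesis by (simp add: b_def)
  qed
  have bd4: "cnorm B (h a) \<le> 4 * cnorm A a" if a: "a \<in> H" "adj A a = a" for a
  proof (cases "cnorm A a = 0")
    case True
    then have "a = 0 \<odot>\<^bsub>A\<^esub> a" using a cl(2) by (simp add: A.cnorm_eq_0_iff)
    then have "h a = 0 \<odot>\<^bsub>B\<^esub> h a" using h(4)[OF a(1), of 0] by simp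
    then show ?thesis using h(1)[OF a(1)] True by simp
  next
    case False
    have aA: "a \<in> carrier A" using a cl(2) by blast
    have p: "cnorm A a > 0" using False A.cnorm_nonneg[OF aA] by simp
    let ?c = "complex_of_real (1 / (2 * cnorm A a))"
    have "cnorm B (h (?c \<odot>\<^bsub>A\<^esub> a)) \<le> 2"
      using a aA p by (intro bd) (auto simp: cl A.adj_smult A.cnorm_smult norm_divide norm_mult)
    then have "(1 / (2 * cnorm A a)) * cnorm B (h a) \<le> 2"
      using a p h(1,4) by (simp add: B.cnorm_smult norm_divide norm_mult)
    then show ?thesis using p by (simp add: field_simps)
  qed
  have sa: "cnorm B (h a) \<le> cnorm A a" if a: "a \<in> H" "adj A a = a" for a
  proof (rule le_if_iterated_squares_le)
    show "0 \<le> cnorm A a" using a cl(2) by simp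
    fix n
    have "\<exists>c\<in>H. adj A c = c \<and> cnorm A c = cnorm A a ^ (2 ^ n) \<and> cnorm B (h c) = cnorm B (h a) ^ (2 ^ n)"
    proof (induction n)
      case (Suc n)
      then obtain c where c: "c \<in> H" "adj A c = c" "cnorm A c = cnorm A a ^ (2 ^ n)"
        "cnorm B (h c) = cnorm B (h a) ^ (2 ^ n)" by blast
      have cA: "c \<in> carrier A" using c cl(2) by blast
      have "adj B (h c) = h c" using h(5) c by metis
      then have "cnorm B (h (c \<otimes>\<^bsub>A\<^esub> c)) = (cnorm B (h c))\<^sup>2"
        using B.cstar_identity[OF h(1)[OF c(1)]] h(3) c by simp
      moreover have "cnorm A (c \<otimes>\<^bsub>A\<^esub> c) = (cnorm A c)\<^sup>2"
        using A.cstar_identity[OF cA] c by simp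
      moreover have "c \<otimes>\<^bsub>A\<^esub> c \<in> H" "adj A (c \<otimes>\<^bsub>A\<^esub> c) = c \<otimes>\<^bsub>A\<^esub> c"
        using c cA H' by (auto simp: A.adj_mult)
      ultimately show ?case
        using c by (intro bexI[of _ "c \<otimes>\<^bsub>A\<^esub> c"]) (auto simp flip: power_mult simp: mult.commute)
    qed (use a in auto)
    then show "cnorm B (h a) ^ (2 ^ n) \<le> 4 * cnorm A a ^ (2 ^ n)"
      using bd4 by metis
  qed
  have xA: "x \<in> carrier A" using x cl(2) by blast
  have "(cnorm B (h x))\<^sup>2 = cnorm B (h (adj A x \<otimes>\<^bsub>A\<^esub> x))"
    using B.cstar_identity[OF h(1)[OF x]] h(3,5) x H' by simp
  also have "\<dots> \<le> cnorm A (adj A x \<otimes>\<^bsub>A\<^esub> x)"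
    using x xA H' by (intro sa) (auto simp: A.adj_mult A.adj_adj)
  also have "\<dots> = (cnorm A x)\<^sup>2" by (rule A.cstar_identity[OF xA])
  finally show ?thesis
    using A.cnorm_nonneg[OF xA] by (simp add: power_mono_iff h(1) x)
qed

corollary star_hom_norm_le:
  assumes "cstar_algebra A" "cstar_algebra B" "star_hom A B h" "x \<in> carrier A"
  shows "cnorm B (h x) \<le> cnorm A x"
  using star_hom_contractive[OF assms(1,2) cstar_algebra.cstar_subalgebra_carrier[OF assms(1)]] assms(3,4)
  by simp

locale cstar_hom = A: cstar_algebra A + B: cstar_algebra B
  for A (structure) and B (structure) and h +
  assumes hom: "star_hom A B h"
begin

lemmas h_closed [simp, intro] = star_homD(1)[OF hom]
lemmas h_add = star_homD(2)[OF hom]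
lemmas h_mult = star_homD(3)[OF hom]
lemmas h_smult = star_homD(4)[OF hom]
lemmas h_adj = star_homD(5)[OF hom]

lemma h_norm_le: "x \<in> carrier A \<Longrightarrow> cnorm B (h x) \<le> cnorm A x"
  by (rule star_hom_norm_le[OF A.cstar_algebra_axioms B.cstar_algebra_axioms hom])

lemma h_zero [simp]: "h \<zero>\<^bsub>A\<^esub> = \<zero>\<^bsub>B\<^esub>"
  using h_smult[of "\<zero>\<^bsub>A\<^esub>" 0] by simp

lemma h_minus: "x \<in> carrier A \<Longrightarrow> y \<in> carrier A \<Longrightarrow> h (x \<ominus>\<^bsub>A\<^esub> y) = h x \<ominus>\<^bsub>B\<^esub> h y"
  by (simp add: A.minus_eq_smult B.minus_eq_smult h_add h_smult)

lemma h_lim: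
  assumes s: "cstar_lim A s l" shows "cstar_lim B (\<lambda>n. h (s n)) (h l)"
  by (rule A.cstar_lim_linear_bounded[OF s B.cstar_algebra_axioms, where C = 1])
    (use A.cstar_limD(2)[OF s] h_norm_le in \<open>auto simp flip: h_minus\<close>)

lemma closed_subspace_vimage:
  "closed_subspace B V \<Longrightarrow> closed_subspace A {x \<in> carrier A. h x \<in> V}"
  by (rule A.closed_subspace_preimage[OF B.cstar_algebra_axioms, where C = 1])
    (auto simp: h_add h_smult h_norm_le)

lemma closed_subspace_image:
  assumes V: "closed_subspace A V" and iso: "\<And>x. x \<in> V \<Longrightarrow> cnorm A x \<le> cnorm B (h x)"
  shows "closed_subspace B (h ` V)"
proof (rule B.closed_subspaceI)
  note cl = A.closed_subspaceD[OF V]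
  fix s l assume s: "\<And>n. s n \<in> h ` V" and l: "cstar_lim B s l"
  have "\<exists>t. t \<in> V \<and> h t = s n" for n using s[of n] by auto
  then obtain t where t: "\<And>n. t n \<in> V" "\<And>n. h (t n) = s n" by metis
  obtain m where m: "cstar_lim A t m"
  proof (rule A.cauchy_imp_cstar_lim)
    show "t n \<in> carrier A" for n using t cl by blast
    fix e :: real assume "e > 0"
    then obtain N where N: "\<And>m n. m \<ge> N \<Longrightarrow> n \<ge> N \<Longrightarrow> cnorm B (s m \<ominus>\<^bsub>B\<^esub> s n) < e"
      using B.cstar_lim_cauchy[OF l] by blast
    have "cnorm A (t m \<ominus>\<^bsub>A\<^esub> t n) \<le> cnorm B (s m \<ominus>\<^bsub>B\<^esub> s n)" for m n
      using iso[OF cl(6)[OF t(1) t(1)], of m n] t cl(2) by (simp add: h_minus)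
    then show "\<exists>N. \<forall>m\<ge>N. \<forall>n\<ge>N. cnorm A (t m \<ominus>\<^bsub>A\<^esub> t n) < e"
      using N le_less_trans by blast
  qed
  then have "h m = l"
    using h_lim[OF m] B.cstar_lim_unique[OF _ l] t(2) by simp
  then show "l \<in> h ` V" using cl(7)[OF t(1) m] by blast
next
  note cl = A.closed_subspaceD[OF V]
  show "h ` V \<subseteq> carrier B" using cl by auto
  show "\<zero>\<^bsub>B\<^esub> \<in> h ` V" using cl(3) by (auto intro!: rev_image_eqI[of "\<zero>\<^bsub>A\<^esub>"])
  fix x assume x: "x \<in> h ` V"
  show "c \<odot>\<^bsub>B\<^esub> x \<in> h ` V" for c
    using x cl(2,5) by (auto simp flip: h_smult)
  fix y assume "y \<in> h ` V"
  then show "x \<oplus>\<^bsub>B\<^esub> y \<in> h ` V"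
    using x cl(2,4) by (auto simp flip: h_add)
qed

end

lemma star_hom_eq_on_generators:
  assumes A: "cstar_algebra A" and B: "cstar_algebra B" and h: "star_hom A B h" and k: "star_hom A B k"
    and gen: "cstar_generated_by A S" and eq: "\<And>s. s \<in> S \<Longrightarrow> h s = k s" and x: "x \<in> carrier A"
  shows "h x = k x"
proof -
  interpret h: cstar_hom A B h by (intro cstar_hom.intro cstar_hom_axioms.intro A B h)
  interpret k: cstar_hom A B k by (intro cstar_hom.intro cstar_hom_axioms.intro A B k)
  define E where "E = {x \<in> carrier A. h x = k x}"
  have "cstar_subalgebra E A"
  proof (rule h.A.cstar_subalgebraI)
    show "closed_subspace A E"
    proof (rule h.A.closed_subspaceI)
      fix s l assume s: "\<And>n. s n \<in> E" and l: "cstar_lim A s l"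
      show "l \<in> E"
        using h.h_lim[OF l] k.h_lim[OF l] s h.A.cstar_limD(2)[OF l]
        by (auto simp: E_def intro: h.B.cstar_lim_unique)
    qed (auto simp: E_def h.h_add k.h_add h.h_smult k.h_smult)
  qed (auto simp: E_def h.h_mult k.h_mult h.h_adj k.h_adj)
  moreover have "S \<subseteq> E"
    using gen eq by (auto simp: E_def cstar_generated_by_def)
  ultimately show ?thesis
    using h.A.generated_eqI[OF gen _ _ x] by (auto simp: E_def)
qed

section \<open>Isomorphic copies of separable C*-algebras\<close>

text \<open>Negatives are given by multiplication with \<open>-1\<close>, and completeness is stated for Cauchy sequences in
  terms of the norm, so that neither a group nor a metric space has to be constructed first.\<close>

lemma cstar_algebraI:
  fixes R :: "('b, 'm) cstar_scheme" (structure)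
  assumes zero: "\<zero> \<in> carrier R"
    and add: "\<And>x y. x \<in> carrier R \<Longrightarrow> y \<in> carrier R \<Longrightarrow> x \<oplus> y \<in> carrier R"
    and add_assoc: "\<And>x y z. x \<in> carrier R \<Longrightarrow> y \<in> carrier R \<Longrightarrow> z \<in> carrier R \<Longrightarrow> (x \<oplus> y) \<oplus> z = x \<oplus> (y \<oplus> z)"
    and add_comm: "\<And>x y. x \<in> carrier R \<Longrightarrow> y \<in> carrier R \<Longrightarrow> x \<oplus> y = y \<oplus> x"
    and zero_add: "\<And>x. x \<in> carrier R \<Longrightarrow> \<zero> \<oplus> x = x"
    and neg: "\<And>x. x \<in> carrier R \<Longrightarrow> x \<oplus> (-1) \<odot> x = \<zero>"
    and smult: "\<And>c x. x \<in> carrier R \<Longrightarrow> c \<odot> x \<in> carrier R"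
    and smult_add_scalar: "\<And>c d x. x \<in> carrier R \<Longrightarrow> (c + d) \<odot> x = c \<odot> x \<oplus> d \<odot> x"
    and smult_add: "\<And>c x y. x \<in> carrier R \<Longrightarrow> y \<in> carrier R \<Longrightarrow> c \<odot> (x \<oplus> y) = c \<odot> x \<oplus> c \<odot> y"
    and smult_smult: "\<And>c d x. x \<in> carrier R \<Longrightarrow> (c * d) \<odot> x = c \<odot> (d \<odot> x)"
    and smult_1: "\<And>x. x \<in> carrier R \<Longrightarrow> 1 \<odot> x = x"
    and mult: "\<And>x y. x \<in> carrier R \<Longrightarrow> y \<in> carrier R \<Longrightarrow> x \<otimes> y \<in> carrier R"
    and mult_assoc: "\<And>x y z. x \<in> carrier R \<Longrightarrow> y \<in> carrier R \<Longrightarrow> z \<in> carrier R \<Longrightarrow> (x \<otimes> y) \<otimes> z = x \<otimes> (y \<otimes> z)"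
    and mult_add_left: "\<And>x y z. x \<in> carrier R \<Longrightarrow> y \<in> carrier R \<Longrightarrow> z \<in> carrier R \<Longrightarrow> (x \<oplus> y) \<otimes> z = x \<otimes> z \<oplus> y \<otimes> z"
    and mult_add_right: "\<And>x y z. x \<in> carrier R \<Longrightarrow> y \<in> carrier R \<Longrightarrow> z \<in> carrier R \<Longrightarrow> z \<otimes> (x \<oplus> y) = z \<otimes> x \<oplus> z \<otimes> y"
    and smult_mult_left: "\<And>c x y. x \<in> carrier R \<Longrightarrow> y \<in> carrier R \<Longrightarrow> (c \<odot> x) \<otimes> y = c \<odot> (x \<otimes> y)"
    and smult_mult_right: "\<And>c x y. x \<in> carrier R \<Longrightarrow> y \<in> carrier R \<Longrightarrow> x \<otimes> (c \<odot> y) = c \<odot> (x \<otimes> y)"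
    and adj: "\<And>x. x \<in> carrier R \<Longrightarrow> adj R x \<in> carrier R"
    and adj_adj: "\<And>x. x \<in> carrier R \<Longrightarrow> adj R (adj R x) = x"
    and adj_add: "\<And>x y. x \<in> carrier R \<Longrightarrow> y \<in> carrier R \<Longrightarrow> adj R (x \<oplus> y) = adj R x \<oplus> adj R y"
    and adj_smult: "\<And>c x. x \<in> carrier R \<Longrightarrow> adj R (c \<odot> x) = cnj c \<odot> adj R x"
    and adj_mult: "\<And>x y. x \<in> carrier R \<Longrightarrow> y \<in> carrier R \<Longrightarrow> adj R (x \<otimes> y) = adj R y \<otimes> adj R x"
    and norm_0: "\<And>x. x \<in> carrier R \<Longrightarrow> cnorm R x = 0 \<longleftrightarrow> x = \<zero>"
    and norm_add: "\<And>x y. x \<in> carrier R \<Longrightarrow> y \<in> carrier R \<Longrightarrow> cnorm R (x \<oplus> y) \<le> cnorm R x + cnorm R y"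
    and norm_smult: "\<And>c x. x \<in> carrier R \<Longrightarrow> cnorm R (c \<odot> x) = cmod c * cnorm R x"
    and norm_mult: "\<And>x y. x \<in> carrier R \<Longrightarrow> y \<in> carrier R \<Longrightarrow> cnorm R (x \<otimes> y) \<le> cnorm R x * cnorm R y"
    and cstar: "\<And>x. x \<in> carrier R \<Longrightarrow> cnorm R (adj R x \<otimes> x) = (cnorm R x)\<^sup>2"
    and complete: "\<And>s :: nat \<Rightarrow> 'b. (\<And>n. s n \<in> carrier R) \<Longrightarrow>
        (\<And>e. e > 0 \<Longrightarrow> \<exists>N. \<forall>m\<ge>N. \<forall>n\<ge>N. cnorm R (s m \<oplus> (-1) \<odot> s n) < e) \<Longrightarrow>
        \<exists>l\<in>carrier R. \<forall>e>0. \<exists>N. \<forall>n\<ge>N. cnorm R (s n \<oplus> (-1) \<odot> l) < e"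
  shows "cstar_algebra R"
proof -
  interpret M: abelian_group R
  proof (rule abelian_groupI)
    show "\<exists>y\<in>carrier R. y \<oplus> x = \<zero>" if "x \<in> carrier R" for x
      using neg[OF that] add_comm[OF that] smult[OF that, of "-1"] that by metis
  qed (use zero add add_assoc add_comm zero_add in auto)
  have mod: "Module.module complex_ring R"
    by (rule moduleI[OF cring_complex_ring M.abelian_group_axioms])
      (auto simp: smult smult_add_scalar smult_add smult_smult smult_1)
  have neg': "\<ominus> x = (-1) \<odot> x" if "x \<in> carrier R" for x
    using that neg smult M.minus_equality[of "(-1) \<odot> x" x] add_comm by metis
  have minus: "x \<ominus> y = x \<oplus> (-1) \<odot> y" if "x \<in> carrier R" "y \<in> carrier R" for x y
    using that by (simp add: a_minus_def neg')
  have nonneg: "0 \<le> cnorm R x" if x: "x \<in> carrier R" for x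
    using norm_add[OF x smult[OF x, of "-1"]] norm_0[OF zero] norm_smult[OF x, of "-1"] neg[OF x] by simp
  have MS: "Metric_space (carrier R) (cdist R)"
  proof
    fix x y z
    show "0 \<le> cdist R x y" by (simp add: cdist_def nonneg)
    have "cnorm R (y \<ominus> x) = cnorm R ((-1) \<odot> (x \<ominus> y))" if "x \<in> carrier R" "y \<in> carrier R"
      using that by (simp flip: neg' add: a_minus_def M.minus_add M.a_comm)
    then show "cdist R x y = cdist R y x"
      by (simp add: cdist_def norm_smult)
    assume x: "x \<in> carrier R" and y: "y \<in> carrier R"
    have "x \<ominus> y = \<zero> \<longleftrightarrow> x = y"
      using x y M.minus_equality[of x "\<ominus> y"] by (auto simp: a_minus_def M.r_neg)
    then show "cdist R x y = 0 \<longleftrightarrow> x = y"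
      using x y by (simp add: cdist_def norm_0)
    assume z: "z \<in> carrier R"
    have "x \<ominus> z = (x \<ominus> y) \<oplus> (y \<ominus> z)"
      using x y z by (simp add: a_minus_def M.a_assoc M.r_neg1)
    then show "cdist R x z \<le> cdist R x y + cdist R y z"
      using x y z norm_add[of "x \<ominus> y" "y \<ominus> z"] by (simp add: cdist_def)
  qed
  then interpret MS: Metric_space "carrier R" "cdist R" .
  have "MS.mcomplete"
    unfolding MS.mcomplete_def MS.MCauchy_def
  proof (intro allI impI, elim conjE)
    fix s :: "nat \<Rightarrow> 'b" assume s: "range s \<subseteq> carrier R"
      and c: "\<forall>e>0. \<exists>N. \<forall>n n'. N \<le> n \<longrightarrow> N \<le> n' \<longrightarrow> cdist R (s n) (s n') < e"
    have s': "s n \<in> carrier R" for n using s by auto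
    have c': "\<exists>N. \<forall>m\<ge>N. \<forall>n\<ge>N. cnorm R (s m \<oplus> (-1) \<odot> s n) < e" if "e > 0" for e
      using c that s' by (simp add: cdist_def minus)
    have "\<exists>l\<in>carrier R. \<forall>e>0. \<exists>N. \<forall>n\<ge>N. cnorm R (s n \<oplus> (-1) \<odot> l) < e"
      by (rule complete[OF s']) (rule c')
    then show "\<exists>l. limitin MS.mtopology s l sequentially"
      unfolding MS.limit_metric_sequentially using s' by (auto simp: cdist_def minus)
  qed
  then show ?thesis
    by (intro cstar_algebra.intro mod cstar_algebra_axioms.intro)
      (simp_all add: assms)
qed

text \<open>The copy of \<open>H\<close> along a map \<open>f\<close> that is injective on \<open>H\<close>.  The element \<open>e\<close> of \<open>H\<close> becomes the field
  \<open>one\<close>, because a unit of \<open>H\<close> need not be the unit of \<open>A\<close>.\<close>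

definition transport_cstar ::
    "('a, 'm) cstar_scheme \<Rightarrow> 'a set \<Rightarrow> 'a \<Rightarrow> ('a \<Rightarrow> 'b) \<Rightarrow> 'b cstar" where
  "transport_cstar A H e f = (let g = the_inv_into H f in
     \<lparr>carrier = f ` H, monoid.mult = (\<lambda>x y. f (g x \<otimes>\<^bsub>A\<^esub> g y)), one = f e, zero = f \<zero>\<^bsub>A\<^esub>,
      add = (\<lambda>x y. f (g x \<oplus>\<^bsub>A\<^esub> g y)), smult = (\<lambda>c x. f (c \<odot>\<^bsub>A\<^esub> g x)),
      adj = (\<lambda>x. f (adj A (g x))), cnorm = (\<lambda>x. cnorm A (g x))\<rparr>)"

lemma (in cstar_algebra) transport_cstar:
  fixes f :: "'a \<Rightarrow> 'c"
  assumes H: "cstar_subalgebra H A" and f: "inj_on f H"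
  shows "cstar_algebra (transport_cstar A H e f)"
    and "star_hom (transport_cstar A H e f) A (the_inv_into H f)"
proof -
  note cl = closed_subspaceD[OF cstar_subalgebraD(1)[OF H]]
  note H' = cstar_subalgebraD(2,3)[OF H]
  have g [simp]: "the_inv_into H f (f x) = x" if "x \<in> H" for x
    using f that by (rule the_inv_into_f_f)
  have [simp]: "f x = f y \<longleftrightarrow> x = y" if "x \<in> H" "y \<in> H" for x y
    using f that by (auto dest: inj_onD)
  note [simp] = cl(2-5) H'
  have neg: "x \<oplus> (-1) \<odot> x = \<zero>" if "x \<in> carrier A" for x
    using M.r_neg[OF that] uminus_eq_smult[OF that] by simp
  let ?E = "transport_cstar A H e f"
  have E: "carrier ?E = f ` H" "monoid.mult ?E = (\<lambda>x y. f (the_inv_into H f x \<otimes> the_inv_into H f y))"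
    "zero ?E = f \<zero>" "add ?E = (\<lambda>x y. f (the_inv_into H f x \<oplus> the_inv_into H f y))"
    "smult ?E = (\<lambda>c x. f (c \<odot> the_inv_into H f x))" "adj ?E = (\<lambda>x. f (adj A (the_inv_into H f x)))"
    "cnorm ?E = (\<lambda>x. cnorm A (the_inv_into H f x))"
    by (simp_all add: transport_cstar_def Let_def)
  show "cstar_algebra ?E"
  proof (rule cstar_algebraI, unfold E)
    fix s :: "nat \<Rightarrow> 'c"
    assume s: "\<And>n. s n \<in> f ` H"
      and c: "\<And>e. e > 0 \<Longrightarrow> \<exists>N. \<forall>m\<ge>N. \<forall>n\<ge>N. cnorm A (the_inv_into H f (f (the_inv_into H f (s m) \<oplus>
        the_inv_into H f (f (-1 \<odot> the_inv_into H f (s n)))))) < e"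
    define t where "t n = the_inv_into H f (s n)" for n
    have t: "t n \<in> H" "s n = f (t n)" for n using s[of n] by (auto simp: t_def)
    obtain l where l: "cstar_lim A t l"
    proof (rule cauchy_imp_cstar_lim)
      show "\<exists>N. \<forall>m\<ge>N. \<forall>n\<ge>N. cnorm A (t m \<ominus> t n) < e" if "e > 0" for e
        using c[OF that] t by (simp add: minus_eq_smult)
    qed (use t in auto)
    then have lH: "l \<in> H" using cl(7)[of t l] t by blast
    show "\<exists>l\<in>f ` H. \<forall>e>0. \<exists>N. \<forall>n\<ge>N. cnorm A (the_inv_into H f (f (the_inv_into H f (s n) \<oplus>
        the_inv_into H f (f (-1 \<odot> the_inv_into H f l))))) < e"
    proof (intro bexI[of _ "f l"] allI impI)
      fix e :: real assume "e > 0"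
      then have "\<exists>N. \<forall>n\<ge>N. cnorm A (t n \<ominus> l) < e"
        using LIMSEQ_D[OF cstar_limD(3)[OF l]] lH t by simp
      then show "\<exists>N. \<forall>n\<ge>N. cnorm A (the_inv_into H f (f (the_inv_into H f (s n) \<oplus>
        the_inv_into H f (f (-1 \<odot> the_inv_into H f (f l)))))) < e"
        using t lH by (simp add: minus_eq_smult)
    qed (use lH in simp)
  qed (auto simp: M.a_ac neg mult_assoc mult_add_left mult_add_right smult_mult_left
      smult_mult_right adj_adj adj_add adj_smult adj_mult cnorm_eq_0_iff cnorm_triangle cnorm_smult
      cnorm_mult cstar_identity smult_add smult_add_scalar)
  show "star_hom ?E A (the_inv_into H f)"
    by (rule star_homI) (auto simp: E)
qed

definition rational_scalars :: "complex set" where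
  "rational_scalars = (\<lambda>(a, b). Complex (of_rat a) (of_rat b)) ` UNIV"

lemma countable_rational_scalars: "countable rational_scalars"
  by (simp add: rational_scalars_def)

lemma rational_scalars_approx:
  obtains c where "\<And>n. c n \<in> rational_scalars" "(\<lambda>n::nat. c n) \<longlonglongrightarrow> z"
proof -
  have "\<exists>q. \<bar>of_rat q - x\<bar> < 1 / real (Suc n)" for x :: real and n
  proof -
    obtain r where "x < of_rat r" "of_rat r < x + 1 / real (Suc n)"
      using of_rat_dense[of x "x + 1 / real (Suc n)"] by auto
    then show ?thesis by (intro exI[of _ r]) (simp add: abs_less_iff)
  qed
  then obtain q where q: "\<And>x n. \<bar>of_rat (q x n) - x\<bar> < 1 / real (Suc n)" by metis
  have lim: "(\<lambda>n. of_rat (q x n)) \<longlonglongrightarrow> x" for x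
  proof (rule LIM_zero_cancel, rule tendsto_rabs_zero_cancel)
    show "(\<lambda>n. \<bar>of_rat (q x n) - x\<bar>) \<longlonglongrightarrow> 0"
      using q[of x] by (intro tendsto_sandwich[OF _ _ tendsto_const LIMSEQ_Suc[OF lim_1_over_n]])
        (auto intro!: always_eventually less_imp_le)
  qed
  show ?thesis
  proof (rule that)
    show "Complex (of_rat (q (Re z) n)) (of_rat (q (Im z) n)) \<in> rational_scalars" for n
      by (force simp: rational_scalars_def)
    show "(\<lambda>n. Complex (of_rat (q (Re z) n)) (of_rat (q (Im z) n))) \<longlonglongrightarrow> z"
      using tendsto_Complex[OF lim[of "Re z"] lim[of "Im z"]] by simp
  qed
qed

context cstar_algebra
begin

text \<open>The *-polynomials in \<open>S\<close> with rational scalars, in stages.  Their union is countable and its closure is the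
  C*-algebra generated by \<open>S\<close>.\<close>

primrec rational_star_polys :: "'a set \<Rightarrow> nat \<Rightarrow> 'a set" where
  "rational_star_polys S 0 = insert \<zero> S"
| "rational_star_polys S (Suc n) = (let Q = rational_star_polys S n in
     Q \<union> (\<lambda>(x, y). x \<oplus> y) ` (Q \<times> Q) \<union> (\<lambda>(x, y). x \<otimes> y) ` (Q \<times> Q) \<union> adj A ` Q
       \<union> (\<lambda>(c, x). c \<odot> x) ` (rational_scalars \<times> Q))"

text \<open>The set \<open>D\<close> of rational *-polynomials is closed under the operations except multiplication by
  irrational scalars; its closure \<open>H\<close> is closed under these too, because scalars can be approximated.\<close>

lemma countable_generated_subalgebra:
  assumes S: "countable S" "S \<subseteq> carrier A"
  obtains H D where "cstar_subalgebra H A" "S \<subseteq> H" "\<And>G. cstar_subalgebra G A \<Longrightarrow> S \<subseteq> G \<Longrightarrow> H \<subseteq> G"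
    "countable D" "D \<noteq> {}" "D \<subseteq> carrier A" "\<And>x e. x \<in> H \<Longrightarrow> e > 0 \<Longrightarrow> \<exists>d\<in>D. cnorm A (d \<ominus> x) < e"
proof -
  define Q where "Q = rational_star_polys S"
  define D where "D = (\<Union>n. Q n)"
  define H where "H = {x \<in> carrier A. \<forall>e>0. \<exists>d\<in>D. cnorm A (d \<ominus> x) < e}"
  have "countable (Q n)" for n
    unfolding Q_def
  proof (induction n)
    case (Suc n)
    then show ?case
      unfolding rational_star_polys.simps Let_def
      by (intro countable_Un countable_image countable_SIGMA countable_rational_scalars)
  qed (simp add: S)
  then have cD: "countable D" by (auto simp: D_def)
  have mono: "Q m \<subseteq> Q n" if "m \<le> n" for m n
    using that by (induction rule: dec_induct) (auto simp: Q_def Let_def)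
  have Qin: "Q n \<subseteq> G" if G: "cstar_subalgebra G A" "S \<subseteq> G" for G n
    using closed_subspaceD(3-5)[OF cstar_subalgebraD(1)[OF G(1)]] cstar_subalgebraD(2,3)[OF G(1)] G(2)
    by (induction n) (auto simp: Q_def Let_def subset_iff)
  have DA: "D \<subseteq> carrier A"
    using Qin[OF cstar_subalgebra_carrier S(2)] by (auto simp: D_def)
  have D2: "x \<oplus> y \<in> D \<and> x \<otimes> y \<in> D" if xy: "x \<in> D" "y \<in> D" for x y
  proof -
    obtain m n where "x \<in> Q m" "y \<in> Q n" using xy by (auto simp: D_def)
    then have "x \<in> Q (max m n)" "y \<in> Q (max m n)"
      using mono[of m "max m n"] mono[of n "max m n"] by auto
    then have "x \<oplus> y \<in> Q (Suc (max m n))" "x \<otimes> y \<in> Q (Suc (max m n))"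
      by (auto simp: Q_def Let_def)
    then show ?thesis by (auto simp: D_def)
  qed
  have D1: "adj A x \<in> D" "c \<in> rational_scalars \<Longrightarrow> c \<odot> x \<in> D" if x: "x \<in> D" for x c
  proof -
    obtain m where "x \<in> Q m" using x by (auto simp: D_def)
    then have "adj A x \<in> Q (Suc m)" "c \<in> rational_scalars \<Longrightarrow> c \<odot> x \<in> Q (Suc m)"
      by (auto simp: Q_def Let_def)
    then show "adj A x \<in> D" "c \<in> rational_scalars \<Longrightarrow> c \<odot> x \<in> D" by (auto simp: D_def)
  qed
  have Hlim: "\<exists>s. (\<forall>n. s n \<in> D) \<and> cstar_lim A s x" if x: "x \<in> H" for x
  proof -
    have "\<exists>d\<in>D. cnorm A (d \<ominus> x) < 1 / real (Suc n)" for n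
      using x by (simp add: H_def)
    then obtain s where s: "\<And>n. s n \<in> D" "\<And>n. cnorm A (s n \<ominus> x) < 1 / real (Suc n)" by metis
    have "cstar_lim A s x"
      by (rule cstar_limI[where e = "\<lambda>n. 1 / real (Suc n)"])
        (use s x DA LIMSEQ_Suc[OF lim_1_over_n] in \<open>auto simp: H_def intro: less_imp_le\<close>)
    then show ?thesis using s by blast
  qed
  have limH: "x \<in> H" if s: "\<And>n. s n \<in> D" "cstar_lim A s x" for s x
  proof -
    have "\<exists>d\<in>D. cnorm A (d \<ominus> x) < e" if "e > 0" for e
      using LIMSEQ_D[OF cstar_limD(3)[OF s(2)] that] s cstar_limD(1,2)[OF s(2)] by force
    then show ?thesis using cstar_limD(2)[OF s(2)] by (simp add: H_def)
  qed
  have H0: "D \<subseteq> H" using limH[OF _ cstar_lim_const] DA by blast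
  have HA: "H \<subseteq> carrier A" by (auto simp: H_def)
  have Hclosed: "l \<in> H" if s: "\<And>n. s n \<in> H" and l: "cstar_lim A s l" for s l
  proof -
    have "\<exists>d\<in>D. cnorm A (d \<ominus> l) < e" if e: "e > 0" for e
    proof -
      obtain n where n: "cnorm A (s n \<ominus> l) < e / 2"
        using LIMSEQ_D[OF cstar_limD(3)[OF l], of "e / 2"] e cstar_limD(1,2)[OF l] by force
      obtain d where d: "d \<in> D" "cnorm A (d \<ominus> s n) < e / 2"
        using s[of n] e unfolding H_def by (auto dest: spec[of _ "e / 2"])
      have "cnorm A (d \<ominus> l) \<le> cnorm A (d \<ominus> s n) + cnorm A (s n \<ominus> l)"
        using cnorm_triangle[of "d \<ominus> s n" "s n \<ominus> l"] d DA cstar_limD(1,2)[OF l]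
        by (auto simp: minus_telescope)
      then show ?thesis using n d by (intro bexI[of _ d]) auto
    qed
    then show ?thesis using cstar_limD(2)[OF l] by (simp add: H_def)
  qed
  have radd: "x \<oplus> y \<in> H" if xy: "x \<in> H" "y \<in> H" for x y
  proof -
    obtain s t where s: "\<And>n. s n \<in> D" "cstar_lim A s x" and t: "\<And>n. t n \<in> D" "cstar_lim A t y"
      using Hlim[OF xy(1)] Hlim[OF xy(2)] by blast
    show ?thesis
      using limH[OF _ cstar_lim_add[OF s(2) t(2)]] s t D2 by blast
  qed
  have rmult: "x \<otimes> y \<in> H" if xy: "x \<in> H" "y \<in> H" for x y
  proof -
    obtain s t where s: "\<And>n. s n \<in> D" "cstar_lim A s x" and t: "\<And>n. t n \<in> D" "cstar_lim A t y"
      using Hlim[OF xy(1)] Hlim[OF xy(2)] by blast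
    have "s n \<otimes> y \<in> H" for n
      using limH[OF _ cstar_lim_mult_left[OF t(2), of "s n"]] s t D2 DA by blast
    then show ?thesis
      using Hclosed[OF _ cstar_lim_mult_right[OF s(2), of y]] xy HA by blast
  qed
  have radj: "adj A x \<in> H" if x: "x \<in> H" for x
    using Hlim[OF x] limH[OF _ cstar_lim_adj] D1 by blast
  have rsmult: "c \<odot> x \<in> H" if x: "x \<in> H" for c x
  proof -
    have rat: "q \<odot> x \<in> H" if "q \<in> rational_scalars" for q
      using Hlim[OF x] limH[OF _ cstar_lim_smult] D1 that by blast
    obtain q where q: "\<And>n. q n \<in> rational_scalars" "q \<longlonglongrightarrow> c"
      using rational_scalars_approx by blast
    have xA: "x \<in> carrier A" using x HA by blast
    have "cstar_lim A (\<lambda>n. q n \<odot> x) (c \<odot> x)"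
    proof (rule cstar_limI)
      show "cnorm A (q n \<odot> x \<ominus> c \<odot> x) \<le> cmod (q n - c) * cnorm A x" for n
        using smult_add_scalar[OF xA, of "q n" "- c"] xA
        by (simp add: minus_eq_smult flip: cnorm_smult)
      show "(\<lambda>n. cmod (q n - c) * cnorm A x) \<longlonglongrightarrow> 0"
        using tendsto_mult_left_zero[OF tendsto_norm_zero[OF LIM_zero[OF q(2)]]] .
    qed (use xA in auto)
    then show ?thesis by (rule Hclosed[OF rat[OF q(1)]])
  qed
  have "\<zero> \<in> Q 0" "S \<subseteq> Q 0" by (auto simp: Q_def)
  then have D0: "\<zero> \<in> D" "S \<subseteq> D" by (auto simp: D_def)
  show ?thesis
  proof (rule that)
    show "cstar_subalgebra H A"
    proof (rule cstar_subalgebraI[OF closed_subspaceI])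
      show "l \<in> H" if "\<And>n. s n \<in> H" "cstar_lim A s l" for s l by (rule Hclosed[OF that])
    qed (use HA H0 D0 rmult radj radd rsmult in auto)
    show "H \<subseteq> G" if G: "cstar_subalgebra G A" "S \<subseteq> G" for G
    proof
      fix x assume "x \<in> H"
      then obtain s where s: "\<And>n. s n \<in> D" "cstar_lim A s x" using Hlim by blast
      have "s n \<in> G" for n using s(1)[of n] Qin[OF G] by (auto simp: D_def)
      then show "x \<in> G" using closed_subspaceD(7)[OF cstar_subalgebraD(1)[OF G(1)]] s(2) by blast
    qed
  qed (use D0 H0 cD DA in \<open>auto simp: H_def\<close>)
qed

text \<open>An element of a separable metric space is determined by its distances to the members of a dense
  sequence, so the subalgebra generated by countably many elements has a copy on sequences of reals.\<close>

lemma ex_test_copy: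
  assumes S: "countable S" "S \<subseteq> carrier A" "e \<in> S"
  obtains E :: test_cstar and g H where "cstar_algebra E" "star_hom E A g" "bij_betw g (carrier E) H"
    "g \<one>\<^bsub>E\<^esub> = e" "\<one>\<^bsub>E\<^esub> \<in> carrier E" "S \<subseteq> H" "\<And>G. cstar_subalgebra G A \<Longrightarrow> S \<subseteq> G \<Longrightarrow> H \<subseteq> G"
proof -
  obtain H D where H: "cstar_subalgebra H A" "S \<subseteq> H" "\<And>G. cstar_subalgebra G A \<Longrightarrow> S \<subseteq> G \<Longrightarrow> H \<subseteq> G"
    and D: "countable D" "D \<noteq> {}" "D \<subseteq> carrier A" "\<And>x e. x \<in> H \<Longrightarrow> e > 0 \<Longrightarrow> \<exists>d\<in>D. cnorm A (d \<ominus> x) < e"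
    by (rule countable_generated_subalgebra[OF S(1,2)]) (rule that; assumption)
  have HA: "H \<subseteq> carrier A" using closed_subspaceD(1)[OF cstar_subalgebraD(1)[OF H(1)]] .
  \<comment> \<open>the sequence of distances to an enumeration of a dense set\<close>
  define f :: "'a \<Rightarrow> nat \<Rightarrow> real" where "f x n = cnorm A (from_nat_into D n \<ominus> x)" for x n
  have f: "inj_on f H"
  proof (rule inj_onI, rule ccontr)
    fix x y assume x: "x \<in> H" and y: "y \<in> H" and eq: "f x = f y" and "x \<noteq> y"
    have xyA: "x \<in> carrier A" "y \<in> carrier A" using x y HA by auto
    then have pos: "cnorm A (x \<ominus> y) > 0"
      using \<open>x \<noteq> y\<close> cnorm_eq_0_iff[of "x \<ominus> y"] by (simp add: minus_eq_zero_iff less_le)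
    then obtain d where d: "d \<in> D" "cnorm A (d \<ominus> x) < cnorm A (x \<ominus> y) / 2"
      using D(4)[OF x, of "cnorm A (x \<ominus> y) / 2"] by auto
    have "cnorm A (d \<ominus> x) = cnorm A (d \<ominus> y)"
      using fun_cong[OF eq] from_nat_into_surj[OF D(1) d(1)] by (auto simp: f_def)
    moreover have "cnorm A (x \<ominus> y) \<le> cnorm A (x \<ominus> d) + cnorm A (d \<ominus> y)"
      using cnorm_triangle[of "x \<ominus> d" "d \<ominus> y"] xyA d(1) D(3) by (auto simp: minus_telescope)
    moreover have "cnorm A (x \<ominus> d) = cnorm A (d \<ominus> x)"
      using xyA d(1) D(3) by (intro cnorm_minus_commute) auto
    ultimately show False using d(2) by simp
  qed
  let ?E = "transport_cstar A H e f"
  have E: "carrier ?E = f ` H" "\<one>\<^bsub>?E\<^esub> = f e" by (simp_all add: transport_cstar_def Let_def)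
  show ?thesis
  proof (rule that)
    show "cstar_algebra ?E" "star_hom ?E A (the_inv_into H f)"
      by (rule transport_cstar[OF H(1) f])+
    show "bij_betw (the_inv_into H f) (carrier ?E) H"
      unfolding E using f by (simp add: bij_betw_the_inv_into inj_on_imp_bij_betw)
    show "the_inv_into H f \<one>\<^bsub>?E\<^esub> = e" "\<one>\<^bsub>?E\<^esub> \<in> carrier ?E"
      using S(3) H(2) f by (auto simp: E the_inv_into_f_f)
  qed (use H in auto)
qed

end

section \<open>Universal properties for test algebras of any type\<close>

context cstar_algebra
begin

text \<open>If \<open>q\<close> is a unit for the generators, then it is a unit for everything they generate, since the corner at \<open>q\<close>
  is a C*-subalgebra.\<close>

lemma test_copy_unital:
  fixes E :: test_cstar
  assumes q: "q \<in> carrier A" "adj A q = q" "q \<otimes> q = q"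
    and S: "S \<subseteq> carrier A" "\<And>s. s \<in> S \<Longrightarrow> q \<otimes> s = s \<and> s \<otimes> q = s"
    and E: "cstar_algebra E" and g: "star_hom E A g" "bij_betw g (carrier E) H"
    and one: "g \<one>\<^bsub>E\<^esub> = q" "\<one>\<^bsub>E\<^esub> \<in> carrier E"
    and H: "\<And>G. cstar_subalgebra G A \<Longrightarrow> S \<subseteq> G \<Longrightarrow> H \<subseteq> G"
  shows "unital_cstar_algebra E"
proof -
  interpret E: cstar_algebra E by (rule E)
  have "H \<subseteq> {x \<in> carrier A. q \<otimes> x = x \<and> x \<otimes> q = x}"
    using S by (intro H cstar_subalgebra_corner q) auto
  then have "q \<otimes> g y = g y \<and> g y \<otimes> q = g y" if "y \<in> carrier E" for y
    using that bij_betw_apply[OF g(2) that] by auto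
  then show ?thesis
    using one inj_onD[OF bij_betw_imp_inj_on[OF g(2)]]
    by unfold_locales (simp_all add: star_homD(3)[OF g(1)])
qed

end

lemma free_twist_hom:
  assumes A: "is_free_twist \<theta> A u v"
    and D: "unital_cstar_algebra D" and uv: "twisted_isometries \<theta> D u' v'"
  obtains h where "unital_star_hom A D h" "h u = u'" "h v = v'"
proof -
  interpret D: unital_cstar_algebra D by (rule D)
  let ?S = "{\<one>\<^bsub>D\<^esub>, u', v'}"
  have uv': "u' \<in> carrier D" "v' \<in> carrier D" "adj D u' \<otimes>\<^bsub>D\<^esub> u' = \<one>\<^bsub>D\<^esub>" "adj D v' \<otimes>\<^bsub>D\<^esub> v' = \<one>\<^bsub>D\<^esub>"
    "u' \<otimes>\<^bsub>D\<^esub> v' = cis (2 * pi * \<theta>) \<odot>\<^bsub>D\<^esub> (v' \<otimes>\<^bsub>D\<^esub> u')"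
    using uv by (auto simp: twisted_isometries_def isometry_elem_def)
  obtain E :: test_cstar and g H where E: "cstar_algebra E" "star_hom E D g" "bij_betw g (carrier E) H"
    "g \<one>\<^bsub>E\<^esub> = \<one>\<^bsub>D\<^esub>" "\<one>\<^bsub>E\<^esub> \<in> carrier E" and SH: "?S \<subseteq> H" and H: "\<And>G. cstar_subalgebra G D \<Longrightarrow> ?S \<subseteq> G \<Longrightarrow> H \<subseteq> G"
    by (rule D.ex_test_copy[of ?S "\<one>\<^bsub>D\<^esub>"]) (use uv' D.one_closed in auto)
  interpret E: cstar_algebra E by (rule E)
  have adj1: "adj D \<one>\<^bsub>D\<^esub> = \<one>\<^bsub>D\<^esub>"
    using D.adj_mult[of "\<one>\<^bsub>D\<^esub>" "adj D \<one>\<^bsub>D\<^esub>"] D.one_closed D.one_mult D.mult_one D.adj_adj D.adj_in by metis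
  have uE: "unital_cstar_algebra E"
  proof (rule D.test_copy_unital[where S = ?S and H = H, OF D.one_closed adj1 D.one_mult[OF D.one_closed] _ _ E])
    show "?S \<subseteq> carrier D" using uv'(1,2) D.one_closed by simp
    show "\<one>\<^bsub>D\<^esub> \<otimes>\<^bsub>D\<^esub> s = s \<and> s \<otimes>\<^bsub>D\<^esub> \<one>\<^bsub>D\<^esub> = s" if "s \<in> ?S" for s
      using that uv'(1,2) D.one_closed by (elim insertE) (simp_all add: D.one_mult D.mult_one)
  qed (rule H)
  note inj = inj_onD[OF bij_betw_imp_inj_on[OF E(3)]]
  note hom = star_homD[OF E(2)]
  obtain a b where ab: "a \<in> carrier E" "g a = u'" "b \<in> carrier E" "g b = v'"
    using SH unfolding bij_betw_imp_surj_on[OF E(3), symmetric] by auto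
  have "twisted_isometries \<theta> E a b"
    unfolding twisted_isometries_def isometry_elem_def
    using ab E(4,5) uv' by (auto intro!: inj simp: hom)
  then obtain h where h: "unital_star_hom A E h" "h u = a" "h v = b"
    using A uE unfolding is_free_twist_def by blast
  show ?thesis
    by (rule that[of "\<lambda>x. g (h x)"])
      (use h ab E(4) in \<open>auto simp: unital_star_hom_def intro: star_hom_comp[OF _ E(2)]\<close>)
qed

text \<open>The unitary and the projection may live in the corner at a projection \<open>q\<close>, as the elements \<open>U'\<close> and
  \<open>P'\<close> of the free twist do; the homomorphism then takes the unit to \<open>q\<close>.\<close>

lemma free_unitary_projection_hom:
  assumes B: "is_free_unitary_projection B U P" and D: "cstar_algebra D"
    and q: "q \<in> carrier D" "adj D q = q" "q \<otimes>\<^bsub>D\<^esub> q = q"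
    and U': "U' \<in> carrier D" "adj D U' \<otimes>\<^bsub>D\<^esub> U' = q" "U' \<otimes>\<^bsub>D\<^esub> adj D U' = q" "q \<otimes>\<^bsub>D\<^esub> U' = U'" "U' \<otimes>\<^bsub>D\<^esub> q = U'"
    and P': "projection_elem D P'" "q \<otimes>\<^bsub>D\<^esub> P' = P'" "P' \<otimes>\<^bsub>D\<^esub> q = P'"
  obtains h where "star_hom B D h" "h \<one>\<^bsub>B\<^esub> = q" "h U = U'" "h P = P'"
proof -
  interpret D: cstar_algebra D by (rule D)
  let ?S = "{q, U', P'}"
  have P'': "P' \<in> carrier D" "adj D P' = P'" "P' \<otimes>\<^bsub>D\<^esub> P' = P'"
    using P' by (auto simp: projection_elem_def)
  obtain E :: test_cstar and g H where E: "cstar_algebra E" "star_hom E D g" "bij_betw g (carrier E) H"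
    "g \<one>\<^bsub>E\<^esub> = q" "\<one>\<^bsub>E\<^esub> \<in> carrier E" and SH: "?S \<subseteq> H" and H: "\<And>G. cstar_subalgebra G D \<Longrightarrow> ?S \<subseteq> G \<Longrightarrow> H \<subseteq> G"
    by (rule D.ex_test_copy[of ?S q]) (use q U' P'' in auto)
  interpret E: cstar_algebra E by (rule E)
  have uE: "unital_cstar_algebra E"
  proof (rule D.test_copy_unital[where S = ?S and H = H, OF q _ _ E])
    show "?S \<subseteq> carrier D" using q(1) U'(1) P''(1) by simp
    show "q \<otimes>\<^bsub>D\<^esub> s = s \<and> s \<otimes>\<^bsub>D\<^esub> q = s" if "s \<in> ?S" for s
      using that q(3) U'(4,5) P'(2,3) by (elim insertE) simp_all
  qed (rule H)
  note inj = inj_onD[OF bij_betw_imp_inj_on[OF E(3)]]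
  note hom = star_homD[OF E(2)]
  obtain a b where ab: "a \<in> carrier E" "g a = U'" "b \<in> carrier E" "g b = P'"
    using SH unfolding bij_betw_imp_surj_on[OF E(3), symmetric] by auto
  have "unitary_elem E a" "projection_elem E b"
    unfolding unitary_elem_def projection_elem_def
    using ab E(4,5) U' P'' by (auto intro!: inj simp: hom)
  then obtain h where h: "unital_star_hom B E h" "h U = a" "h P = b"
    using B uE unfolding is_free_unitary_projection_def by blast
  show ?thesis
    by (rule that[of "\<lambda>x. g (h x)"])
      (use h ab E(4) in \<open>auto simp: unital_star_hom_def intro: star_hom_comp[OF _ E(2)]\<close>)
qed

lemma compacts_hom:
  assumes K: "is_compacts K x" and D: "cstar_algebra D" and x': "matrix_column_relations D x'"
  obtains h where "star_hom K D h" "\<And>i. h (x i) = x' i"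
proof -
  interpret D: cstar_algebra D by (rule D)
  have x'': "range x' \<subseteq> carrier D"
    "\<And>i j. adj D (x' i) \<otimes>\<^bsub>D\<^esub> x' j = (if i = j then x' 0 else \<zero>\<^bsub>D\<^esub>)"
    using x' by (auto simp: matrix_column_relations_def)
  obtain E :: test_cstar and g H where E: "cstar_algebra E" "star_hom E D g" "bij_betw g (carrier E) H"
     and SH: "range x' \<subseteq> H"
    by (rule D.ex_test_copy[of "range x'" "x' 0"]) (use x'' in auto)
  interpret g: cstar_hom E D g by (intro cstar_hom.intro cstar_hom_axioms.intro E D)
  note inj = inj_onD[OF bij_betw_imp_inj_on[OF E(3)]]
  have "\<exists>y. y \<in> carrier E \<and> g y = x' i" for i
    using subsetD[OF SH rangeI[of x' i]] unfolding bij_betw_imp_surj_on[OF E(3), symmetric] by auto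
  then obtain y where y: "\<And>i. y i \<in> carrier E" "\<And>i. g (y i) = x' i" by metis
  have "matrix_column_relations E y"
    unfolding matrix_column_relations_def
    using y x'' by (auto intro!: inj simp: g.h_mult g.h_adj)
  then obtain h where h: "star_hom K E h" "\<And>i. h (x i) = y i"
    using K E(1) unfolding is_compacts_def by blast
  show ?thesis
    by (rule that[of "\<lambda>x. g (h x)"]) (use h y in \<open>auto intro: star_hom_comp[OF _ E(2)]\<close>)
qed

section \<open>The multiplier algebra\<close>

text \<open>Multipliers as adjointable operators on \<open>A\<close>, which is a Hilbert module over itself with inner product
  \<open>\<langle>x, y\<rangle> = x\<^sup>* y\<close>.  An element is a pair of an operator and its adjoint, which makes the involution a swap
  and avoids choosing adjoints.  Linearity follows from adjointability, as the inner product is nondegenerate.\<close>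

definition multiplier_algebra :: "('a, 'm) cstar_scheme \<Rightarrow> (('a \<Rightarrow> 'a) \<times> ('a \<Rightarrow> 'a)) cstar" where
  "multiplier_algebra A =
     \<lparr>carrier = {(f, g). f \<in> carrier A \<rightarrow>\<^sub>E carrier A \<and> g \<in> carrier A \<rightarrow>\<^sub>E carrier A \<and>
        (\<forall>x\<in>carrier A. \<forall>y\<in>carrier A. adj A (f x) \<otimes>\<^bsub>A\<^esub> y = adj A x \<otimes>\<^bsub>A\<^esub> g y) \<and>
        (\<exists>C. \<forall>x\<in>carrier A. cnorm A (f x) \<le> C * cnorm A x)},
      monoid.mult = (\<lambda>m n. (\<lambda>x\<in>carrier A. fst m (fst n x), \<lambda>x\<in>carrier A. snd n (snd m x))),
      one = (\<lambda>x\<in>carrier A. x, \<lambda>x\<in>carrier A. x),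
      zero = (\<lambda>x\<in>carrier A. \<zero>\<^bsub>A\<^esub>, \<lambda>x\<in>carrier A. \<zero>\<^bsub>A\<^esub>),
      add = (\<lambda>m n. (\<lambda>x\<in>carrier A. fst m x \<oplus>\<^bsub>A\<^esub> fst n x, \<lambda>x\<in>carrier A. snd m x \<oplus>\<^bsub>A\<^esub> snd n x)),
      smult = (\<lambda>c m. (\<lambda>x\<in>carrier A. c \<odot>\<^bsub>A\<^esub> fst m x, \<lambda>x\<in>carrier A. cnj c \<odot>\<^bsub>A\<^esub> snd m x)),
      adj = (\<lambda>m. (snd m, fst m)),
      cnorm = (\<lambda>m. Inf {C. 0 \<le> C \<and> (\<forall>x\<in>carrier A. cnorm A (fst m x) \<le> C * cnorm A x)})\<rparr>"

context cstar_algebra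
begin

abbreviation "MA \<equiv> multiplier_algebra A"

lemma nondegenerate:
  assumes "y \<in> carrier A" "z \<in> carrier A" "\<And>x. x \<in> carrier A \<Longrightarrow> adj A x \<otimes> y = adj A x \<otimes> z"
  shows "y = z"
proof -
  have "adj A (y \<ominus> z) \<otimes> (y \<ominus> z) = \<zero>"
    using assms by (simp add: mult_minus_right)
  then have "cnorm A (y \<ominus> z) = 0"
    using cstar_identity[of "y \<ominus> z"] assms by simp
  then show ?thesis
    using assms by (simp add: cnorm_eq_0_iff minus_eq_zero_iff)
qed

lemma MA_simps:
  "x \<in> carrier A \<Longrightarrow> fst (m \<otimes>\<^bsub>MA\<^esub> n) x = fst m (fst n x)"
  "x \<in> carrier A \<Longrightarrow> snd (m \<otimes>\<^bsub>MA\<^esub> n) x = snd n (snd m x)"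
  "x \<in> carrier A \<Longrightarrow> fst \<one>\<^bsub>MA\<^esub> x = x" "x \<in> carrier A \<Longrightarrow> snd \<one>\<^bsub>MA\<^esub> x = x"
  "x \<in> carrier A \<Longrightarrow> fst \<zero>\<^bsub>MA\<^esub> x = \<zero>" "x \<in> carrier A \<Longrightarrow> snd \<zero>\<^bsub>MA\<^esub> x = \<zero>"
  "x \<in> carrier A \<Longrightarrow> fst (m \<oplus>\<^bsub>MA\<^esub> n) x = fst m x \<oplus> fst n x"
  "x \<in> carrier A \<Longrightarrow> snd (m \<oplus>\<^bsub>MA\<^esub> n) x = snd m x \<oplus> snd n x"
  "x \<in> carrier A \<Longrightarrow> fst (c \<odot>\<^bsub>MA\<^esub> m) x = c \<odot> fst m x"
  "x \<in> carrier A \<Longrightarrow> snd (c \<odot>\<^bsub>MA\<^esub> m) x = cnj c \<odot> snd m x"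
  "fst (adj MA m) = snd m" "snd (adj MA m) = fst m"
  by (simp_all add: multiplier_algebra_def)

lemma MA_I:
  assumes "\<And>x. x \<in> carrier A \<Longrightarrow> fst m x \<in> carrier A" "\<And>x. x \<in> carrier A \<Longrightarrow> snd m x \<in> carrier A"
    "fst m \<in> extensional (carrier A)" "snd m \<in> extensional (carrier A)"
    "\<And>x y. x \<in> carrier A \<Longrightarrow> y \<in> carrier A \<Longrightarrow> adj A (fst m x) \<otimes> y = adj A x \<otimes> snd m y"
    "\<And>x. x \<in> carrier A \<Longrightarrow> cnorm A (fst m x) \<le> C * cnorm A x"
  shows "m \<in> carrier MA"
  using assms unfolding multiplier_algebra_def by (auto simp: case_prod_unfold PiE_def intro!: exI[of _ C])

lemma MA_D:
  assumes "m \<in> carrier MA"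
  shows "x \<in> carrier A \<Longrightarrow> fst m x \<in> carrier A" "x \<in> carrier A \<Longrightarrow> snd m x \<in> carrier A"
    "fst m \<in> extensional (carrier A)" "snd m \<in> extensional (carrier A)"
    "x \<in> carrier A \<Longrightarrow> y \<in> carrier A \<Longrightarrow> adj A (fst m x) \<otimes> y = adj A x \<otimes> snd m y"
  using assms by (auto simp: multiplier_algebra_def case_prod_unfold PiE_def)

lemma MA_bounded: "m \<in> carrier MA \<Longrightarrow> \<exists>C. \<forall>x\<in>carrier A. cnorm A (fst m x) \<le> C * cnorm A x"
  by (simp add: multiplier_algebra_def case_prod_unfold)

lemma MA_D_swap:
  assumes m: "m \<in> carrier MA" and x: "x \<in> carrier A" and y: "y \<in> carrier A"
  shows "adj A (snd m x) \<otimes> y = adj A x \<otimes> fst m y"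
  using arg_cong[OF MA_D(5)[OF m y x], of "adj A"] MA_D(1,2)[OF m] x y
  by (simp add: adj_mult adj_adj)

text \<open>An operator determines its adjoint.\<close>

lemma MA_eqI:
  assumes m: "m \<in> carrier MA" and n: "n \<in> carrier MA"
    and eq: "\<And>x. x \<in> carrier A \<Longrightarrow> fst m x = fst n x"
  shows "m = n"
proof (rule prod_eqI)
  show "fst m = fst n"
    using MA_D(3)[OF m] MA_D(3)[OF n] eq by (rule extensionalityI)
  show "snd m = snd n"
  proof (rule extensionalityI[OF MA_D(4)[OF m] MA_D(4)[OF n]])
    fix y assume y: "y \<in> carrier A"
    show "snd m y = snd n y"
    proof (rule nondegenerate)
      show "adj A x \<otimes> snd m y = adj A x \<otimes> snd n y" if x: "x \<in> carrier A" for x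
        unfolding MA_D(5)[OF m x y, symmetric] MA_D(5)[OF n x y, symmetric] eq[OF x] ..
    qed (use y MA_D(2)[OF m] MA_D(2)[OF n] in auto)
  qed
qed

lemma MA_fst_add:
  assumes m: "m \<in> carrier MA" and x: "x \<in> carrier A" and y: "y \<in> carrier A"
  shows "fst m (x \<oplus> y) = fst m x \<oplus> fst m y"
  by (rule nondegenerate) (use x y MA_D(1,2)[OF m] in \<open>simp_all add: MA_D_swap[OF m, symmetric] mult_add_right\<close>)

lemma MA_fst_smult:
  assumes m: "m \<in> carrier MA" and x: "x \<in> carrier A"
  shows "fst m (c \<odot> x) = c \<odot> fst m x"
  by (rule nondegenerate) (use x MA_D(1,2)[OF m] in \<open>simp_all add: MA_D_swap[OF m, symmetric] smult_mult_right\<close>)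

lemma MA_fst_mult:
  assumes m: "m \<in> carrier MA" and x: "x \<in> carrier A" and y: "y \<in> carrier A"
  shows "fst m (x \<otimes> y) = fst m x \<otimes> y"
  by (rule nondegenerate) (use x y MA_D(1,2)[OF m] in \<open>simp_all add: MA_D_swap[OF m, symmetric] flip: mult_assoc\<close>)

lemma MA_norm:
  assumes m: "m \<in> carrier MA"
  shows MA_norm_le: "x \<in> carrier A \<Longrightarrow> cnorm A (fst m x) \<le> cnorm MA m * cnorm A x"
    and MA_norm_nonneg: "0 \<le> cnorm MA m"
proof -
  define N where "N = {C. 0 \<le> C \<and> (\<forall>x\<in>carrier A. cnorm A (fst m x) \<le> C * cnorm A x)}"
  have N: "cnorm MA m = Inf N" by (simp add: multiplier_algebra_def N_def)
  obtain C where C: "\<forall>x\<in>carrier A. cnorm A (fst m x) \<le> C * cnorm A x"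
    using MA_bounded[OF m] by (elim exE)
  have "cnorm A (fst m x) \<le> max C 0 * cnorm A x" if "x \<in> carrier A" for x
    using bspec[OF C that] mult_right_mono[of C "max C 0" "cnorm A x"] that by simp
  then have ne: "N \<noteq> {}" by (auto simp: N_def intro!: exI[of _ "max C 0"])
  show "0 \<le> cnorm MA m"
    unfolding N by (rule cInf_greatest[OF ne]) (simp add: N_def)
  show "cnorm A (fst m x) \<le> cnorm MA m * cnorm A x" if x: "x \<in> carrier A"
  proof (cases "cnorm A x = 0")
    case True
    then have "fst m x = 0 \<odot> fst m x"
      using MA_fst_smult[OF m x, of 0] x by (simp add: cnorm_eq_0_iff)
    then show ?thesis using True MA_D(1)[OF m x] by simp
  next
    case False
    then have p: "cnorm A x > 0" using x by (simp add: less_le)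
    have "cnorm A (fst m x) / cnorm A x \<le> Inf N"
      by (rule cInf_greatest[OF ne]) (use p x in \<open>simp add: N_def divide_le_eq\<close>)
    then show ?thesis using p by (simp add: N divide_le_eq)
  qed
qed

lemma MA_norm_leI:
  assumes "0 \<le> C" "\<And>x. x \<in> carrier A \<Longrightarrow> cnorm A (fst m x) \<le> C * cnorm A x"
  shows "cnorm MA m \<le> C"
  unfolding multiplier_algebra_def using assms by (auto intro!: cInf_lower bdd_belowI[of _ 0])

text \<open>The adjoint \<open>g\<close> of \<open>f\<close> is bounded by the same constant:
  \<open>|g x|\<^sup>2 = |\<langle>f (g x), x\<rangle>| \<le> |f| |g x| |x|\<close>.\<close>

lemma MA_snd_norm_le:
  assumes m: "m \<in> carrier MA" and x: "x \<in> carrier A"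
  shows "cnorm A (snd m x) \<le> cnorm MA m * cnorm A x"
proof (cases "cnorm A (snd m x) = 0")
  case True
  then show ?thesis using MA_norm_nonneg[OF m] x by simp
next
  case False
  note [simp] = x MA_D(1,2)[OF m]
  have "cnorm A (snd m x) * cnorm A (snd m x) = cnorm A (adj A (fst m (snd m x)) \<otimes> x)"
    using cstar_identity[of "snd m x"] MA_D(5)[OF m, of "snd m x" x] by (simp add: power2_eq_square)
  also have "\<dots> \<le> cnorm A (fst m (snd m x)) * cnorm A x"
    using cnorm_mult[of "adj A (fst m (snd m x))" x] by simp
  also have "\<dots> \<le> (cnorm MA m * cnorm A (snd m x)) * cnorm A x"
    by (intro mult_right_mono MA_norm_le m) simp_all
  finally have "cnorm A (snd m x) * cnorm A (snd m x) \<le> (cnorm MA m * cnorm A x) * cnorm A (snd m x)"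
    by (simp add: mult_ac)
  then show ?thesis using False by (simp add: mult_le_cancel_right less_le)
qed

lemma MA_adj_closed: "m \<in> carrier MA \<Longrightarrow> adj MA m \<in> carrier MA"
  by (rule MA_I[where C = "cnorm MA m"])
    (auto simp: MA_simps MA_D MA_D_swap MA_snd_norm_le)

lemma MA_add_closed:
  assumes "m \<in> carrier MA" "n \<in> carrier MA" shows "m \<oplus>\<^bsub>MA\<^esub> n \<in> carrier MA"
proof (rule MA_I[where C = "cnorm MA m + cnorm MA n"])
  show "fst (m \<oplus>\<^bsub>MA\<^esub> n) \<in> extensional (carrier A)" "snd (m \<oplus>\<^bsub>MA\<^esub> n) \<in> extensional (carrier A)"
    by (simp_all add: multiplier_algebra_def)
  show "cnorm A (fst (m \<oplus>\<^bsub>MA\<^esub> n) x) \<le> (cnorm MA m + cnorm MA n) * cnorm A x" if "x \<in> carrier A" for x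
    using that assms cnorm_triangle[of "fst m x" "fst n x"] MA_norm_le[OF assms(1) that]
      MA_norm_le[OF assms(2) that] by (simp add: MA_simps MA_D algebra_simps)
qed (use assms in \<open>auto simp: MA_simps MA_D adj_add mult_add_left mult_add_right\<close>)

lemma MA_smult_closed:
  assumes "m \<in> carrier MA" shows "c \<odot>\<^bsub>MA\<^esub> m \<in> carrier MA"
proof (rule MA_I[where C = "cmod c * cnorm MA m"])
  show "fst (c \<odot>\<^bsub>MA\<^esub> m) \<in> extensional (carrier A)" "snd (c \<odot>\<^bsub>MA\<^esub> m) \<in> extensional (carrier A)"
    by (simp_all add: multiplier_algebra_def)
  show "cnorm A (fst (c \<odot>\<^bsub>MA\<^esub> m) x) \<le> cmod c * cnorm MA m * cnorm A x" if "x \<in> carrier A" for x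
    using that assms MA_norm_le[OF assms(1) that]
    by (simp add: MA_simps MA_D cnorm_smult mult.assoc mult_left_mono)
qed (use assms in \<open>auto simp: MA_simps MA_D adj_smult smult_mult_left smult_mult_right\<close>)

lemma MA_mult_closed:
  assumes "m \<in> carrier MA" "n \<in> carrier MA" shows "m \<otimes>\<^bsub>MA\<^esub> n \<in> carrier MA"
proof (rule MA_I[where C = "cnorm MA m * cnorm MA n"])
  show "fst (m \<otimes>\<^bsub>MA\<^esub> n) \<in> extensional (carrier A)" "snd (m \<otimes>\<^bsub>MA\<^esub> n) \<in> extensional (carrier A)"
    by (simp_all add: multiplier_algebra_def)
  show "cnorm A (fst (m \<otimes>\<^bsub>MA\<^esub> n) x) \<le> cnorm MA m * cnorm MA n * cnorm A x" if "x \<in> carrier A" for x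
    using that assms MA_norm_le[OF assms(1), of "fst n x"] MA_norm_nonneg[OF assms(1)]
      mult_left_mono[OF MA_norm_le[OF assms(2) that], of "cnorm MA m"]
    by (simp add: MA_simps MA_D mult.assoc)
qed (use assms in \<open>auto simp: MA_simps MA_D\<close>)

lemma MA_one_closed: "\<one>\<^bsub>MA\<^esub> \<in> carrier MA"
  by (rule MA_I[where C = 1]) (auto simp: MA_simps, auto simp: multiplier_algebra_def)

lemma MA_zero_closed: "\<zero>\<^bsub>MA\<^esub> \<in> carrier MA"
  by (rule MA_I[where C = 0]) (auto simp: MA_simps, auto simp: multiplier_algebra_def)

lemmas MA_closed = MA_adj_closed MA_add_closed MA_smult_closed MA_mult_closed MA_one_closed MA_zero_closed

text \<open>The adjointness relation passes to pointwise limits because multiplication and involution are continuous.\<close>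

lemma MA_pointwise_limit:
  assumes s: "\<And>n. s n \<in> carrier MA" and C: "\<And>n. cnorm MA (s n) \<le> C"
    and f: "\<And>x. x \<in> carrier A \<Longrightarrow> cstar_lim A (\<lambda>n. fst (s n) x) (f x)"
    and g: "\<And>x. x \<in> carrier A \<Longrightarrow> cstar_lim A (\<lambda>n. snd (s n) x) (g x)"
  shows "(\<lambda>x\<in>carrier A. f x, \<lambda>x\<in>carrier A. g x) \<in> carrier MA"
proof (rule MA_I[where C = C])
  note fA = cstar_limD(2)[OF f] and gA = cstar_limD(2)[OF g]
  fix x assume x: "x \<in> carrier A"
  show "cnorm A (fst (\<lambda>x\<in>carrier A. f x, \<lambda>x\<in>carrier A. g x) x) \<le> C * cnorm A x"
    using cstar_lim_norm_le[OF f[OF x], of "C * cnorm A x"] MA_norm_le[OF s x]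
      mult_right_mono[OF C, of "cnorm A x"] x order_trans by fastforce
  fix y assume y: "y \<in> carrier A"
  have "cstar_lim A (\<lambda>n. adj A (fst (s n) x) \<otimes> y) (adj A (f x) \<otimes> y)"
    by (intro cstar_lim_mult_right cstar_lim_adj f x y)
  moreover have "cstar_lim A (\<lambda>n. adj A x \<otimes> snd (s n) y) (adj A x \<otimes> g y)"
    by (intro cstar_lim_mult_left g y adj_in x)
  ultimately show "adj A (fst (\<lambda>x\<in>carrier A. f x, \<lambda>x\<in>carrier A. g x) x) \<otimes> y
      = adj A x \<otimes> snd (\<lambda>x\<in>carrier A. f x, \<lambda>x\<in>carrier A. g x) y"
    using cstar_lim_unique x y MA_D(5)[OF s x y] by simp
qed (auto intro: cstar_limD(2)[OF f] cstar_limD(2)[OF g])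

text \<open>A Cauchy sequence in the operator norm converges pointwise together with its adjoints, uniformly on bounded
  sets.\<close>

lemma MA_complete:
  fixes s :: "nat \<Rightarrow> ('a \<Rightarrow> 'a) \<times> ('a \<Rightarrow> 'a)"
  assumes s: "\<And>n. s n \<in> carrier MA"
    and cauchy: "\<And>e. e > 0 \<Longrightarrow> \<exists>N. \<forall>m\<ge>N. \<forall>n\<ge>N. cnorm MA (s m \<oplus>\<^bsub>MA\<^esub> (-1) \<odot>\<^bsub>MA\<^esub> s n) < e"
  shows "\<exists>l\<in>carrier MA. \<forall>e>0. \<exists>N. \<forall>n\<ge>N. cnorm MA (s n \<oplus>\<^bsub>MA\<^esub> (-1) \<odot>\<^bsub>MA\<^esub> l) < e"
proof -
  note [simp] = MA_D(1,2)[OF s] MA_closed s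
  have fst_diff: "fst (s m \<oplus>\<^bsub>MA\<^esub> (-1) \<odot>\<^bsub>MA\<^esub> s n) x = fst (s m) x \<ominus> fst (s n) x" if "x \<in> carrier A" for m n x
    using that by (simp add: MA_simps minus_eq_smult)
  have snd_diff: "snd (s m \<oplus>\<^bsub>MA\<^esub> (-1) \<odot>\<^bsub>MA\<^esub> s n) x = snd (s m) x \<ominus> snd (s n) x" if "x \<in> carrier A" for m n x
    using that by (simp add: MA_simps minus_eq_smult)
  have small: "\<exists>N. \<forall>m\<ge>N. \<forall>n\<ge>N. cnorm MA (s m \<oplus>\<^bsub>MA\<^esub> (-1) \<odot>\<^bsub>MA\<^esub> s n) * cnorm A x < e"
    if x: "x \<in> carrier A" and e: "e > 0" for x e
  proof -
    have p: "cnorm A x + 1 > 0" using cnorm_nonneg[OF x] by linarith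
    obtain N where N: "\<And>m n. m \<ge> N \<Longrightarrow> n \<ge> N \<Longrightarrow> cnorm MA (s m \<oplus>\<^bsub>MA\<^esub> (-1) \<odot>\<^bsub>MA\<^esub> s n) < e / (cnorm A x + 1)"
      using cauchy[of "e / (cnorm A x + 1)"] p e by auto
    have "cnorm MA (s m \<oplus>\<^bsub>MA\<^esub> (-1) \<odot>\<^bsub>MA\<^esub> s n) * cnorm A x < e" if "m \<ge> N" "n \<ge> N" for m n
    proof -
      have "cnorm MA (s m \<oplus>\<^bsub>MA\<^esub> (-1) \<odot>\<^bsub>MA\<^esub> s n) * cnorm A x
          \<le> cnorm MA (s m \<oplus>\<^bsub>MA\<^esub> (-1) \<odot>\<^bsub>MA\<^esub> s n) * (cnorm A x + 1)"
        by (intro mult_left_mono MA_norm_nonneg) simp_all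
      also have "\<dots> < e" using N[OF that] p by (simp add: pos_less_divide_eq)
      finally show ?thesis .
    qed
    then show ?thesis by blast
  qed
  have "\<exists>l. cstar_lim A (\<lambda>n. fst (s n) x) l" if x: "x \<in> carrier A" for x
  proof (rule cauchy_imp_cstar_lim)
    fix e :: real assume "e > 0"
    then obtain N where N: "\<And>m n. m \<ge> N \<Longrightarrow> n \<ge> N \<Longrightarrow>
        cnorm MA (s m \<oplus>\<^bsub>MA\<^esub> (-1) \<odot>\<^bsub>MA\<^esub> s n) * cnorm A x < e"
      using small[OF x] by metis
    have "cnorm A (fst (s m) x \<ominus> fst (s n) x) \<le> cnorm MA (s m \<oplus>\<^bsub>MA\<^esub> (-1) \<odot>\<^bsub>MA\<^esub> s n) * cnorm A x" for m n
      unfolding fst_diff[OF x, symmetric] by (rule MA_norm_le[OF _ x]) simp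
    then show "\<exists>N. \<forall>m\<ge>N. \<forall>n\<ge>N. cnorm A (fst (s m) x \<ominus> fst (s n) x) < e"
      by (intro exI[of _ N] allI impI) (rule le_less_trans[OF _ N])
  qed (use x in auto)
  then obtain f where f: "\<And>x. x \<in> carrier A \<Longrightarrow> cstar_lim A (\<lambda>n. fst (s n) x) (f x)" by metis
  have "\<exists>l. cstar_lim A (\<lambda>n. snd (s n) x) l" if x: "x \<in> carrier A" for x
  proof (rule cauchy_imp_cstar_lim)
    fix e :: real assume "e > 0"
    then obtain N where N: "\<And>m n. m \<ge> N \<Longrightarrow> n \<ge> N \<Longrightarrow>
        cnorm MA (s m \<oplus>\<^bsub>MA\<^esub> (-1) \<odot>\<^bsub>MA\<^esub> s n) * cnorm A x < e"
      using small[OF x] by metis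
    have "cnorm A (snd (s m) x \<ominus> snd (s n) x) \<le> cnorm MA (s m \<oplus>\<^bsub>MA\<^esub> (-1) \<odot>\<^bsub>MA\<^esub> s n) * cnorm A x" for m n
      unfolding snd_diff[OF x, symmetric] by (rule MA_snd_norm_le[OF _ x]) simp
    then show "\<exists>N. \<forall>m\<ge>N. \<forall>n\<ge>N. cnorm A (snd (s m) x \<ominus> snd (s n) x) < e"
      by (intro exI[of _ N] allI impI) (rule le_less_trans[OF _ N])
  qed (use x in auto)
  then obtain g where g: "\<And>x. x \<in> carrier A \<Longrightarrow> cstar_lim A (\<lambda>n. snd (s n) x) (g x)" by metis
  obtain N where N: "\<And>n. n \<ge> N \<Longrightarrow> cnorm MA (s n \<oplus>\<^bsub>MA\<^esub> (-1) \<odot>\<^bsub>MA\<^esub> s N) < 1"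
    using cauchy[of 1] by auto
  define C where "C = 1 + cnorm MA (s N)"
  have bdN: "cnorm MA (s (n + N)) \<le> C" for n
  proof (rule MA_norm_leI)
    show "0 \<le> C" unfolding C_def using MA_norm_nonneg[OF s, of N] by linarith
    fix x assume x: "x \<in> carrier A"
    have "cnorm A (fst (s (n + N)) x) \<le> cnorm A (fst (s (n + N)) x \<ominus> fst (s N) x) + cnorm A (fst (s N) x)"
      using x by (intro cnorm_triangle_diff) auto
    also have "\<dots> \<le> 1 * cnorm A x + cnorm MA (s N) * cnorm A x"
    proof (rule add_mono)
      have "cnorm A (fst (s (n + N)) x \<ominus> fst (s N) x)
          \<le> cnorm MA (s (n + N) \<oplus>\<^bsub>MA\<^esub> (-1) \<odot>\<^bsub>MA\<^esub> s N) * cnorm A x"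
        using MA_norm_le[of "s (n + N) \<oplus>\<^bsub>MA\<^esub> (-1) \<odot>\<^bsub>MA\<^esub> s N", OF _ x] x by (simp add: fst_diff)
      also have "\<dots> \<le> 1 * cnorm A x"
        using N[of "n + N"] x by (intro mult_right_mono) auto
      finally show "cnorm A (fst (s (n + N)) x \<ominus> fst (s N) x) \<le> 1 * cnorm A x" .
    qed (use MA_norm_le[OF s x] in simp)
    finally show "cnorm A (fst (s (n + N)) x) \<le> C * cnorm A x"
      by (simp add: C_def algebra_simps)
  qed
  have shift: "cstar_lim A (\<lambda>n. t (n + N)) l" if "cstar_lim A t l" for t l
    using that unfolding cstar_lim_def by (auto intro: LIMSEQ_ignore_initial_segment)
  define l where "l = (\<lambda>x\<in>carrier A. f x, \<lambda>x\<in>carrier A. g x)"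
  have l: "l \<in> carrier MA"
    unfolding l_def using bdN shift[OF f] shift[OF g]
    by (intro MA_pointwise_limit[where s = "\<lambda>n. s (n + N)"]) auto
  show ?thesis
  proof (intro bexI[OF _ l] allI impI)
    fix e :: real assume e: "e > 0"
    then obtain M where M: "\<And>m n. m \<ge> M \<Longrightarrow> n \<ge> M \<Longrightarrow> cnorm MA (s m \<oplus>\<^bsub>MA\<^esub> (-1) \<odot>\<^bsub>MA\<^esub> s n) < e / 2"
      using cauchy[of "e / 2"] by auto
    have "cnorm MA (s n \<oplus>\<^bsub>MA\<^esub> (-1) \<odot>\<^bsub>MA\<^esub> l) < e" if n: "n \<ge> M" for n
    proof -
      have "cnorm MA (s n \<oplus>\<^bsub>MA\<^esub> (-1) \<odot>\<^bsub>MA\<^esub> l) \<le> e / 2"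
      proof (rule MA_norm_leI)
        fix x assume x: "x \<in> carrier A"
        have fx: "f x \<in> carrier A" using cstar_limD(2)[OF f[OF x]] .
        have "cstar_lim A (\<lambda>m. fst (s n) x \<ominus> fst (s (m + M)) x) (fst (s n) x \<ominus> f x)"
        proof -
          have "cstar_lim A (\<lambda>m. fst (s (m + M)) x) (f x)"
            using f[OF x] unfolding cstar_lim_def by (auto intro: LIMSEQ_ignore_initial_segment)
          from cstar_lim_add[OF cstar_lim_const cstar_lim_smult[OF this, of "-1"], of "fst (s n) x"]
          show ?thesis using x fx by (simp add: minus_eq_smult)
        qed
        moreover have "cnorm A (fst (s n) x \<ominus> fst (s (m + M)) x) \<le> e / 2 * cnorm A x" for m
          using MA_norm_le[of "s n \<oplus>\<^bsub>MA\<^esub> (-1) \<odot>\<^bsub>MA\<^esub> s (m + M)", OF _ x] x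
            mult_right_mono[OF less_imp_le[OF M[OF n, of "m + M"]], of "cnorm A x"]
          by (simp add: fst_diff)
        ultimately have "cnorm A (fst (s n) x \<ominus> f x) \<le> e / 2 * cnorm A x"
          by (rule cstar_lim_norm_le)
        moreover have "fst (s n \<oplus>\<^bsub>MA\<^esub> (-1) \<odot>\<^bsub>MA\<^esub> l) x = fst (s n) x \<ominus> f x"
          using x fx by (simp add: MA_simps l_def minus_eq_smult)
        ultimately show "cnorm A (fst (s n \<oplus>\<^bsub>MA\<^esub> (-1) \<odot>\<^bsub>MA\<^esub> l) x) \<le> e / 2 * cnorm A x" by simp
      qed (use e in simp)
      then show ?thesis using e by simp
    qed
    then show "\<exists>N. \<forall>n\<ge>N. cnorm MA (s n \<oplus>\<^bsub>MA\<^esub> (-1) \<odot>\<^bsub>MA\<^esub> l) < e" by blast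
  qed
qed

lemma MA_norm_add:
  assumes "m \<in> carrier MA" "n \<in> carrier MA"
  shows "cnorm MA (m \<oplus>\<^bsub>MA\<^esub> n) \<le> cnorm MA m + cnorm MA n"
proof (rule MA_norm_leI)
  show "cnorm A (fst (m \<oplus>\<^bsub>MA\<^esub> n) x) \<le> (cnorm MA m + cnorm MA n) * cnorm A x" if "x \<in> carrier A" for x
    using that assms cnorm_triangle[of "fst m x" "fst n x"] MA_norm_le[OF assms(1) that]
      MA_norm_le[OF assms(2) that] by (simp add: MA_simps MA_D algebra_simps)
qed (use MA_norm_nonneg assms in simp)

lemma MA_norm_smult_le:
  assumes "m \<in> carrier MA"
  shows "cnorm MA (c \<odot>\<^bsub>MA\<^esub> m) \<le> cmod c * cnorm MA m"
proof (rule MA_norm_leI)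
  show "cnorm A (fst (c \<odot>\<^bsub>MA\<^esub> m) x) \<le> cmod c * cnorm MA m * cnorm A x" if "x \<in> carrier A" for x
    using that assms MA_norm_le[OF assms(1) that]
    by (simp add: MA_simps MA_D cnorm_smult mult.assoc mult_left_mono)
qed (use MA_norm_nonneg assms in simp)

lemma MA_norm_mult:
  assumes "m \<in> carrier MA" "n \<in> carrier MA"
  shows "cnorm MA (m \<otimes>\<^bsub>MA\<^esub> n) \<le> cnorm MA m * cnorm MA n"
proof (rule MA_norm_leI)
  show "cnorm A (fst (m \<otimes>\<^bsub>MA\<^esub> n) x) \<le> cnorm MA m * cnorm MA n * cnorm A x" if "x \<in> carrier A" for x
    using that assms MA_norm_le[OF assms(1), of "fst n x"] MA_norm_nonneg[OF assms(1)]
      mult_left_mono[OF MA_norm_le[OF assms(2) that], of "cnorm MA m"]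
    by (simp add: MA_simps MA_D mult.assoc)
qed (use MA_norm_nonneg assms in simp)

lemma MA_norm_adj_le:
  assumes "m \<in> carrier MA" shows "cnorm MA (adj MA m) \<le> cnorm MA m"
  by (rule MA_norm_leI) (use assms in \<open>auto simp: MA_simps MA_norm_nonneg MA_snd_norm_le\<close>)

text \<open>The C*-identity comes from \<open>|f x|\<^sup>2 = |\<langle>x, f\<^sup>* (f x)\<rangle>| \<le> |f\<^sup>* f| |x|\<^sup>2\<close>.\<close>

theorem multiplier_algebra_unital_cstar: "unital_cstar_algebra MA"
proof -
  note [simp] = MA_D(1,2) MA_closed
  have neg: "x \<oplus> (-1) \<odot> x = \<zero>" if "x \<in> carrier A" for x
    using M.r_neg[OF that] uminus_eq_smult[OF that] by simp
  have "cstar_algebra MA"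
  proof (rule cstar_algebraI[OF _ _ _ _ _ _ _ _ _ _ _ _ _ _ _ _ _ _ _ _ _ _ _ _ _ _ _ MA_complete])
    fix m assume m: "m \<in> carrier MA"
    show "adj MA (adj MA m) = m" "adj MA (c \<odot>\<^bsub>MA\<^esub> m) = cnj c \<odot>\<^bsub>MA\<^esub> adj MA m" for c
      by (simp_all add: multiplier_algebra_def)
    show "(cnorm MA m = 0) = (m = \<zero>\<^bsub>MA\<^esub>)"
    proof
      assume 0: "cnorm MA m = 0"
      show "m = \<zero>\<^bsub>MA\<^esub>"
        by (rule MA_eqI) (use m MA_norm_le[OF m] 0 in \<open>auto simp: MA_simps simp flip: cnorm_eq_0_iff intro: antisym\<close>)
    next
      assume "m = \<zero>\<^bsub>MA\<^esub>"
      then have "cnorm MA m \<le> 0" by (intro MA_norm_leI) (auto simp: MA_simps)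
      then show "cnorm MA m = 0" using MA_norm_nonneg[OF m] by simp
    qed
    show "cnorm MA (c \<odot>\<^bsub>MA\<^esub> m) = cmod c * cnorm MA m" for c
    proof (rule antisym[OF MA_norm_smult_le[OF m]])
      show "cmod c * cnorm MA m \<le> cnorm MA (c \<odot>\<^bsub>MA\<^esub> m)"
      proof (cases "c = 0")
        case True
        then show ?thesis using MA_norm_nonneg[OF MA_smult_closed[OF m]] by simp
      next
        case False
        have "inverse c \<odot>\<^bsub>MA\<^esub> (c \<odot>\<^bsub>MA\<^esub> m) = m"
          by (rule MA_eqI) (use m False in \<open>auto simp: MA_simps\<close>)
        then have "cnorm MA m \<le> cmod (inverse c) * cnorm MA (c \<odot>\<^bsub>MA\<^esub> m)"
          using MA_norm_smult_le[of "c \<odot>\<^bsub>MA\<^esub> m" "inverse c"] m by simp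
        then show ?thesis using False by (simp add: norm_inverse norm_divide field_simps)
      qed
    qed
    show "cnorm MA (adj MA m \<otimes>\<^bsub>MA\<^esub> m) = (cnorm MA m)\<^sup>2"
    proof (rule antisym)
      have "cnorm MA (adj MA m \<otimes>\<^bsub>MA\<^esub> m) \<le> cnorm MA (adj MA m) * cnorm MA m"
        using m by (intro MA_norm_mult) auto
      also have "\<dots> \<le> cnorm MA m * cnorm MA m"
        using m by (intro mult_right_mono MA_norm_adj_le MA_norm_nonneg)
      finally show "cnorm MA (adj MA m \<otimes>\<^bsub>MA\<^esub> m) \<le> (cnorm MA m)\<^sup>2" by (simp add: power2_eq_square)
      define C where "C = cnorm MA (adj MA m \<otimes>\<^bsub>MA\<^esub> m)"
      have C0: "0 \<le> C" unfolding C_def using m by (intro MA_norm_nonneg) auto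
      have "cnorm MA m \<le> sqrt C"
      proof (rule MA_norm_leI)
        fix x assume x: "x \<in> carrier A"
        note [simp] = m x
        have "(cnorm A (fst m x))\<^sup>2 = cnorm A (adj A x \<otimes> fst (adj MA m \<otimes>\<^bsub>MA\<^esub> m) x)"
          using cstar_identity[of "fst m x"] MA_D(5)[OF m x, of "fst m x"] by (simp add: MA_simps)
        also have "\<dots> \<le> cnorm A x * cnorm A (fst (adj MA m \<otimes>\<^bsub>MA\<^esub> m) x)"
          using cnorm_mult[of "adj A x" "fst (adj MA m \<otimes>\<^bsub>MA\<^esub> m) x"] by simp
        also have "\<dots> \<le> cnorm A x * (C * cnorm A x)"
          unfolding C_def by (intro mult_left_mono MA_norm_le) simp_all
        also have "\<dots> = (sqrt C * cnorm A x)\<^sup>2"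
          using C0 by (simp add: power_mult_distrib power2_eq_square)
        finally show "cnorm A (fst m x) \<le> sqrt C * cnorm A x"
          by (rule power2_le_imp_le) (simp add: C0)
      qed (use C0 in simp)
      then have "(cnorm MA m)\<^sup>2 \<le> (sqrt C)\<^sup>2"
        using MA_norm_nonneg[OF m] by (rule power_mono)
      then show "(cnorm MA m)\<^sup>2 \<le> cnorm MA (adj MA m \<otimes>\<^bsub>MA\<^esub> m)" using C0 by (simp add: C_def)
    qed
  qed (simp_all add: MA_norm_add MA_norm_mult,
      (rule MA_eqI; simp add: MA_simps MA_fst_add MA_fst_smult smult_add_scalar smult_add neg M.a_ac)+)
  moreover have "\<one>\<^bsub>MA\<^esub> \<otimes>\<^bsub>MA\<^esub> m = m" "m \<otimes>\<^bsub>MA\<^esub> \<one>\<^bsub>MA\<^esub> = m" if "m \<in> carrier MA" for m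
    by (rule MA_eqI; simp add: MA_simps that)+
  ultimately show ?thesis
    by (intro unital_cstar_algebra.intro unital_cstar_algebra_axioms.intro MA_one_closed) auto
qed

end

context cstar_algebra
begin

text \<open>The embedding of \<open>A\<close> as an ideal of its multiplier algebra.\<close>

definition left_mult :: "'a \<Rightarrow> ('a \<Rightarrow> 'a) \<times> ('a \<Rightarrow> 'a)" where
  "left_mult a = (\<lambda>x\<in>carrier A. a \<otimes> x, \<lambda>x\<in>carrier A. adj A a \<otimes> x)"

lemma left_mult_apply [simp]:
  "x \<in> carrier A \<Longrightarrow> fst (left_mult a) x = a \<otimes> x"
  "x \<in> carrier A \<Longrightarrow> snd (left_mult a) x = adj A a \<otimes> x"
  by (simp_all add: left_mult_def)

lemma left_mult_closed [simp]: "a \<in> carrier A \<Longrightarrow> left_mult a \<in> carrier MA"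
  by (rule MA_I[where C = "cnorm A a"])
    (auto simp: left_mult_def adj_mult mult_assoc cnorm_mult)

lemma star_hom_left_mult: "star_hom A MA left_mult"
proof (rule star_homI)
  fix x assume x: "x \<in> carrier A"
  then show "left_mult x \<in> carrier MA" by simp
  show "left_mult (c \<odot> x) = c \<odot>\<^bsub>MA\<^esub> left_mult x" for c
    using x by (intro MA_eqI) (simp_all add: MA_simps MA_closed smult_mult_left)
  show "left_mult (adj A x) = adj MA (left_mult x)"
    using x by (intro MA_eqI) (simp_all add: MA_simps MA_closed)
  fix y assume y: "y \<in> carrier A"
  show "left_mult (x \<oplus> y) = left_mult x \<oplus>\<^bsub>MA\<^esub> left_mult y"
    using x y by (intro MA_eqI) (simp_all add: MA_simps MA_closed mult_add_left)
  show "left_mult (x \<otimes> y) = left_mult x \<otimes>\<^bsub>MA\<^esub> left_mult y"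
    using x y by (intro MA_eqI) (simp_all add: MA_simps MA_closed mult_assoc)
qed

lemma cnorm_le_left_mult:
  assumes a: "a \<in> carrier A" shows "cnorm A a \<le> cnorm MA (left_mult a)"
proof (cases "cnorm A a = 0")
  case True
  then show ?thesis using MA_norm_nonneg[OF left_mult_closed[OF a]] by simp
next
  case False
  have "cnorm A a * cnorm A a = cnorm A (fst (left_mult a) (adj A a))"
    using cstar_identity[of "adj A a"] a by (simp add: adj_adj power2_eq_square)
  also have "\<dots> \<le> cnorm MA (left_mult a) * cnorm A a"
    using MA_norm_le[OF left_mult_closed[OF a], of "adj A a"] a by simp
  finally show ?thesis using False a by (simp add: mult_le_cancel_right less_le)
qed

lemma mult_left_mult:
  "m \<in> carrier MA \<Longrightarrow> a \<in> carrier A \<Longrightarrow> m \<otimes>\<^bsub>MA\<^esub> left_mult a = left_mult (fst m a)"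
  by (rule MA_eqI) (simp_all add: MA_closed MA_D MA_simps MA_fst_mult)

lemma left_mult_inj:
  assumes "a \<in> carrier A" "b \<in> carrier A" "left_mult a = left_mult b" shows "a = b"
proof (rule nondegenerate)
  fix x assume x: "x \<in> carrier A"
  have "adj A a \<otimes> x = adj A b \<otimes> x"
    using arg_cong[OF assms(3), of "\<lambda>m. snd m x"] x by simp
  from arg_cong[OF this, of "adj A"] show "adj A x \<otimes> a = adj A x \<otimes> b"
    using assms x by (simp add: adj_mult adj_adj)
qed (use assms in auto)

lemma closed_subspace_left_mult: "closed_subspace MA (left_mult ` carrier A)"
proof -
  interpret M: unital_cstar_algebra MA by (rule multiplier_algebra_unital_cstar)
  interpret l: cstar_hom A MA left_mult
    by (intro cstar_hom.intro cstar_hom_axioms.intro cstar_algebra_axioms M.cstar_algebra_axioms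
        star_hom_left_mult)
  show ?thesis
    by (rule l.closed_subspace_image[OF closed_subspace_carrier cnorm_le_left_mult])
qed

lemma closed_subspace_MA_eq:
  assumes m: "m \<in> carrier MA" and n: "n \<in> carrier MA"
  shows "closed_subspace A {x \<in> carrier A. fst m x = fst n x}"
proof -
  note [simp] = MA_D(1)[OF m] MA_D(1)[OF n]
  have "closed_subspace A {x \<in> carrier A. fst m x \<ominus> fst n x \<in> {\<zero>}}"
  proof (rule closed_subspace_preimage[OF cstar_algebra_axioms closed_subspace_zero, where C = "cnorm MA m + cnorm MA n"])
    fix x assume x: "x \<in> carrier A"
    then show "cnorm A (fst m x \<ominus> fst n x) \<le> (cnorm MA m + cnorm MA n) * cnorm A x"
      using cnorm_triangle_minus[of "fst m x" "fst n x"] MA_norm_le[OF m x] MA_norm_le[OF n x]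
      by (simp add: algebra_simps)
  qed (auto simp: MA_fst_add[OF m] MA_fst_add[OF n] MA_fst_smult[OF m] MA_fst_smult[OF n]
      minus_add_minus smult_minus)
  moreover have "{x \<in> carrier A. fst m x \<ominus> fst n x \<in> {\<zero>}} = {x \<in> carrier A. fst m x = fst n x}"
    by (auto simp: minus_eq_zero_iff)
  ultimately show ?thesis by simp
qed

section \<open>Strict limits\<close>

text \<open>For a bounded sequence of operators, convergence needs to be checked on a total set only.\<close>

lemma closed_subspace_convergent:
  assumes a: "\<And>n. a n \<in> carrier A" and C: "\<And>n. cnorm A (a n) \<le> C"
  shows "closed_subspace A {x \<in> carrier A. \<exists>l. cstar_lim A (\<lambda>n. a n \<otimes> x) l}"
proof (rule closed_subspaceI)
  fix s l assume s: "\<And>n. s n \<in> {x \<in> carrier A. \<exists>l. cstar_lim A (\<lambda>n. a n \<otimes> x) l}" and l: "cstar_lim A s l"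
  note [simp] = a cstar_limD(1,2)[OF l]
  have "0 \<le> C" using C[of 0] cnorm_nonneg[OF a, of 0] by linarith
  have "\<exists>m. cstar_lim A (\<lambda>n. a n \<otimes> l) m"
  proof (rule cauchy_imp_cstar_lim)
    fix e :: real assume e: "e > 0"
    \<comment> \<open>adding 1 avoids division by zero when the bound is 0\<close>
    obtain k where k: "cnorm A (s k \<ominus> l) < e / (3 * (C + 1))"
      using LIMSEQ_D[OF cstar_limD(3)[OF l], of "e / (3 * (C + 1))"] e \<open>0 \<le> C\<close> by force
    have b: "cnorm A (a n \<otimes> (s k \<ominus> l)) < e / 3" for n
    proof -
      have "cnorm A (a n \<otimes> (s k \<ominus> l)) \<le> (C + 1) * cnorm A (s k \<ominus> l)"
        using cnorm_mult[of "a n" "s k \<ominus> l"] mult_right_mono[of "cnorm A (a n)" "C + 1" "cnorm A (s k \<ominus> l)"] C[of n]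
        by simp
      also have "\<dots> < e / 3"
        using k \<open>0 \<le> C\<close> by (simp add: field_simps)
      finally show ?thesis .
    qed
    obtain m where "cstar_lim A (\<lambda>n. a n \<otimes> s k) m" using s[of k] by auto
    then obtain N where N: "\<And>i j. i \<ge> N \<Longrightarrow> j \<ge> N \<Longrightarrow> cnorm A (a i \<otimes> s k \<ominus> a j \<otimes> s k) < e / 3"
      using cstar_lim_cauchy[of "\<lambda>n. a n \<otimes> s k" m "e / 3"] e by auto
    have "cnorm A (a i \<otimes> l \<ominus> a j \<otimes> l) < e" if ij: "i \<ge> N" "j \<ge> N" for i j
    proof -
      have "a i \<otimes> l \<ominus> a j \<otimes> l = (a i \<otimes> l \<ominus> a i \<otimes> s k) \<oplus> ((a i \<otimes> s k \<ominus> a j \<otimes> s k) \<oplus> (a j \<otimes> s k \<ominus> a j \<otimes> l))"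
        by (simp add: minus_telescope)
      then have "cnorm A (a i \<otimes> l \<ominus> a j \<otimes> l) \<le> cnorm A (a i \<otimes> l \<ominus> a i \<otimes> s k) +
          (cnorm A (a i \<otimes> s k \<ominus> a j \<otimes> s k) + cnorm A (a j \<otimes> s k \<ominus> a j \<otimes> l))"
        using cnorm_triangle[of "a i \<otimes> l \<ominus> a i \<otimes> s k" "(a i \<otimes> s k \<ominus> a j \<otimes> s k) \<oplus> (a j \<otimes> s k \<ominus> a j \<otimes> l)"]
          cnorm_triangle[of "a i \<otimes> s k \<ominus> a j \<otimes> s k" "a j \<otimes> s k \<ominus> a j \<otimes> l"] by simp
      moreover have "cnorm A (a i \<otimes> l \<ominus> a i \<otimes> s k) = cnorm A (a i \<otimes> (s k \<ominus> l))"
        by (subst cnorm_minus_commute) (simp_all add: mult_minus_right)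
      moreover have "cnorm A (a j \<otimes> s k \<ominus> a j \<otimes> l) = cnorm A (a j \<otimes> (s k \<ominus> l))"
        by (simp add: mult_minus_right)
      ultimately show ?thesis using b[of i] b[of j] N[OF ij] by linarith
    qed
    then show "\<exists>N. \<forall>i\<ge>N. \<forall>j\<ge>N. cnorm A (a i \<otimes> l \<ominus> a j \<otimes> l) < e" by blast
  qed auto
  then show "l \<in> {x \<in> carrier A. \<exists>l. cstar_lim A (\<lambda>n. a n \<otimes> x) l}" by simp
next
  fix x y assume x: "x \<in> {x \<in> carrier A. \<exists>l. cstar_lim A (\<lambda>n. a n \<otimes> x) l}"
  then obtain k where k: "x \<in> carrier A" "cstar_lim A (\<lambda>n. a n \<otimes> x) k" by auto
  show "c \<odot> x \<in> {x \<in> carrier A. \<exists>l. cstar_lim A (\<lambda>n. a n \<otimes> x) l}" for c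
    using cstar_lim_smult[OF k(2), of c] k(1) a by (auto simp: smult_mult_right)
  assume "y \<in> {x \<in> carrier A. \<exists>l. cstar_lim A (\<lambda>n. a n \<otimes> x) l}"
  then obtain l where l: "y \<in> carrier A" "cstar_lim A (\<lambda>n. a n \<otimes> y) l" by auto
  show "x \<oplus> y \<in> {x \<in> carrier A. \<exists>l. cstar_lim A (\<lambda>n. a n \<otimes> x) l}"
    using cstar_lim_add[OF k(2) l(2)] k(1) l(1) a by (auto simp: mult_add_right)
qed (use a in \<open>auto intro!: exI[of _ \<zero>] cstar_lim_const\<close>)

text \<open>The left multiplications by the \<open>a n\<close> are bounded, so their pointwise limit is again a multiplier.\<close>

lemma ex_strict_limit:
  assumes a: "\<And>n. a n \<in> carrier A" and C: "\<And>n. cnorm A (a n) \<le> C"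
    and f: "\<And>x. x \<in> carrier A \<Longrightarrow> \<exists>l. cstar_lim A (\<lambda>n. a n \<otimes> x) l"
    and g: "\<And>x. x \<in> carrier A \<Longrightarrow> \<exists>l. cstar_lim A (\<lambda>n. adj A (a n) \<otimes> x) l"
  obtains m where "m \<in> carrier MA" "\<And>x. x \<in> carrier A \<Longrightarrow> cstar_lim A (\<lambda>n. a n \<otimes> x) (fst m x)"
    "\<And>x. x \<in> carrier A \<Longrightarrow> cstar_lim A (\<lambda>n. adj A (a n) \<otimes> x) (snd m x)"
proof -
  obtain F where F: "\<And>x. x \<in> carrier A \<Longrightarrow> cstar_lim A (\<lambda>n. a n \<otimes> x) (F x)"
    using f by metis
  obtain G where G: "\<And>x. x \<in> carrier A \<Longrightarrow> cstar_lim A (\<lambda>n. adj A (a n) \<otimes> x) (G x)"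
    using g by metis
  let ?m = "(\<lambda>x\<in>carrier A. F x, \<lambda>x\<in>carrier A. G x)"
  have "?m \<in> carrier MA"
  proof (rule MA_pointwise_limit[where s = "\<lambda>n. left_mult (a n)"])
    have "0 \<le> C" using C[of 0] cnorm_nonneg[OF a, of 0] by linarith
    then show "cnorm MA (left_mult (a n)) \<le> C" for n
      using a[of n] C[of n] by (intro MA_norm_leI)
        (auto intro!: order_trans[OF cnorm_mult] mult_right_mono)
  qed (use a F G in simp_all)
  then show ?thesis
    by (rule that) (use F G in simp_all)
qed

end

section \<open>Matrix units\<close>

text \<open>The elements \<open>x i\<close> are the first column of a system of matrix units.\<close>

locale matrix_column = cstar_algebra K for K (structure) +
  fixes x
  assumes rel: "matrix_column_relations K x"
begin

lemma x_closed [simp]: "x i \<in> carrier K"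
  using rel by (auto simp: matrix_column_relations_def)

lemma adj_x_x: "adj K (x i) \<otimes> x j = (if i = j then x 0 else \<zero>)"
  using rel by (auto simp: matrix_column_relations_def)

lemma adj_x0 [simp]: "adj K (x 0) = x 0"
  using adj_mult[of "adj K (x 0)" "x 0"] adj_x_x[of 0 0] by (simp add: adj_adj)

lemma x0_x0 [simp]: "x 0 \<otimes> x 0 = x 0"
  using adj_x_x[of 0 0] by simp

text \<open>The relations give \<open>d\<^sup>* d = 0\<close> for \<open>d = x i \<otimes> x 0 \<ominus> x i\<close>.\<close>

lemma x_x0 [simp]: "x i \<otimes> x 0 = x i"
proof -
  let ?d = "x i \<otimes> x 0 \<ominus> x i"
  have xx: "adj K (x i) \<otimes> x i = x 0" by (simp add: adj_x_x)
  have "adj K ?d \<otimes> (x i \<otimes> x 0) = x 0 \<otimes> (adj K (x i) \<otimes> x i) \<otimes> x 0 \<ominus> (adj K (x i) \<otimes> x i) \<otimes> x 0"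
    by (simp add: adj_minus adj_mult mult_minus_left mult_assoc)
  moreover have "adj K ?d \<otimes> x i = x 0 \<otimes> (adj K (x i) \<otimes> x i) \<ominus> adj K (x i) \<otimes> x i"
    by (simp add: adj_minus adj_mult mult_minus_left mult_assoc)
  ultimately have "adj K ?d \<otimes> ?d = \<zero>"
    by (simp add: mult_minus_right xx)
  then have "cnorm K ?d = 0" using cstar_identity[of ?d] by simp
  then show ?thesis by (simp add: cnorm_eq_0_iff minus_eq_zero_iff)
qed

lemma x0_adj_x [simp]: "x 0 \<otimes> adj K (x i) = adj K (x i)"
  using adj_mult[of "x i" "x 0"] by simp

definition unit where "unit i j = x i \<otimes> adj K (x j)"

lemma unit_closed [simp]: "unit i j \<in> carrier K"
  by (simp add: unit_def)

lemma unit_x: "unit i j \<otimes> x k = (if j = k then x i else \<zero>)"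
  by (simp add: unit_def mult_assoc adj_x_x)

lemma unit_unit: "unit i j \<otimes> unit k l = (if j = k then unit i l else \<zero>)"
proof -
  have "unit i j \<otimes> unit k l = (unit i j \<otimes> x k) \<otimes> adj K (x l)"
    by (simp only: unit_def[of k l]) (simp add: mult_assoc)
  also have "\<dots> = (if j = k then unit i l else \<zero>)"
    by (simp add: unit_x) (simp add: unit_def)
  finally show ?thesis .
qed

lemma adj_unit [simp]: "adj K (unit i j) = unit j i"
  by (simp add: unit_def adj_mult adj_adj)

lemma unit_i_0: "unit i 0 = x i"
  by (simp add: unit_def)

lemma units_total:
  assumes gen: "cstar_generated_by K (range x)"
    and V: "closed_subspace K V" "\<And>i j. unit i j \<in> V" and k: "k \<in> carrier K"
  shows "k \<in> V"
proof -
  let ?S = "{unit i j | i j. True}"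
  have xS: "range x \<subseteq> ?S"
    by (auto simp flip: unit_i_0)
  have "cstar_generated_by K ?S"
    unfolding cstar_generated_by_def
  proof (intro conjI allI impI)
    show "?S \<subseteq> carrier K" by auto
    fix H assume H: "cstar_subalgebra H K \<and> ?S \<subseteq> H"
    with xS gen show "H = carrier K"
      unfolding cstar_generated_by_def by (meson order_trans)
  qed
  then show ?thesis
  proof (rule closed_subspace_total[OF _ V(1)])
    fix W a b assume W: "closed_subspace K W" "?S \<subseteq> W" and ab: "a \<in> ?S" "b \<in> ?S"
    have "unit i j \<in> W" for i j using W(2) by blast
    then show "a \<otimes> b \<in> W \<and> adj K a \<in> W"
      using closed_subspaceD(3)[OF W(1)] ab by (auto simp: unit_unit)
  qed (use V k in auto)
qed

text \<open>The partial sums of the weighted shift \<open>x j \<mapsto> z ^ j \<odot> x (j + k)\<close>.\<close>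

primrec weighted_shift where
  "weighted_shift z k 0 = \<zero>"
| "weighted_shift z k (Suc n) = weighted_shift z k n \<oplus> z ^ n \<odot> unit (n + k) n"

lemma weighted_shift_closed [simp]: "weighted_shift z k n \<in> carrier K"
  by (induction n) simp_all

lemma weighted_shift_x:
  "weighted_shift z k n \<otimes> x j = (if j < n then z ^ j \<odot> x (j + k) else \<zero>)"
  by (induction n) (auto simp: mult_add_left smult_mult_left unit_x less_Suc_eq)

lemma adj_weighted_shift_x:
  "adj K (weighted_shift z k n) \<otimes> x j = (if k \<le> j \<and> j < n + k then cnj z ^ (j - k) \<odot> x (j - k) else \<zero>)"
proof (induction n arbitrary: j)
  case (Suc n)
  show ?case
    by (cases "j = n + k")
      (auto simp: adj_add adj_smult mult_add_left smult_mult_left unit_x Suc)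
qed auto

text \<open>The weights have modulus 1 and distinct columns of the shift are orthogonal, so only the diagonal survives.\<close>

lemma adj_weighted_shift_mult_self:
  assumes z: "cmod z = 1"
  shows "adj K (weighted_shift z k n) \<otimes> weighted_shift z k n = weighted_shift 1 0 n"
proof (induction n)
  case (Suc n)
  let ?W = "weighted_shift z k n"
  have zero: "adj K ?W \<otimes> unit (n + k) n = \<zero>"
    unfolding unit_def by (simp flip: mult_assoc add: adj_weighted_shift_x)
  have zero': "unit n (n + k) \<otimes> ?W = \<zero>"
    using arg_cong[OF zero, of "adj K"] by (simp add: adj_mult adj_adj)
  have 1: "z ^ n * cnj z ^ n = 1"
    using z complex_norm_square[of z] by (simp flip: power_mult_distrib)
  show ?case
    using 1 by (simp add: Suc zero zero' adj_add adj_smult mult_add_left mult_add_right smult_mult_left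
        smult_mult_right unit_unit)
qed simp

lemma cnorm_weighted_shift:
  assumes z: "cmod z = 1" shows "cnorm K (weighted_shift z k n) \<le> 1"
proof -
  have "adj K (weighted_shift 1 0 n) = weighted_shift 1 0 n"
    by (induction n) (simp_all add: adj_add)
  then have "weighted_shift 1 0 n \<otimes> weighted_shift 1 0 n = weighted_shift 1 0 n"
    using adj_weighted_shift_mult_self[of 1 0 n] by simp
  then show ?thesis
    by (intro cnorm_le_1_if_adj_mult_projection) (simp_all add: adj_weighted_shift_mult_self[OF z])
qed

end

section \<open>Creation operators on the tensor product\<close>

locale tensor_compacts = B: unital_cstar_algebra B + T: cstar_algebra T + K: matrix_column K x
  for B :: "('b, 'l) cstar_scheme" and T :: "('t, 'n) cstar_scheme"
    and K :: "('k, 'm) cstar_scheme" and x +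
  fixes tens :: "'b \<Rightarrow> 'k \<Rightarrow> 't"
  assumes tensor: "is_cstar_tensor B K T tens"
    and units_generate: "cstar_generated_by K (range x)"
begin

abbreviation "M \<equiv> multiplier_algebra T"

sublocale M: unital_cstar_algebra M
  by (rule T.multiplier_algebra_unital_cstar)

lemma tens_closed [simp]: "b \<in> carrier B \<Longrightarrow> k \<in> carrier K \<Longrightarrow> tens b k \<in> carrier T"
  and tens_add_left: "b \<in> carrier B \<Longrightarrow> b' \<in> carrier B \<Longrightarrow> k \<in> carrier K \<Longrightarrow>
    tens (b \<oplus>\<^bsub>B\<^esub> b') k = tens b k \<oplus>\<^bsub>T\<^esub> tens b' k"
  and tens_add_right: "b \<in> carrier B \<Longrightarrow> k \<in> carrier K \<Longrightarrow> k' \<in> carrier K \<Longrightarrow>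
    tens b (k \<oplus>\<^bsub>K\<^esub> k') = tens b k \<oplus>\<^bsub>T\<^esub> tens b k'"
  and tens_smult_left: "b \<in> carrier B \<Longrightarrow> k \<in> carrier K \<Longrightarrow> tens (c \<odot>\<^bsub>B\<^esub> b) k = c \<odot>\<^bsub>T\<^esub> tens b k"
  and tens_smult_right: "b \<in> carrier B \<Longrightarrow> k \<in> carrier K \<Longrightarrow> tens b (c \<odot>\<^bsub>K\<^esub> k) = c \<odot>\<^bsub>T\<^esub> tens b k"
  and tens_mult: "b \<in> carrier B \<Longrightarrow> b' \<in> carrier B \<Longrightarrow> k \<in> carrier K \<Longrightarrow> k' \<in> carrier K \<Longrightarrow>
    tens b k \<otimes>\<^bsub>T\<^esub> tens b' k' = tens (b \<otimes>\<^bsub>B\<^esub> b') (k \<otimes>\<^bsub>K\<^esub> k')"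
  and tens_adj: "b \<in> carrier B \<Longrightarrow> k \<in> carrier K \<Longrightarrow> adj T (tens b k) = tens (adj B b) (adj K k)"
  and tens_norm: "b \<in> carrier B \<Longrightarrow> k \<in> carrier K \<Longrightarrow> cnorm T (tens b k) = cnorm B b * cnorm K k"
  and tens_generate: "cstar_generated_by T {tens b k | b k. b \<in> carrier B \<and> k \<in> carrier K}"
  using tensor unfolding is_cstar_tensor_def by simp_all

lemma tens_zero [simp]: "b \<in> carrier B \<Longrightarrow> tens b \<zero>\<^bsub>K\<^esub> = \<zero>\<^bsub>T\<^esub>" "k \<in> carrier K \<Longrightarrow> tens \<zero>\<^bsub>B\<^esub> k = \<zero>\<^bsub>T\<^esub>"
  using tens_smult_right[of b "\<zero>\<^bsub>K\<^esub>" 0] tens_smult_left[of "\<zero>\<^bsub>B\<^esub>" k 0] by simp_all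

text \<open>Convergence and equality statements on the tensor product are reduced to the elements \<open>b \<otimes> e\<^sub>i\<^sub>j\<close>.\<close>

lemma tens_total:
  assumes V: "closed_subspace T V" and bV: "\<And>b i j. b \<in> carrier B \<Longrightarrow> tens b (K.unit i j) \<in> V"
    and t: "t \<in> carrier T"
  shows "t \<in> V"
proof -
  let ?S = "{tens b k | b k. b \<in> carrier B \<and> k \<in> carrier K}"
  have SV: "tens b k \<in> V" if b: "b \<in> carrier B" and k: "k \<in> carrier K" for b k
  proof -
    have "closed_subspace K {k \<in> carrier K. tens b k \<in> V}"
      by (rule K.closed_subspace_preimage[OF T.cstar_algebra_axioms V, where C = "cnorm B b"])
        (use b in \<open>auto simp: tens_add_right tens_smult_right tens_norm\<close>)
    from K.units_total[OF units_generate this _ k] show ?thesis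
      using bV[OF b] by simp
  qed
  show ?thesis
  proof (rule T.closed_subspace_total[OF tens_generate V])
    fix W a b assume W: "closed_subspace T W" "?S \<subseteq> W" and ab: "a \<in> ?S" "b \<in> ?S"
    have "tens b k \<in> W" if "b \<in> carrier B" "k \<in> carrier K" for b k using W(2) that by blast
    then show "a \<otimes>\<^bsub>T\<^esub> b \<in> W \<and> adj T a \<in> W"
      using ab by (auto simp: tens_mult tens_adj)
  qed (use SV t in auto)
qed

text \<open>The elements \<open>vec b i\<close> behave like \<open>b\<close> in position \<open>i\<close> of a column with entries in \<open>B\<close>.
  As right ideal they generate everything, so multipliers are determined by their values on them.\<close>

definition vec where "vec b i = tens b (x i)"

lemma vec_closed [simp]: "b \<in> carrier B \<Longrightarrow> vec b i \<in> carrier T"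
  by (simp add: vec_def)

lemma vec_add: "b \<in> carrier B \<Longrightarrow> b' \<in> carrier B \<Longrightarrow> vec (b \<oplus>\<^bsub>B\<^esub> b') i = vec b i \<oplus>\<^bsub>T\<^esub> vec b' i"
  by (simp add: vec_def tens_add_left)

lemma vec_smult: "b \<in> carrier B \<Longrightarrow> vec (c \<odot>\<^bsub>B\<^esub> b) i = c \<odot>\<^bsub>T\<^esub> vec b i"
  by (simp add: vec_def tens_smult_left)

lemma vec_zero [simp]: "vec \<zero>\<^bsub>B\<^esub> i = \<zero>\<^bsub>T\<^esub>"
  by (simp add: vec_def)

lemma tens_unit: "b \<in> carrier B \<Longrightarrow> tens b (K.unit i j) = vec b i \<otimes>\<^bsub>T\<^esub> tens \<one>\<^bsub>B\<^esub> (adj K (x j))"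
  by (simp add: vec_def tens_mult B.one_closed B.mult_one K.unit_def)

lemma multiplier_eqI:
  assumes m: "m \<in> carrier M" and n: "n \<in> carrier M"
    and eq: "\<And>b i. b \<in> carrier B \<Longrightarrow> fst m (vec b i) = fst n (vec b i)"
  shows "m = n"
proof (rule T.MA_eqI[OF m n])
  fix t assume t: "t \<in> carrier T"
  have "t \<in> {t \<in> carrier T. fst m t = fst n t}"
    by (rule tens_total[OF T.closed_subspace_MA_eq[OF m n] _ t])
      (auto simp: tens_unit eq T.MA_fst_mult[OF m] T.MA_fst_mult[OF n] B.one_closed)
  then show "fst m t = fst n t" by simp
qed

text \<open>The operator with matrix \<open>\<Sum>j. z\<^sup>j (c \<otimes> e j j + d \<otimes> e (j + 1) j)\<close>, as the strict limit of the partial sums.  These are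
  bounded because the weighted shifts are partial isometries, and on each \<open>vec b j\<close> they are eventually
  constant.\<close>

lemma ex_creation_operator:
  assumes z: "cmod z = 1" and c: "c \<in> carrier B" and d: "d \<in> carrier B"
  obtains m where "m \<in> carrier M"
    "\<And>b j. b \<in> carrier B \<Longrightarrow>
      fst m (vec b j) = z ^ j \<odot>\<^bsub>T\<^esub> (vec (c \<otimes>\<^bsub>B\<^esub> b) j \<oplus>\<^bsub>T\<^esub> vec (d \<otimes>\<^bsub>B\<^esub> b) (Suc j))"
    "\<And>b. b \<in> carrier B \<Longrightarrow> snd m (vec b 0) = vec (adj B c \<otimes>\<^bsub>B\<^esub> b) 0"
    "\<And>b j. b \<in> carrier B \<Longrightarrow>
      snd m (vec b (Suc j)) = cnj z ^ Suc j \<odot>\<^bsub>T\<^esub> vec (adj B c \<otimes>\<^bsub>B\<^esub> b) (Suc j)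
        \<oplus>\<^bsub>T\<^esub> cnj z ^ j \<odot>\<^bsub>T\<^esub> vec (adj B d \<otimes>\<^bsub>B\<^esub> b) j"
proof -
  note [simp] = c d
  define a where "a n = tens c (K.weighted_shift z 0 n) \<oplus>\<^bsub>T\<^esub> tens d (K.weighted_shift z 1 n)" for n
  have aT [simp]: "a n \<in> carrier T" for n by (simp add: a_def)
  have norm_a: "cnorm T (a n) \<le> cnorm B c * 1 + cnorm B d * 1" for n
  proof -
    have "cnorm T (a n) \<le> cnorm B c * cnorm K (K.weighted_shift z 0 n)
        + cnorm B d * cnorm K (K.weighted_shift z 1 n)"
      unfolding a_def by (rule order_trans[OF T.cnorm_triangle]) (simp_all add: tens_norm)
    also have "\<dots> \<le> cnorm B c * 1 + cnorm B d * 1"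
      by (intro add_mono mult_left_mono K.cnorm_weighted_shift z) simp_all
    finally show ?thesis .
  qed
  have norm_adj_a: "cnorm T (adj T (a n)) \<le> cnorm B c * 1 + cnorm B d * 1" for n
    using norm_a[of n] by simp
  have a_vec: "a n \<otimes>\<^bsub>T\<^esub> vec b j = tens (c \<otimes>\<^bsub>B\<^esub> b) (K.weighted_shift z 0 n \<otimes>\<^bsub>K\<^esub> x j)
      \<oplus>\<^bsub>T\<^esub> tens (d \<otimes>\<^bsub>B\<^esub> b) (K.weighted_shift z 1 n \<otimes>\<^bsub>K\<^esub> x j)" if "b \<in> carrier B" for n b j
    using that by (simp add: a_def vec_def T.mult_add_left tens_mult)
  have adj_a_vec: "adj T (a n) \<otimes>\<^bsub>T\<^esub> vec b j = tens (adj B c \<otimes>\<^bsub>B\<^esub> b) (adj K (K.weighted_shift z 0 n) \<otimes>\<^bsub>K\<^esub> x j)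
      \<oplus>\<^bsub>T\<^esub> tens (adj B d \<otimes>\<^bsub>B\<^esub> b) (adj K (K.weighted_shift z 1 n) \<otimes>\<^bsub>K\<^esub> x j)" if "b \<in> carrier B" for n b j
    using that by (simp add: a_def vec_def T.mult_add_left T.adj_add tens_adj tens_mult)
  have lim_a: "cstar_lim T (\<lambda>n. a n \<otimes>\<^bsub>T\<^esub> vec b j) (z ^ j \<odot>\<^bsub>T\<^esub> (vec (c \<otimes>\<^bsub>B\<^esub> b) j \<oplus>\<^bsub>T\<^esub> vec (d \<otimes>\<^bsub>B\<^esub> b) (Suc j)))"
    if b: "b \<in> carrier B" for b j
    by (rule T.cstar_lim_eventually_const[where N = "Suc j"])
      (use b in \<open>auto simp: a_vec K.weighted_shift_x tens_smult_right T.smult_add simp flip: vec_def\<close>)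
  have lim_adj_0: "cstar_lim T (\<lambda>n. adj T (a n) \<otimes>\<^bsub>T\<^esub> vec b 0) (vec (adj B c \<otimes>\<^bsub>B\<^esub> b) 0)"
    if b: "b \<in> carrier B" for b
    by (rule T.cstar_lim_eventually_const[where N = 1])
      (use b in \<open>auto simp: adj_a_vec K.adj_weighted_shift_x tens_smult_right simp flip: vec_def\<close>)
  have lim_adj_Suc: "cstar_lim T (\<lambda>n. adj T (a n) \<otimes>\<^bsub>T\<^esub> vec b (Suc j))
      (cnj z ^ Suc j \<odot>\<^bsub>T\<^esub> vec (adj B c \<otimes>\<^bsub>B\<^esub> b) (Suc j) \<oplus>\<^bsub>T\<^esub> cnj z ^ j \<odot>\<^bsub>T\<^esub> vec (adj B d \<otimes>\<^bsub>B\<^esub> b) j)"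
    if b: "b \<in> carrier B" for b j
    by (rule T.cstar_lim_eventually_const[where N = "Suc (Suc j)"])
      (use b in \<open>auto simp: adj_a_vec K.adj_weighted_shift_x tens_smult_right simp flip: vec_def\<close>)
  have lim_adj: "\<exists>l. cstar_lim T (\<lambda>n. adj T (a n) \<otimes>\<^bsub>T\<^esub> vec b j) l" if b: "b \<in> carrier B" for b j
    using lim_adj_0[OF b] lim_adj_Suc[OF b] by (cases j) blast+
  have conv: "\<exists>l. cstar_lim T (\<lambda>n. s n \<otimes>\<^bsub>T\<^esub> t) l"
    if s: "\<And>n. s n \<in> carrier T" "\<And>n. cnorm T (s n) \<le> C"
      and l: "\<And>b j. b \<in> carrier B \<Longrightarrow> \<exists>l. cstar_lim T (\<lambda>n. s n \<otimes>\<^bsub>T\<^esub> vec b j) l"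
      and t: "t \<in> carrier T" for s C t
  proof -
    have "tens b (K.unit i j) \<in> {t \<in> carrier T. \<exists>l. cstar_lim T (\<lambda>n. s n \<otimes>\<^bsub>T\<^esub> t) l}"
      if b: "b \<in> carrier B" for b i j
    proof -
      obtain m where "cstar_lim T (\<lambda>n. s n \<otimes>\<^bsub>T\<^esub> vec b i) m" using l[OF b] by blast
      from T.cstar_lim_mult_right[OF this, of "tens \<one>\<^bsub>B\<^esub> (adj K (x j))"]
      show ?thesis using b s by (auto simp: tens_unit T.mult_assoc B.one_closed)
    qed
    from tens_total[OF T.closed_subspace_convergent[OF s] this t] show ?thesis by simp
  qed
  obtain m where m: "m \<in> carrier M" "\<And>t. t \<in> carrier T \<Longrightarrow> cstar_lim T (\<lambda>n. a n \<otimes>\<^bsub>T\<^esub> t) (fst m t)"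
    "\<And>t. t \<in> carrier T \<Longrightarrow> cstar_lim T (\<lambda>n. adj T (a n) \<otimes>\<^bsub>T\<^esub> t) (snd m t)"
  proof (rule T.ex_strict_limit[of a, OF aT norm_a])
    show "\<exists>l. cstar_lim T (\<lambda>n. a n \<otimes>\<^bsub>T\<^esub> t) l" if "t \<in> carrier T" for t
      by (rule conv[OF aT norm_a _ that]) (use lim_a in blast)
    show "\<exists>l. cstar_lim T (\<lambda>n. adj T (a n) \<otimes>\<^bsub>T\<^esub> t) l" if "t \<in> carrier T" for t
      by (rule conv[OF _ norm_adj_a lim_adj that]) simp_all
  qed blast
  show ?thesis
  proof (rule that[OF m(1)])
    fix b j assume b: "b \<in> carrier B"
    show "fst m (vec b j) = z ^ j \<odot>\<^bsub>T\<^esub> (vec (c \<otimes>\<^bsub>B\<^esub> b) j \<oplus>\<^bsub>T\<^esub> vec (d \<otimes>\<^bsub>B\<^esub> b) (Suc j))"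
      by (rule T.cstar_lim_unique[OF m(2) lim_a]) (use b in auto)
    show "snd m (vec b 0) = vec (adj B c \<otimes>\<^bsub>B\<^esub> b) 0"
      by (rule T.cstar_lim_unique[OF m(3) lim_adj_0]) (use b in auto)
    show "snd m (vec b (Suc j)) = cnj z ^ Suc j \<odot>\<^bsub>T\<^esub> vec (adj B c \<otimes>\<^bsub>B\<^esub> b) (Suc j)
        \<oplus>\<^bsub>T\<^esub> cnj z ^ j \<odot>\<^bsub>T\<^esub> vec (adj B d \<otimes>\<^bsub>B\<^esub> b) j"
      by (rule T.cstar_lim_unique[OF m(3) lim_adj_Suc]) (use b in auto)
  qed
qed

end

section \<open>Twisted isometries\<close>

context unital_cstar_algebra
begin

sublocale R: ring A
  by (rule ring_axioms_unital)

lemmas [simp] = one_closed one_mult mult_one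

lemma adj_one [simp]: "adj A \<one> = \<one>"
  using adj_mult[of \<one> "adj A \<one>"] by (simp add: adj_adj)

lemma adj_pow: "x \<in> carrier A \<Longrightarrow> adj A (x [^] (n::nat)) = adj A x [^] n"
proof (induction n)
  case (Suc n)
  have "adj A (x [^] Suc n) = adj A x \<otimes> adj A x [^] n" using Suc by (simp add: adj_mult)
  also have "\<dots> = adj A x [^] Suc n" using Suc by (intro R.nat_pow_Suc2[symmetric]) simp
  finally show ?case .
qed simp

lemma isometry_mult_adj: "x \<in> carrier A \<Longrightarrow> y \<in> carrier A \<Longrightarrow> adj A x \<otimes> x = \<one> \<Longrightarrow> adj A x \<otimes> (x \<otimes> y) = y"
  by (simp flip: mult_assoc)

lemma isometry_pow: "x \<in> carrier A \<Longrightarrow> adj A x \<otimes> x = \<one> \<Longrightarrow> adj A (x [^] (n::nat)) \<otimes> x [^] n = \<one>"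
proof (induction n)
  case (Suc n)
  have "adj A (x [^] Suc n) \<otimes> x [^] Suc n = adj A x \<otimes> (adj A (x [^] n) \<otimes> (x [^] n \<otimes> x))"
    using Suc by (simp add: adj_mult mult_assoc)
  then show ?case using Suc by (simp add: isometry_mult_adj)
qed simp

text \<open>Closed ideals as closed subspaces, so that the results on closed subspaces apply to them.\<close>

definition closed_two_sided_ideal :: "'a set \<Rightarrow> bool" where
  "closed_two_sided_ideal I \<longleftrightarrow>
     closed_subspace A I \<and> (\<forall>a\<in>carrier A. \<forall>x\<in>I. a \<otimes> x \<in> I \<and> x \<otimes> a \<in> I)"

lemma closed_two_sided_ideal_iff:
  "closed_two_sided_ideal I \<longleftrightarrow> ideal I A \<and> closedin (norm_topology A) I"
proof
  assume I: "closed_two_sided_ideal I"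
  then have V: "closed_subspace A I" by (simp add: closed_two_sided_ideal_def)
  note cl = closed_subspaceD[OF V]
  have "subgroup I (add_monoid A)"
  proof (rule M.add.subgroupI)
    show "\<ominus> x \<in> I" if "x \<in> I" for x
      using cl(2,5)[OF that] by (simp add: uminus_eq_smult)
  qed (use cl in auto)
  then have "ideal I A"
    using I by (intro idealI R.ring_axioms) (auto simp: closed_two_sided_ideal_def)
  then show "ideal I A \<and> closedin (norm_topology A) I"
    using V unfolding closed_subspace_def closedin_iff_seq by auto
next
  assume *: "ideal I A \<and> closedin (norm_topology A) I"
  then interpret I: ideal I A by simp
  have "c \<odot> x \<in> I" if "x \<in> I" for c x
    using I.I_l_closed[OF that, of "c \<odot> \<one>"] I.a_subset that by (auto simp: smult_mult_left)
  then have "closed_subspace A I"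
    using * I.a_subset unfolding closed_subspace_def closedin_iff_seq
    by (auto simp: I.additive_subgroup_axioms additive_subgroup.zero_closed additive_subgroup.a_closed)
  then show "closed_two_sided_ideal I"
    by (auto simp: closed_two_sided_ideal_def I.I_l_closed I.I_r_closed)
qed

lemma closed_ideal_generated:
  assumes S: "S \<subseteq> carrier A"
  shows "closed_two_sided_ideal (closed_ideal_generated A S)" "S \<subseteq> closed_ideal_generated A S"
    "closed_two_sided_ideal I \<Longrightarrow> S \<subseteq> I \<Longrightarrow> closed_ideal_generated A S \<subseteq> I"
proof -
  have eq: "closed_ideal_generated A S = {x. \<forall>I\<in>{I. closed_two_sided_ideal I \<and> S \<subseteq> I}. x \<in> I}"
    by (auto simp: closed_ideal_generated_def closed_two_sided_ideal_iff)
  show "S \<subseteq> closed_ideal_generated A S" "closed_two_sided_ideal I \<Longrightarrow> S \<subseteq> I \<Longrightarrow> closed_ideal_generated A S \<subseteq> I"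
    by (auto simp: eq)
  have "closed_two_sided_ideal (carrier A)"
    by (simp add: closed_two_sided_ideal_def closed_subspace_carrier)
  then have "closed_subspace A (closed_ideal_generated A S)"
    unfolding eq using S by (intro closed_subspace_Ball) (auto simp: closed_two_sided_ideal_def)
  then show "closed_two_sided_ideal (closed_ideal_generated A S)"
    unfolding closed_two_sided_ideal_def by (auto simp: eq closed_two_sided_ideal_def)
qed

end

text \<open>Below, \<open>s\<close> is the twisting scalar, \<open>e\<close> and \<open>f\<close> are the defects of \<open>u\<close> and \<open>v\<close>, and \<open>q\<close> is the defect of \<open>w = u v\<close>,
  the projection onto the wandering subspace of \<open>w\<close>.\<close>

locale twisted_pair = unital_cstar_algebra A for A (structure) +
  fixes \<theta> :: real and u v
  assumes twist: "twisted_isometries \<theta> A u v" and gen: "cstar_generated_by A {u, v}"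
begin

definition s where "s = cis (2 * pi * \<theta>)"
definition w where "w = u \<otimes> v"
definition e where "e = \<one> \<ominus> u \<otimes> adj A u"
definition f where "f = \<one> \<ominus> v \<otimes> adj A v"
definition q where "q = \<one> \<ominus> w \<otimes> adj A w"
abbreviation "U' \<equiv> ubar A u v"
abbreviation "P' \<equiv> pbar A u v"
abbreviation "J \<equiv> defect_ideal A u v"

lemma s_cnj [simp]: "s * cnj s = 1" "cnj s * s = 1"
  by (simp_all add: s_def cis_cnj cis_mult)

lemma uv_closed [simp]: "u \<in> carrier A" "v \<in> carrier A" "w \<in> carrier A"
  and uu [simp]: "adj A u \<otimes> u = \<one>" and vv [simp]: "adj A v \<otimes> v = \<one>"
  and uv: "u \<otimes> v = s \<odot> (v \<otimes> u)"
  using twist by (auto simp: twisted_isometries_def isometry_elem_def s_def w_def)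

lemma defect_closed [simp]: "e \<in> carrier A" "f \<in> carrier A" "q \<in> carrier A"
  by (simp_all add: e_def f_def q_def)

lemma defect_adj [simp]: "adj A e = e" "adj A f = f" "adj A q = q"
  by (simp_all add: e_def f_def q_def adj_minus adj_mult adj_adj)

lemmas uuy [simp] = isometry_mult_adj[OF uv_closed(1) _ uu]
lemmas vvy [simp] = isometry_mult_adj[OF uv_closed(2) _ vv]

lemma vu: "v \<otimes> u = cnj s \<odot> w"
  by (simp add: w_def uv)

lemma w_eq: "w = s \<odot> (v \<otimes> u)"
  by (simp add: w_def uv)

lemma adj_w: "adj A w = adj A v \<otimes> adj A u" "adj A w = cnj s \<odot> (adj A u \<otimes> adj A v)"
  using arg_cong[OF w_eq, of "adj A"] by (simp_all add: w_def adj_mult adj_smult)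

lemma ww [simp]: "adj A w \<otimes> w = \<one>"
  by (simp add: w_def adj_mult mult_assoc)

lemmas wwy [simp] = isometry_mult_adj[OF uv_closed(3) _ ww]

lemma defect_zero [simp]: "e \<otimes> u = \<zero>" "f \<otimes> v = \<zero>" "q \<otimes> w = \<zero>" "adj A u \<otimes> e = \<zero>" "adj A v \<otimes> f = \<zero>" "adj A w \<otimes> q = \<zero>"
  by (simp_all add: e_def f_def q_def mult_minus_left mult_minus_right mult_assoc)

lemma defect_zero_assoc [simp]:
  assumes "y \<in> carrier A"
  shows "e \<otimes> (u \<otimes> y) = \<zero>" "f \<otimes> (v \<otimes> y) = \<zero>" "q \<otimes> (w \<otimes> y) = \<zero>"
    "adj A u \<otimes> (e \<otimes> y) = \<zero>" "adj A v \<otimes> (f \<otimes> y) = \<zero>" "adj A w \<otimes> (q \<otimes> y) = \<zero>"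
  using assms by (simp_all flip: mult_assoc)

lemma defect_idem [simp]: "e \<otimes> e = e" "f \<otimes> f = f" "q \<otimes> q = q"
proof -
  show "e \<otimes> e = e" by (subst (2) e_def) (simp add: mult_minus_right)
  show "f \<otimes> f = f" by (subst (2) f_def) (simp add: mult_minus_right)
  show "q \<otimes> q = q" by (subst (2) q_def) (simp add: mult_minus_right)
qed

lemma defect_idem_assoc [simp]:
  assumes "y \<in> carrier A" shows "e \<otimes> (e \<otimes> y) = e \<otimes> y" "f \<otimes> (f \<otimes> y) = f \<otimes> y" "q \<otimes> (q \<otimes> y) = q \<otimes> y"
  using assms by (simp_all flip: mult_assoc)

text \<open>The defect of a product, computed for \<open>u v\<close> here and for \<open>v u\<close>, a scalar multiple of it, in \<open>q_eq2\<close>.\<close>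

lemma q_eq1: "q = e \<oplus> u \<otimes> f \<otimes> adj A u"
proof -
  have "u \<otimes> f \<otimes> adj A u = u \<otimes> adj A u \<ominus> w \<otimes> adj A w"
    by (simp add: f_def mult_minus_left mult_minus_right w_def adj_mult mult_assoc)
  then show ?thesis
    using minus_telescope[of \<one> "u \<otimes> adj A u" "w \<otimes> adj A w"] by (simp add: q_def e_def)
qed

lemma q_eq2: "q = f \<oplus> v \<otimes> e \<otimes> adj A v"
proof -
  have "w \<otimes> adj A w = v \<otimes> u \<otimes> (adj A u \<otimes> adj A v)"
    by (subst w_eq, subst adj_w(2)) (simp add: smult_mult_left smult_mult_right)
  then have "v \<otimes> e \<otimes> adj A v = v \<otimes> adj A v \<ominus> w \<otimes> adj A w"
    by (simp add: e_def mult_minus_left mult_minus_right mult_assoc)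
  then show ?thesis
    using minus_telescope[of \<one> "v \<otimes> adj A v" "w \<otimes> adj A w"] by (simp add: q_def f_def)
qed

lemma U'_eq: "U' = u \<otimes> f \<oplus> e \<otimes> adj A v"
  by (simp add: ubar_def e_def f_def)

lemma P'_eq: "P' = v \<otimes> e \<otimes> adj A v"
  by (simp add: pbar_def e_def)

lemma bar_closed [simp]: "U' \<in> carrier A" "P' \<in> carrier A"
  by (simp_all add: U'_eq P'_eq)

lemma adj_U': "adj A U' = f \<otimes> adj A u \<oplus> v \<otimes> e"
  by (simp add: U'_eq adj_add adj_mult adj_adj)

lemma adj_P' [simp]: "adj A P' = P'"
  by (simp add: P'_eq adj_mult adj_adj mult_assoc)

lemma P'_P' [simp]: "P' \<otimes> P' = P'"
  by (simp add: P'_eq mult_assoc)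

lemma q_eq: "q = f \<oplus> P'"
  by (simp add: P'_eq q_eq2)

lemma f_eq: "f = q \<ominus> P'"
  by (simp add: q_eq a_minus_def M.a_assoc M.r_neg)

lemma q_P' [simp]: "q \<otimes> P' = P'" "P' \<otimes> q = P'"
proof -
  show "q \<otimes> P' = P'" unfolding q_eq by (simp add: mult_add_left) (simp add: P'_eq mult_assoc)
  from arg_cong[OF this, of "adj A"] show "P' \<otimes> q = P'" by (simp add: adj_mult)
qed

text \<open>The two parts of \<open>U'\<close>: on \<open>f = q - P'\<close> it acts as \<open>u\<close>, on \<open>P'\<close> as \<open>v\<^sup>*\<close>.\<close>

lemma U'_f: "U' \<otimes> f = u \<otimes> f"
  by (simp add: U'_eq mult_add_left mult_assoc)

lemma U'_P': "U' \<otimes> P' = e \<otimes> adj A v"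
  by (simp add: U'_eq P'_eq mult_add_left mult_assoc)

lemma U'_q [simp]: "U' \<otimes> q = U'"
  unfolding q_eq by (simp add: mult_add_right U'_f U'_P') (simp add: U'_eq)

lemma U'_unitary [simp]: "adj A U' \<otimes> U' = q" "U' \<otimes> adj A U' = q"
proof -
  have "adj A U' \<otimes> U' = f \<oplus> v \<otimes> e \<otimes> adj A v"
    unfolding adj_U' unfolding U'_eq by (simp add: mult_add_left mult_add_right mult_assoc)
  then show "adj A U' \<otimes> U' = q" by (simp add: q_eq2)
  have "U' \<otimes> adj A U' = u \<otimes> f \<otimes> adj A u \<oplus> e"
    unfolding adj_U' unfolding U'_eq by (simp add: mult_add_left mult_add_right mult_assoc)
  then show "U' \<otimes> adj A U' = q" by (simp add: q_eq1 M.a_comm)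
qed

lemma q_U' [simp]: "q \<otimes> U' = U'"
  by (subst U'_unitary(2)[symmetric], subst mult_assoc) simp_all

text \<open>How \<open>u\<close>, \<open>v\<close> and their adjoints act between the wandering subspace and its translates.  All coefficients
  (\<open>u f\<close>, \<open>e v\<^sup>*\<close> and their adjoints) lie in the algebra generated by \<open>U'\<close> and \<open>P'\<close>.\<close>

lemma q_u: "q \<otimes> u = u \<otimes> f" and q_v: "q \<otimes> v = v \<otimes> e"
  by (simp_all add: q_eq1[THEN arg_cong[where f = "\<lambda>x. x \<otimes> u"]] q_eq2[THEN arg_cong[where f = "\<lambda>x. x \<otimes> v"]]
      mult_add_left mult_assoc)

lemma q_adj_u: "q \<otimes> adj A u = f \<otimes> adj A u \<oplus> v \<otimes> e \<otimes> adj A w"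
proof -
  have "u \<otimes> q = u \<otimes> f \<oplus> w \<otimes> (e \<otimes> adj A v)"
    by (subst q_eq2) (simp add: mult_add_right w_def mult_assoc)
  from arg_cong[OF this, of "adj A"] show ?thesis
    by (simp add: adj_mult adj_add adj_adj)
qed

lemma q_adj_v: "q \<otimes> adj A v = e \<otimes> adj A v \<oplus> s \<odot> (u \<otimes> f \<otimes> adj A w)"
proof -
  have "v \<otimes> q = v \<otimes> e \<oplus> v \<otimes> u \<otimes> (f \<otimes> adj A u)"
    by (subst q_eq1) (simp add: mult_add_right mult_assoc)
  also have "\<dots> = v \<otimes> e \<oplus> cnj s \<odot> (w \<otimes> (f \<otimes> adj A u))"
    by (simp add: vu smult_mult_left)
  finally have "v \<otimes> q = v \<otimes> e \<oplus> cnj s \<odot> (w \<otimes> (f \<otimes> adj A u))" .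
  from arg_cong[OF this, of "adj A"] show ?thesis
    by (simp add: adj_mult adj_add adj_adj adj_smult)
qed

text \<open>The isometry \<open>w\<close> commutes up to a scalar with \<open>u\<close> and \<open>v\<close>, and hence \<open>w\<^sup>*\<close> with their adjoints.  Multiplied
  with \<open>u\<close> or \<open>v\<close> themselves, \<open>w\<^sup>*\<close> cancels a factor.\<close>

lemma adj_w_u: "adj A w \<otimes> u = adj A v" and adj_w_v: "adj A w \<otimes> v = cnj s \<odot> adj A u"
  by (simp add: adj_w(1) mult_assoc) (simp add: adj_w(2) mult_assoc smult_mult_left)

lemma adj_w_adj_u: "adj A w \<otimes> adj A u = cnj s \<odot> (adj A u \<otimes> adj A w)"
  by (subst adj_w(2)) (simp add: adj_w(1) smult_mult_left mult_assoc)

lemma adj_w_adj_v: "adj A w \<otimes> adj A v = s \<odot> (adj A v \<otimes> adj A w)"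
  by (subst (2) adj_w(2)) (simp add: adj_w(1) smult_mult_right mult_assoc)

definition V where "V i = adj A (w [^] (i::nat))"

lemma V_closed [simp]: "V i \<in> carrier A" "w [^] (i::nat) \<in> carrier A"
  by (simp_all add: V_def)

lemma V_0 [simp]: "V 0 = \<one>"
  by (simp add: V_def)

lemma V_Suc: "V (Suc i) = V i \<otimes> adj A w" "V (Suc i) = adj A w \<otimes> V i"
proof -
  show "V (Suc i) = adj A w \<otimes> V i" by (simp add: V_def adj_mult)
  show "V (Suc i) = V i \<otimes> adj A w" unfolding V_def adj_pow[OF uv_closed(3)] by simp
qed

lemma w_pow_Suc: "y \<in> carrier A \<Longrightarrow> w [^] Suc k \<otimes> y = w \<otimes> (w [^] k \<otimes> y)"
  by (subst R.nat_pow_Suc2) (simp_all add: mult_assoc)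

lemma V_w [simp]: "V i \<otimes> w [^] i = \<one>"
  by (simp add: V_def isometry_pow)

lemma V_adj_u: "V i \<otimes> adj A u = cnj s ^ i \<odot> (adj A u \<otimes> V i)"
proof (induction i)
  case (Suc i)
  have "V (Suc i) \<otimes> adj A u = adj A w \<otimes> (V i \<otimes> adj A u)" by (simp add: V_Suc(2) mult_assoc)
  also have "\<dots> = cnj s ^ i \<odot> (adj A w \<otimes> adj A u \<otimes> V i)" by (simp add: Suc smult_mult_right mult_assoc)
  also have "\<dots> = cnj s ^ Suc i \<odot> (adj A u \<otimes> V (Suc i))"
    by (simp add: adj_w_adj_u smult_mult_left mult_assoc V_Suc(2) mult.commute)
  finally show ?case .
qed simp

lemma V_adj_v: "V i \<otimes> adj A v = s ^ i \<odot> (adj A v \<otimes> V i)"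
proof (induction i)
  case (Suc i)
  have "V (Suc i) \<otimes> adj A v = adj A w \<otimes> (V i \<otimes> adj A v)" by (simp add: V_Suc(2) mult_assoc)
  also have "\<dots> = s ^ i \<odot> (adj A w \<otimes> adj A v \<otimes> V i)" by (simp add: Suc smult_mult_right mult_assoc)
  also have "\<dots> = s ^ Suc i \<odot> (adj A v \<otimes> V (Suc i))"
    by (simp add: adj_w_adj_v smult_mult_left mult_assoc V_Suc(2) mult.commute)
  finally show ?case .
qed simp

lemma V_Suc_u: "V (Suc i) \<otimes> u = s ^ i \<odot> (adj A v \<otimes> V i)"
  by (simp add: V_Suc(1) mult_assoc adj_w_u V_adj_v)

lemma V_Suc_v: "V (Suc i) \<otimes> v = cnj s ^ Suc i \<odot> (adj A u \<otimes> V i)"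
  by (simp add: V_Suc(1) mult_assoc adj_w_v V_adj_u smult_mult_right)

text \<open>The subspaces \<open>w\<^sup>i q\<close> are pairwise orthogonal.\<close>

lemma V_q: "q \<otimes> (V i \<otimes> (w [^] j \<otimes> q)) = (if i = j then q else \<zero>)"
proof (induction i arbitrary: j)
  case 0
  show ?case
    by (cases j) (simp_all add: w_pow_Suc del: R.nat_pow_Suc Group.nat_pow_Suc)
next
  case (Suc i)
  show ?case
  proof (cases j)
    case 0
    then show ?thesis by (simp add: V_Suc(1) mult_assoc)
  next
    case (Suc k)
    have "V (Suc i) \<otimes> (w [^] j \<otimes> q) = V i \<otimes> (w [^] k \<otimes> q)"
      unfolding Suc V_Suc(1) by (subst w_pow_Suc) (simp_all add: mult_assoc)
    then show ?thesis by (simp add: Suc.IH Suc)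
  qed
qed

section \<open>The corner at the wandering projection\<close>

text \<open>The set of all \<open>y\<close> with every \<open>q w\<^sup>*\<^sup>i y\<close> in \<open>Y\<close> is stable under left multiplication by \<open>u\<close>, \<open>v\<close> and
  their adjoints: these can be moved past \<open>w\<^sup>*\<^sup>i\<close>, and next to \<open>q\<close> they become elements of \<open>Y\<close> followed by at
  most one \<open>w\<^sup>*\<close>.  The set contains every \<open>w\<^sup>j q\<close>, so it is a left ideal containing every \<open>a w\<^sup>j q\<close>.\<close>

lemma corner_entries:
  assumes Y: "cstar_subalgebra Y A" "q \<in> Y" "U' \<in> Y" "P' \<in> Y"
    and a: "a \<in> carrier A"
  shows "q \<otimes> (V i \<otimes> (a \<otimes> (w [^] (j::nat) \<otimes> q))) \<in> Y"
proof -
  note cl = closed_subspaceD[OF cstar_subalgebraD(1)[OF Y(1)]]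
  note Y' = cstar_subalgebraD(2,3)[OF Y(1)]
  define L where "L = {y. \<forall>i. y \<in> {y \<in> carrier A. q \<otimes> V i \<otimes> y \<in> Y}}"
  have L: "closed_subspace A L"
    unfolding L_def
    by (intro closed_subspace_All closed_subspace_mult_left cstar_subalgebraD(1)[OF Y(1)]) simp
  have LI: "y \<in> L" if "y \<in> carrier A" "\<And>i. q \<otimes> (V i \<otimes> y) \<in> Y" for y
    using that by (simp add: L_def mult_assoc)
  have LD: "y \<in> carrier A" "q \<otimes> (V i \<otimes> y) \<in> Y" if "y \<in> L" for y i
    using that by (auto simp: L_def mult_assoc)
  have fY: "f \<in> Y" unfolding f_eq by (rule cl(6)[OF Y(2,4)])
  have ufY: "u \<otimes> f \<in> Y" using Y'(1)[OF Y(3) fY] by (simp add: U'_f)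
  have evY: "e \<otimes> adj A v \<in> Y" using Y'(1)[OF Y(3,4)] by (simp add: U'_P')
  have fuY: "f \<otimes> adj A u \<in> Y" using Y'(2)[OF ufY] by (simp add: adj_mult)
  have veY: "v \<otimes> e \<in> Y" using Y'(2)[OF evY] by (simp add: adj_mult adj_adj)
  have fq: "f \<otimes> q = f" by (simp add: f_eq mult_minus_left)
  have ufq: "u \<otimes> f \<otimes> q = u \<otimes> f" by (simp add: mult_assoc fq)
  have evq: "e \<otimes> adj A v \<otimes> q = e \<otimes> adj A v" by (simp flip: U'_P' add: mult_assoc)
  have "q \<otimes> (u \<otimes> f) = u \<otimes> f" by (simp flip: U'_f) (simp flip: mult_assoc)
  from arg_cong[OF this, of "adj A"] have fuq: "f \<otimes> adj A u \<otimes> q = f \<otimes> adj A u" by (simp add: adj_mult)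
  have "q \<otimes> (e \<otimes> adj A v) = e \<otimes> adj A v" by (simp flip: U'_P') (simp flip: mult_assoc)
  from arg_cong[OF this, of "adj A"] have veq: "v \<otimes> e \<otimes> q = v \<otimes> e" by (simp add: adj_mult adj_adj)
  \<comment> \<open>elements of the corner absorb \<open>q\<close>\<close>
  have qq: "c \<otimes> z \<in> Y" if "c \<in> Y" "c \<otimes> q = c" "z \<in> carrier A" "q \<otimes> z \<in> Y" for c z
    using Y'(1)[OF that(1,4)] that(2,3) cl(2)[OF that(1)] by (simp flip: mult_assoc)
  have A1: "q \<otimes> (adj A u \<otimes> (V i \<otimes> y)) \<in> Y" if y: "y \<in> L" for y i
  proof -
    have "q \<otimes> (adj A u \<otimes> (V i \<otimes> y)) = (q \<otimes> adj A u) \<otimes> (V i \<otimes> y)"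
      using LD(1)[OF y] by (simp add: mult_assoc)
    also have "\<dots> = f \<otimes> adj A u \<otimes> (V i \<otimes> y) \<oplus> v \<otimes> e \<otimes> (V (Suc i) \<otimes> y)"
      using LD(1)[OF y] by (simp add: q_adj_u mult_add_left V_Suc(2) mult_assoc)
    also have "\<dots> \<in> Y"
      using LD[OF y] by (intro cl(4)[OF qq[OF fuY fuq] qq[OF veY veq]]) simp_all
    finally show ?thesis .
  qed
  have A2: "q \<otimes> (adj A v \<otimes> (V i \<otimes> y)) \<in> Y" if y: "y \<in> L" for y i
  proof -
    have "q \<otimes> (adj A v \<otimes> (V i \<otimes> y)) = (q \<otimes> adj A v) \<otimes> (V i \<otimes> y)"
      using LD(1)[OF y] by (simp add: mult_assoc)
    also have "\<dots> = e \<otimes> adj A v \<otimes> (V i \<otimes> y) \<oplus> s \<odot> (u \<otimes> f \<otimes> (V (Suc i) \<otimes> y))"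
      using LD(1)[OF y] by (simp add: q_adj_v mult_add_left smult_mult_left V_Suc(2) mult_assoc)
    also have "\<dots> \<in> Y"
      using LD[OF y] by (intro cl(4)[OF qq[OF evY evq] cl(5)[OF qq[OF ufY ufq]]]) simp_all
    finally show ?thesis .
  qed
  have "a \<otimes> (w [^] j \<otimes> q) \<in> L"
  proof (rule left_stable[OF gen L _ _ a])
    show "w [^] j \<otimes> q \<in> L"
      by (rule LI) (simp_all add: V_q Y cl(3))
    fix t y assume t: "t \<in> {u, v}" and y: "y \<in> L"
    note [simp] = LD(1)[OF y]
    have "q \<otimes> (V i \<otimes> (u \<otimes> y)) \<in> Y" for i
    proof (cases i)
      case 0
      have "q \<otimes> (V i \<otimes> (u \<otimes> y)) = (q \<otimes> u) \<otimes> (V 0 \<otimes> y)" by (simp add: 0 mult_assoc)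
      also have "\<dots> \<in> Y" unfolding q_u by (rule qq[OF ufY ufq]) (simp, rule LD(2)[OF y])
      finally show ?thesis .
    next
      case (Suc k)
      have "V i \<otimes> (u \<otimes> y) = s ^ k \<odot> (adj A v \<otimes> (V k \<otimes> y))"
        using arg_cong[OF V_Suc_u[of k], of "\<lambda>z. z \<otimes> y"] by (simp add: Suc mult_assoc smult_mult_left)
      then show ?thesis using cl(5)[OF A2[OF y]] by (simp add: smult_mult_right)
    qed
    moreover have "q \<otimes> (V i \<otimes> (v \<otimes> y)) \<in> Y" for i
    proof (cases i)
      case 0
      have "q \<otimes> (V i \<otimes> (v \<otimes> y)) = (q \<otimes> v) \<otimes> (V 0 \<otimes> y)" by (simp add: 0 mult_assoc)
      also have "\<dots> \<in> Y" unfolding q_v by (rule qq[OF veY veq]) (simp, rule LD(2)[OF y])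
      finally show ?thesis .
    next
      case (Suc k)
      have "V i \<otimes> (v \<otimes> y) = cnj s ^ Suc k \<odot> (adj A u \<otimes> (V k \<otimes> y))"
        using arg_cong[OF V_Suc_v[of k], of "\<lambda>z. z \<otimes> y"] by (simp add: Suc mult_assoc smult_mult_left)
      then show ?thesis using cl(5)[OF A1[OF y]] by (simp add: smult_mult_right)
    qed
    ultimately show "t \<otimes> y \<in> L" using t by (auto intro!: LI)
    have "q \<otimes> (V i \<otimes> (adj A u \<otimes> y)) \<in> Y" for i
    proof -
      have "V i \<otimes> (adj A u \<otimes> y) = cnj s ^ i \<odot> (adj A u \<otimes> (V i \<otimes> y))"
        using arg_cong[OF V_adj_u[of i], of "\<lambda>z. z \<otimes> y"] by (simp add: mult_assoc smult_mult_left)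
      then show ?thesis using cl(5)[OF A1[OF y]] by (simp add: smult_mult_right)
    qed
    moreover have "q \<otimes> (V i \<otimes> (adj A v \<otimes> y)) \<in> Y" for i
    proof -
      have "V i \<otimes> (adj A v \<otimes> y) = s ^ i \<odot> (adj A v \<otimes> (V i \<otimes> y))"
        using arg_cong[OF V_adj_v[of i], of "\<lambda>z. z \<otimes> y"] by (simp add: mult_assoc smult_mult_left)
      then show ?thesis using cl(5)[OF A2[OF y]] by (simp add: smult_mult_right)
    qed
    ultimately show "adj A t \<otimes> y \<in> L" using t by (auto intro!: LI)
  qed
  then show ?thesis using LD(2) by blast
qed

section \<open>An approximate unit of the defect ideal\<close>

lemma J: "closed_two_sided_ideal J" "e \<in> J" "f \<in> J"
  and J_least: "closed_two_sided_ideal I \<Longrightarrow> e \<in> I \<Longrightarrow> f \<in> I \<Longrightarrow> J \<subseteq> I"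
  using closed_ideal_generated[of "{e, f}"] unfolding defect_ideal_def e_def f_def by auto

lemma J_closed_subspace: "closed_subspace A J"
  and J_mult: "a \<in> carrier A \<Longrightarrow> x \<in> J \<Longrightarrow> a \<otimes> x \<in> J" "a \<in> carrier A \<Longrightarrow> x \<in> J \<Longrightarrow> x \<otimes> a \<in> J"
  using J(1) by (auto simp: closed_two_sided_ideal_def)

lemmas JD = closed_subspaceD[OF J_closed_subspace]

lemma q_in_J: "q \<in> J"
  unfolding q_eq1 using J by (intro JD(4) J_mult) simp_all

lemma J_adj: "x \<in> J \<Longrightarrow> adj A x \<in> J"
proof -
  have "closed_two_sided_ideal {x \<in> carrier A. adj A x \<in> J}"
    unfolding closed_two_sided_ideal_def
    by (auto simp: closed_subspace_adj[OF J_closed_subspace] J_mult adj_mult)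
  from J_least[OF this] show "x \<in> J \<Longrightarrow> adj A x \<in> J"
    using J by auto
qed

lemma cnorm_V_le: "cnorm A (V i) \<le> 1" "cnorm A (w [^] (i::nat)) \<le> 1"
proof -
  show "cnorm A (w [^] i) \<le> 1"
    by (rule cnorm_le_1_if_adj_mult_projection) (simp_all add: isometry_pow)
  then show "cnorm A (V i) \<le> 1" by (simp add: V_def)
qed

text \<open>The elements \<open>a\<close> with \<open>w\<^sup>*\<^sup>n a \<longrightarrow> 0\<close> form a closed right ideal.  It is also a left ideal, since \<open>w\<^sup>*\<^sup>n\<close>
  moves past the generators up to scalars of modulus 1 at the cost of at most one factor \<open>w\<^sup>*\<close>, and it contains both
  defects, as \<open>w\<^sup>* e = w\<^sup>* f = 0\<close>.\<close>

lemma V_lim_0: "a \<in> J \<Longrightarrow> (\<lambda>n. cnorm A (V n \<otimes> a)) \<longlonglongrightarrow> 0"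
proof -
  define I where "I = {a \<in> carrier A. (\<lambda>n. cnorm A (V n \<otimes> a)) \<longlonglongrightarrow> 0}"
  have bound: "cnorm A (V n \<otimes> a) \<le> cnorm A a" if "a \<in> carrier A" for n a
    using cnorm_mult[of "V n" a] mult_right_mono[OF cnorm_V_le(1), of "cnorm A a" n] that by simp
  have I: "closed_subspace A I"
  proof (rule closed_subspaceI)
    fix t l assume t: "\<And>n. t n \<in> I" and l: "cstar_lim A t l"
    note [simp] = cstar_limD(1,2)[OF l]
    have "(\<lambda>n. cnorm A (V n \<otimes> l)) \<longlonglongrightarrow> 0"
    proof (rule LIMSEQ_I)
      fix r :: real assume r: "r > 0"
      obtain k where k: "cnorm A (t k \<ominus> l) < r / 2"
        using LIMSEQ_D[OF cstar_limD(3)[OF l], of "r / 2"] r by force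
      obtain N where N: "\<And>n. n \<ge> N \<Longrightarrow> cnorm A (V n \<otimes> t k) < r / 2"
        using t[of k] LIMSEQ_D[of "\<lambda>n. cnorm A (V n \<otimes> t k)" 0 "r / 2"] r by (auto simp: I_def)
      have "cnorm A (V n \<otimes> l) < r" if n: "n \<ge> N" for n
      proof -
        have "cnorm A (V n \<otimes> l) \<le> cnorm A (V n \<otimes> l \<ominus> V n \<otimes> t k) + cnorm A (V n \<otimes> t k)"
          by (rule cnorm_triangle_diff) simp_all
        also have "V n \<otimes> l \<ominus> V n \<otimes> t k = V n \<otimes> (l \<ominus> t k)" by (simp add: mult_minus_right)
        also have "cnorm A (V n \<otimes> (l \<ominus> t k)) \<le> cnorm A (t k \<ominus> l)"
          using bound[of "l \<ominus> t k" n] cnorm_minus_commute[of l "t k"] by simp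
        finally show ?thesis using k N[OF n] by simp
      qed
      then show "\<exists>no. \<forall>n\<ge>no. norm (cnorm A (V n \<otimes> l) - 0) < r" by auto
    qed
    then show "l \<in> I" by (simp add: I_def)
  next
    fix x y c assume x: "x \<in> I"
    have "(\<lambda>n. cmod c * cnorm A (V n \<otimes> x)) \<longlonglongrightarrow> 0"
      using x tendsto_mult_right_zero by (auto simp: I_def)
    then show "c \<odot> x \<in> I" using x by (simp add: I_def smult_mult_right cnorm_smult)
    assume y: "y \<in> I"
    have "(\<lambda>n. cnorm A (V n \<otimes> x) + cnorm A (V n \<otimes> y)) \<longlonglongrightarrow> 0"
      using tendsto_add[of "\<lambda>n. cnorm A (V n \<otimes> x)" 0 _ "\<lambda>n. cnorm A (V n \<otimes> y)" 0] x y by (simp add: I_def)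
    then have "(\<lambda>n. cnorm A (V n \<otimes> (x \<oplus> y))) \<longlonglongrightarrow> 0"
      by (rule tendsto_sandwich[OF _ _ tendsto_const, rotated 2])
        (use x y in \<open>auto simp: I_def mult_add_right intro!: always_eventually cnorm_triangle\<close>)
    then show "x \<oplus> y \<in> I" using x y by (simp add: I_def)
  qed (auto simp: I_def)
  \<comment> \<open>shifting the index by one makes room for a cancelled factor \<open>w\<^sup>*\<close>\<close>
  have dom: "y \<in> I" if "y \<in> carrier A" "x \<in> I" "\<And>n. cnorm A (V (Suc n) \<otimes> y) \<le> cnorm A (V n \<otimes> x) * C" for x y C
  proof -
    have "(\<lambda>n. cnorm A (V n \<otimes> x) * C) \<longlonglongrightarrow> 0"
      using that(2) tendsto_mult_left_zero by (auto simp: I_def)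
    then have "(\<lambda>n. cnorm A (V (Suc n) \<otimes> y)) \<longlonglongrightarrow> 0"
      by (rule tendsto_sandwich[OF _ _ tendsto_const, rotated 2]) (use that in \<open>auto intro!: always_eventually\<close>)
    then show ?thesis using that(1) LIMSEQ_imp_Suc by (auto simp: I_def)
  qed
  have L: "x \<otimes> y \<in> I" if x: "x \<in> carrier A" and y: "y \<in> I" for x y
  proof (rule left_stable[OF gen I _ _ x y])
    fix t z assume t: "t \<in> {u, v}" and z: "z \<in> I"
    have zA [simp]: "z \<in> carrier A" using z by (simp add: I_def)
    have s1: "cmod (s ^ n) = 1" "cmod (cnj s ^ n) = 1" for n by (simp_all add: norm_power s_def)
    have ns: "cnorm A (a \<otimes> (V n \<otimes> z)) \<le> cnorm A (V n \<otimes> z) * cnorm A a" if "a \<in> carrier A" for a n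
      using cnorm_mult[of a "V n \<otimes> z"] that by (simp add: mult.commute)
    have ns': "cnorm A (a \<otimes> (V (Suc n) \<otimes> z)) \<le> cnorm A (V n \<otimes> z) * (cnorm A w * cnorm A a)" if "a \<in> carrier A" for a n
    proof -
      have "cnorm A (V (Suc n) \<otimes> z) \<le> cnorm A (V n \<otimes> z) * cnorm A w"
        using ns[of "adj A w" n] by (simp add: V_Suc(2) mult_assoc)
      then have "cnorm A (V (Suc n) \<otimes> z) * cnorm A a \<le> cnorm A (V n \<otimes> z) * cnorm A w * cnorm A a"
        using that by (intro mult_right_mono) simp_all
      then show ?thesis using ns[OF that, of "Suc n"] by (simp add: mult.assoc)
    qed
    have "u \<otimes> z \<in> I"
    proof (rule dom[OF _ z])
      fix n
      have "V (Suc n) \<otimes> (u \<otimes> z) = s ^ n \<odot> (adj A v \<otimes> (V n \<otimes> z))"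
        using arg_cong[OF V_Suc_u[of n], of "\<lambda>y. y \<otimes> z"] by (simp add: mult_assoc smult_mult_left)
      then show "cnorm A (V (Suc n) \<otimes> (u \<otimes> z)) \<le> cnorm A (V n \<otimes> z) * cnorm A (adj A v)"
        using ns[of "adj A v" n] by (simp add: cnorm_smult s1)
    qed simp
    moreover have "v \<otimes> z \<in> I"
    proof (rule dom[OF _ z])
      fix n
      have "V (Suc n) \<otimes> (v \<otimes> z) = cnj s ^ Suc n \<odot> (adj A u \<otimes> (V n \<otimes> z))"
        using arg_cong[OF V_Suc_v[of n], of "\<lambda>y. y \<otimes> z"] by (simp add: mult_assoc smult_mult_left)
      then show "cnorm A (V (Suc n) \<otimes> (v \<otimes> z)) \<le> cnorm A (V n \<otimes> z) * cnorm A (adj A u)"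
        using ns[of "adj A u" n] s1(2)[of "Suc n"] by (simp add: cnorm_smult del: power_Suc)
    qed simp
    ultimately show "t \<otimes> z \<in> I" using t by auto
    have "adj A u \<otimes> z \<in> I"
    proof (rule dom[OF _ z])
      fix n
      have "V (Suc n) \<otimes> (adj A u \<otimes> z) = cnj s ^ Suc n \<odot> (adj A u \<otimes> (V (Suc n) \<otimes> z))"
        using arg_cong[OF V_adj_u[of "Suc n"], of "\<lambda>y. y \<otimes> z"] by (simp add: mult_assoc smult_mult_left)
      then show "cnorm A (V (Suc n) \<otimes> (adj A u \<otimes> z)) \<le> cnorm A (V n \<otimes> z) * (cnorm A w * cnorm A (adj A u))"
        using ns'[of "adj A u" n] s1(2)[of "Suc n"] by (simp add: cnorm_smult del: power_Suc)
    qed simp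
    moreover have "adj A v \<otimes> z \<in> I"
    proof (rule dom[OF _ z])
      fix n
      have "V (Suc n) \<otimes> (adj A v \<otimes> z) = s ^ Suc n \<odot> (adj A v \<otimes> (V (Suc n) \<otimes> z))"
        using arg_cong[OF V_adj_v[of "Suc n"], of "\<lambda>y. y \<otimes> z"] by (simp add: mult_assoc smult_mult_left)
      then show "cnorm A (V (Suc n) \<otimes> (adj A v \<otimes> z)) \<le> cnorm A (V n \<otimes> z) * (cnorm A w * cnorm A (adj A v))"
        using ns'[of "adj A v" n] s1(1)[of "Suc n"] by (simp add: cnorm_smult del: power_Suc)
    qed simp
    ultimately show "adj A t \<otimes> z \<in> I" using t by auto
  qed
  have Rt: "y \<otimes> x \<in> I" if x: "x \<in> carrier A" and y: "y \<in> I" for x y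
  proof (rule dom[OF _ y])
    have [simp]: "y \<in> carrier A" using y by (simp add: I_def)
    have "cnorm A (V (Suc n) \<otimes> y) \<le> cnorm A w * cnorm A (V n \<otimes> y)" for n
      using cnorm_mult[of "adj A w" "V n \<otimes> y"] by (simp add: V_Suc(2) mult_assoc)
    then have "cnorm A (V (Suc n) \<otimes> y) * cnorm A x \<le> cnorm A w * cnorm A (V n \<otimes> y) * cnorm A x" for n
      using x by (intro mult_right_mono) simp_all
    then show "cnorm A (V (Suc n) \<otimes> (y \<otimes> x)) \<le> cnorm A (V n \<otimes> y) * (cnorm A w * cnorm A x)" for n
      using cnorm_mult[of "V (Suc n) \<otimes> y" x] x order_trans by (fastforce simp: mult_assoc mult_ac)
  qed (use x y in \<open>simp add: I_def\<close>)
  have I': "closed_two_sided_ideal I"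
    unfolding closed_two_sided_ideal_def using I L Rt by blast
  have start: "y \<in> I" if "y \<in> carrier A" "adj A w \<otimes> y = \<zero>" for y
  proof -
    have "(\<lambda>n. cnorm A (V (Suc n) \<otimes> y)) \<longlonglongrightarrow> 0"
      using that by (simp add: V_Suc(1) mult_assoc)
    from LIMSEQ_imp_Suc[OF this] show ?thesis using that by (simp add: I_def)
  qed
  have "J \<subseteq> I"
  proof (rule J_least[OF I'])
    show "e \<in> I" by (rule start) (simp_all add: adj_w(1) mult_assoc)
    show "f \<in> I" by (rule start) (simp_all add: adj_w(2) mult_assoc smult_mult_left)
  qed
  then show "a \<in> J \<Longrightarrow> (\<lambda>n. cnorm A (V n \<otimes> a)) \<longlonglongrightarrow> 0"
    by (auto simp: I_def)
qed

definition Q where "Q n = \<one> \<ominus> w [^] (n::nat) \<otimes> V n"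

lemma Q_closed [simp]: "Q n \<in> carrier A"
  by (simp add: Q_def)

lemma adj_Q [simp]: "adj A (Q n) = Q n"
  by (simp add: Q_def adj_minus adj_mult V_def adj_adj)

lemma Q_Q [simp]: "Q n \<otimes> Q n = Q n"
proof -
  have "V n \<otimes> (w [^] n \<otimes> V n) = V n" by (simp flip: mult_assoc)
  then have "Q n \<otimes> (w [^] n \<otimes> V n) = \<zero>"
    by (simp add: Q_def mult_minus_left mult_assoc)
  then show ?thesis by (subst (2) Q_def) (simp add: mult_minus_right)
qed

lemma Q_0 [simp]: "Q 0 = \<zero>"
  by (simp add: Q_def)

lemma Q_Suc: "Q (Suc n) = Q n \<oplus> w [^] n \<otimes> q \<otimes> V n"
proof -
  have "w [^] n \<otimes> q \<otimes> V n = w [^] n \<otimes> V n \<ominus> w [^] Suc n \<otimes> V (Suc n)"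
    by (simp add: q_def mult_minus_left mult_minus_right V_Suc(2) mult_assoc)
  then show ?thesis
    using minus_telescope[of \<one> "w [^] n \<otimes> V n" "w [^] Suc n \<otimes> V (Suc n)"] by (simp add: Q_def)
qed

lemma Q_in_J: "Q n \<in> J"
proof (induction n)
  case (Suc n)
  show ?case
    unfolding Q_Suc by (rule JD(4)[OF Suc J_mult(2)[OF _ J_mult(1)[OF _ q_in_J]]]) simp_all
qed (simp add: JD(3))

text \<open>The projection \<open>Q n\<close> is the sum of the \<open>w\<^sup>i q w\<^sup>*\<^sup>i\<close> with \<open>i < n\<close>.\<close>

lemma Q_mult_eq_zeroI:
  assumes "y \<in> carrier A" "\<And>i. q \<otimes> (V i \<otimes> y) = \<zero>" shows "Q n \<otimes> y = \<zero>"
  by (induction n) (use assms in \<open>simp_all add: Q_Suc mult_add_left mult_assoc\<close>)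

lemma minus_minus_cancel: "x \<in> carrier A \<Longrightarrow> z \<in> carrier A \<Longrightarrow> x \<ominus> (x \<ominus> z) = z"
  by (simp add: a_minus_def M.minus_add M.a_assoc[symmetric] M.r_neg)

text \<open>The error is at most \<open>|w\<^sup>*\<^sup>n a| + |w\<^sup>*\<^sup>n a\<^sup>*|\<close>, and \<open>J\<close> is closed under adjoints.\<close>

lemma Q_approximate_unit:
  assumes a: "a \<in> J" shows "cstar_lim A (\<lambda>n. Q n \<otimes> a \<otimes> Q n) a"
proof (rule cstar_limI)
  note [simp] = JD(2)[OF a]
  show "(\<lambda>n. cnorm A (V n \<otimes> adj A a) + cnorm A (V n \<otimes> a)) \<longlonglongrightarrow> 0"
    using tendsto_add[OF V_lim_0[OF J_adj[OF a]] V_lim_0[OF a]] by simp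
  fix n
  have "cnorm A (Q n \<otimes> a \<otimes> Q n \<ominus> a) = cnorm A (a \<ominus> Q n \<otimes> a \<otimes> Q n)"
    by (rule cnorm_minus_commute) simp_all
  also have "a \<ominus> Q n \<otimes> a \<otimes> Q n = (a \<ominus> Q n \<otimes> a) \<oplus> (Q n \<otimes> a \<ominus> Q n \<otimes> a \<otimes> Q n)"
    by (simp add: minus_telescope)
  also have "cnorm A \<dots> \<le> cnorm A (a \<ominus> Q n \<otimes> a) + cnorm A (Q n \<otimes> a \<ominus> Q n \<otimes> a \<otimes> Q n)"
    by (rule cnorm_triangle) simp_all
  also have "\<dots> \<le> cnorm A (V n \<otimes> a) + cnorm A (V n \<otimes> adj A a)"
  proof (rule add_mono)
    have one_minus_Q: "y \<ominus> Q n \<otimes> y = w [^] n \<otimes> (V n \<otimes> y)" if "y \<in> carrier A" for y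
      using that by (simp add: Q_def mult_minus_left mult_assoc minus_minus_cancel)
    have w_le: "cnorm A (w [^] n \<otimes> y) \<le> cnorm A y" if "y \<in> carrier A" for y
      using cnorm_mult[of "w [^] n" y] mult_right_mono[OF cnorm_V_le(2), of "cnorm A y" n] that by simp
    show "cnorm A (a \<ominus> Q n \<otimes> a) \<le> cnorm A (V n \<otimes> a)"
      by (simp add: one_minus_Q w_le)
    have "Q n \<otimes> a \<ominus> Q n \<otimes> a \<otimes> Q n = Q n \<otimes> adj A (adj A a \<ominus> Q n \<otimes> adj A a)"
      by (simp add: adj_minus adj_mult adj_adj mult_minus_right mult_assoc)
    then have "cnorm A (Q n \<otimes> a \<ominus> Q n \<otimes> a \<otimes> Q n) \<le> cnorm A (Q n) * cnorm A (adj A a \<ominus> Q n \<otimes> adj A a)"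
      using cnorm_mult[of "Q n" "adj A (adj A a \<ominus> Q n \<otimes> adj A a)"] by simp
    also have "\<dots> \<le> 1 * cnorm A (adj A a \<ominus> Q n \<otimes> adj A a)"
      by (intro mult_right_mono cnorm_projection_le_1) simp_all
    also have "\<dots> \<le> cnorm A (V n \<otimes> adj A a)"
      by (simp add: one_minus_Q w_le)
    finally show "cnorm A (Q n \<otimes> a \<ominus> Q n \<otimes> a \<otimes> Q n) \<le> cnorm A (V n \<otimes> adj A a)" .
  qed
  finally show "cnorm A (Q n \<otimes> a \<otimes> Q n \<ominus> a) \<le> cnorm A (V n \<otimes> adj A a) + cnorm A (V n \<otimes> a)" by simp
qed (use JD(2)[OF a] in simp_all)

end

section \<open>The representation of the free twist by multipliers\<close>

text \<open>The case \<open>x 0 = 0\<close> is excluded here: it would make the maps \<open>b \<mapsto> b \<otimes> x 0\<close> zero.\<close>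

locale free_twist_tensor = tensor_compacts B T K x tens + A: twisted_pair A \<theta> u v
  for B :: "('b, 'l) cstar_scheme" and T :: "('t, 'n) cstar_scheme" and K :: "('k, 'm) cstar_scheme"
    and x tens and A :: "('a, 'o) cstar_scheme" and \<theta> u v +
  fixes U P :: 'b
  assumes free_twist: "is_free_twist \<theta> A u v"
    and free_UP: "is_free_unitary_projection B U P"
    and x0: "x 0 \<noteq> \<zero>\<^bsub>K\<^esub>"
begin

definition R where "R = \<one>\<^bsub>B\<^esub> \<ominus>\<^bsub>B\<^esub> P"

lemma UP_closed [simp]: "U \<in> carrier B" "P \<in> carrier B" "R \<in> carrier B"
  and UP [simp]: "adj B U \<otimes>\<^bsub>B\<^esub> U = \<one>\<^bsub>B\<^esub>" "U \<otimes>\<^bsub>B\<^esub> adj B U = \<one>\<^bsub>B\<^esub>" "adj B P = P" "P \<otimes>\<^bsub>B\<^esub> P = P" "adj B R = R"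
  and UP_generate: "cstar_generated_by B {U, P}"
  using free_UP unfolding is_free_unitary_projection_def unitary_elem_def projection_elem_def
  by (simp_all add: R_def B.adj_minus)

lemma PR [simp]: "P \<otimes>\<^bsub>B\<^esub> R = \<zero>\<^bsub>B\<^esub>" "R \<otimes>\<^bsub>B\<^esub> P = \<zero>\<^bsub>B\<^esub>" "R \<otimes>\<^bsub>B\<^esub> R = R"
  by (simp_all add: R_def B.mult_minus_right B.mult_minus_left)

lemma P_add_R: "R \<oplus>\<^bsub>B\<^esub> P = \<one>\<^bsub>B\<^esub>"
  by (simp add: R_def B.add_minus_cancel)

lemma UP_assoc [simp]:
  assumes "b \<in> carrier B"
  shows "adj B U \<otimes>\<^bsub>B\<^esub> (U \<otimes>\<^bsub>B\<^esub> b) = b" "U \<otimes>\<^bsub>B\<^esub> (adj B U \<otimes>\<^bsub>B\<^esub> b) = b" "P \<otimes>\<^bsub>B\<^esub> (P \<otimes>\<^bsub>B\<^esub> b) = P \<otimes>\<^bsub>B\<^esub> b"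
    "P \<otimes>\<^bsub>B\<^esub> (R \<otimes>\<^bsub>B\<^esub> b) = \<zero>\<^bsub>B\<^esub>" "R \<otimes>\<^bsub>B\<^esub> (P \<otimes>\<^bsub>B\<^esub> b) = \<zero>\<^bsub>B\<^esub>" "R \<otimes>\<^bsub>B\<^esub> (R \<otimes>\<^bsub>B\<^esub> b) = R \<otimes>\<^bsub>B\<^esub> b"
  using assms by (simp_all flip: B.mult_assoc)

lemma vec_R_P: "b \<in> carrier B \<Longrightarrow> vec (R \<otimes>\<^bsub>B\<^esub> b) i \<oplus>\<^bsub>T\<^esub> vec (P \<otimes>\<^bsub>B\<^esub> b) i = vec b i"
  by (simp flip: vec_add B.mult_add_left add: P_add_R)

lemma vec_URU: "b \<in> carrier B \<Longrightarrow> vec (U \<otimes>\<^bsub>B\<^esub> (R \<otimes>\<^bsub>B\<^esub> (adj B U \<otimes>\<^bsub>B\<^esub> b))) i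
      \<oplus>\<^bsub>T\<^esub> vec (U \<otimes>\<^bsub>B\<^esub> (P \<otimes>\<^bsub>B\<^esub> (adj B U \<otimes>\<^bsub>B\<^esub> b))) i = vec b i"
  by (simp flip: vec_add B.mult_add_right B.mult_add_left add: P_add_R)

lemma vec_UPU: "b \<in> carrier B \<Longrightarrow> vec (U \<otimes>\<^bsub>B\<^esub> (P \<otimes>\<^bsub>B\<^esub> (adj B U \<otimes>\<^bsub>B\<^esub> b))) i
      \<oplus>\<^bsub>T\<^esub> vec (U \<otimes>\<^bsub>B\<^esub> (R \<otimes>\<^bsub>B\<^esub> (adj B U \<otimes>\<^bsub>B\<^esub> b))) i = vec b i"
  using vec_URU[of b i] by (simp add: T.M.a_comm)

lemma s_pow [simp]: "A.s ^ i * cnj A.s ^ i = 1" "cnj A.s ^ i * A.s ^ i = 1"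
  by (simp_all flip: power_mult_distrib)

text \<open>The arrangements of the weights in which rewriting leaves the products of \<open>u\<close> and \<open>v\<close> and their adjoints.\<close>

lemma s_pow_Suc [simp]: "cnj A.s ^ i * cnj A.s * (A.s ^ i * A.s) = 1" "cnj A.s ^ i * cnj A.s * (A.s * A.s ^ i) = 1"
  "A.s * (A.s ^ i * (cnj A.s ^ i * cnj A.s)) = 1" "A.s * (A.s ^ i * (cnj A.s * cnj A.s ^ i)) = 1"
  using s_pow(2)[of "Suc i"] by (simp_all add: mult_ac)

text \<open>The coefficients are read off from the relations in \<open>A\<close>: there, \<open>u q = U' (q - P') + w U' P'\<close> and
  \<open>v q = P' U'\<^sup>* + \<lambda>\<^sup>* w (q - P') U'\<^sup>*\<close>, where \<open>\<lambda>\<^sup>*\<close> is the conjugate of the twisting scalar, while \<open>u w = \<lambda> w u\<close> and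
  \<open>v w = \<lambda>\<^sup>* w v\<close> give the weights.  With \<open>U\<close>, \<open>P\<close> in place of \<open>U'\<close>, \<open>P'\<close> and the shift
  \<open>vec b j \<mapsto> vec b (j + 1)\<close> in place of \<open>w\<close>, these become the formulas below.\<close>

lemma ex_twisted_isometries:
  obtains u0 v0 where "twisted_isometries \<theta> M u0 v0"
    "\<And>b j. b \<in> carrier B \<Longrightarrow> fst u0 (vec b j) =
      A.s ^ j \<odot>\<^bsub>T\<^esub> (vec (U \<otimes>\<^bsub>B\<^esub> (R \<otimes>\<^bsub>B\<^esub> b)) j \<oplus>\<^bsub>T\<^esub> vec (U \<otimes>\<^bsub>B\<^esub> (P \<otimes>\<^bsub>B\<^esub> b)) (Suc j))"
    "\<And>b j. b \<in> carrier B \<Longrightarrow> fst v0 (vec b j) = cnj A.s ^ j \<odot>\<^bsub>T\<^esub> (vec (P \<otimes>\<^bsub>B\<^esub> (adj B U \<otimes>\<^bsub>B\<^esub> b)) j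
      \<oplus>\<^bsub>T\<^esub> cnj A.s \<odot>\<^bsub>T\<^esub> vec (R \<otimes>\<^bsub>B\<^esub> (adj B U \<otimes>\<^bsub>B\<^esub> b)) (Suc j))"
    "\<And>b. b \<in> carrier B \<Longrightarrow> fst (adj M u0) (vec b 0) = vec (R \<otimes>\<^bsub>B\<^esub> (adj B U \<otimes>\<^bsub>B\<^esub> b)) 0"
    "\<And>b. b \<in> carrier B \<Longrightarrow> fst (adj M v0) (vec b 0) = vec (U \<otimes>\<^bsub>B\<^esub> (P \<otimes>\<^bsub>B\<^esub> b)) 0"
    "\<And>b j. b \<in> carrier B \<Longrightarrow> fst (u0 \<otimes>\<^bsub>M\<^esub> v0) (vec b j) = vec b (Suc j)"
proof -
  have s: "cmod A.s = 1" "cmod (cnj A.s) = 1" by (simp_all add: A.s_def)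
  obtain u0 where u0: "u0 \<in> carrier M"
    "\<And>b j. b \<in> carrier B \<Longrightarrow> fst u0 (vec b j) =
      A.s ^ j \<odot>\<^bsub>T\<^esub> (vec (U \<otimes>\<^bsub>B\<^esub> (R \<otimes>\<^bsub>B\<^esub> b)) j \<oplus>\<^bsub>T\<^esub> vec (U \<otimes>\<^bsub>B\<^esub> (P \<otimes>\<^bsub>B\<^esub> b)) (Suc j))"
    "\<And>b. b \<in> carrier B \<Longrightarrow> fst (adj M u0) (vec b 0) = vec (R \<otimes>\<^bsub>B\<^esub> (adj B U \<otimes>\<^bsub>B\<^esub> b)) 0"
    "\<And>b j. b \<in> carrier B \<Longrightarrow> fst (adj M u0) (vec b (Suc j)) =
      cnj A.s ^ Suc j \<odot>\<^bsub>T\<^esub> vec (R \<otimes>\<^bsub>B\<^esub> (adj B U \<otimes>\<^bsub>B\<^esub> b)) (Suc j)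
      \<oplus>\<^bsub>T\<^esub> cnj A.s ^ j \<odot>\<^bsub>T\<^esub> vec (P \<otimes>\<^bsub>B\<^esub> (adj B U \<otimes>\<^bsub>B\<^esub> b)) j"
    by (rule ex_creation_operator[OF s(1), of "U \<otimes>\<^bsub>B\<^esub> R" "U \<otimes>\<^bsub>B\<^esub> P"])
      (auto simp: B.mult_assoc B.adj_mult T.MA_simps)
  obtain v0 where v0: "v0 \<in> carrier M"
    "\<And>b j. b \<in> carrier B \<Longrightarrow> fst v0 (vec b j) = cnj A.s ^ j \<odot>\<^bsub>T\<^esub> (vec (P \<otimes>\<^bsub>B\<^esub> (adj B U \<otimes>\<^bsub>B\<^esub> b)) j
      \<oplus>\<^bsub>T\<^esub> cnj A.s \<odot>\<^bsub>T\<^esub> vec (R \<otimes>\<^bsub>B\<^esub> (adj B U \<otimes>\<^bsub>B\<^esub> b)) (Suc j))"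
    "\<And>b. b \<in> carrier B \<Longrightarrow> fst (adj M v0) (vec b 0) = vec (U \<otimes>\<^bsub>B\<^esub> (P \<otimes>\<^bsub>B\<^esub> b)) 0"
    "\<And>b j. b \<in> carrier B \<Longrightarrow> fst (adj M v0) (vec b (Suc j)) =
      A.s ^ Suc j \<odot>\<^bsub>T\<^esub> vec (U \<otimes>\<^bsub>B\<^esub> (P \<otimes>\<^bsub>B\<^esub> b)) (Suc j)
      \<oplus>\<^bsub>T\<^esub> A.s ^ j \<odot>\<^bsub>T\<^esub> (A.s \<odot>\<^bsub>T\<^esub> vec (U \<otimes>\<^bsub>B\<^esub> (R \<otimes>\<^bsub>B\<^esub> b)) j)"
    by (rule ex_creation_operator[OF s(2), of "P \<otimes>\<^bsub>B\<^esub> adj B U" "cnj A.s \<odot>\<^bsub>B\<^esub> (R \<otimes>\<^bsub>B\<^esub> adj B U)"])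
      (auto simp: B.mult_assoc B.adj_mult B.adj_adj B.adj_smult B.smult_mult_left vec_smult T.MA_simps)
  note [simp] = u0(1) v0(1) T.MA_closed T.MA_D(1) T.MA_simps(1,3,9) u0(2) v0(2)
  note lin = T.MA_fst_add T.MA_fst_smult T.smult_add
  have "adj M u0 \<otimes>\<^bsub>M\<^esub> u0 = \<one>\<^bsub>M\<^esub>"
  proof (rule multiplier_eqI)
    fix b i assume b: "b \<in> carrier B"
    show "fst (adj M u0 \<otimes>\<^bsub>M\<^esub> u0) (vec b i) = fst \<one>\<^bsub>M\<^esub> (vec b i)"
      by (cases i) (use b in \<open>simp_all add: lin u0(3,4) vec_R_P del: power_Suc T.MA_simps(11)\<close>)
  qed simp_all
  moreover have "adj M v0 \<otimes>\<^bsub>M\<^esub> v0 = \<one>\<^bsub>M\<^esub>"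
  proof (rule multiplier_eqI)
    fix b i assume b: "b \<in> carrier B"
    show "fst (adj M v0 \<otimes>\<^bsub>M\<^esub> v0) (vec b i) = fst \<one>\<^bsub>M\<^esub> (vec b i)"
      by (cases i) (use b in \<open>simp_all add: lin v0(3,4) vec_UPU del: power_Suc T.MA_simps(11)\<close>)
  qed simp_all
  moreover have uv: "fst (u0 \<otimes>\<^bsub>M\<^esub> v0) (vec b j) = vec b (Suc j)" if b: "b \<in> carrier B" for b j
    using b by (simp add: lin vec_UPU)
  moreover have "u0 \<otimes>\<^bsub>M\<^esub> v0 = cis (2 * pi * \<theta>) \<odot>\<^bsub>M\<^esub> (v0 \<otimes>\<^bsub>M\<^esub> u0)"
  proof (rule multiplier_eqI)
    fix b i assume b: "b \<in> carrier B"
    show "fst (u0 \<otimes>\<^bsub>M\<^esub> v0) (vec b i) = fst (cis (2 * pi * \<theta>) \<odot>\<^bsub>M\<^esub> (v0 \<otimes>\<^bsub>M\<^esub> u0)) (vec b i)"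
      unfolding uv[OF b] A.s_def[symmetric] using b by (simp add: lin vec_R_P)
  qed simp_all
  ultimately show ?thesis
    by (intro that[of u0 v0]) (use u0 v0 in \<open>auto simp: twisted_isometries_def isometry_elem_def\<close>)
qed

text \<open>The image of \<open>q\<close> is the projection onto the first column.  Since \<open>U' q = U'\<close> and \<open>P' q = P'\<close>, the images of \<open>U'\<close>
  and \<open>P'\<close> are determined by what they do to the elements \<open>vec b 0\<close>.\<close>

lemma ex_representation:
  obtains h where "unital_star_hom A M h"
    "\<And>b j. b \<in> carrier B \<Longrightarrow> fst (h A.w) (vec b j) = vec b (Suc j)"
    "h A.q = T.left_mult (tens \<one>\<^bsub>B\<^esub> (x 0))"
    "h A.U' = T.left_mult (tens U (x 0))"
    "h A.P' = T.left_mult (tens P (x 0))"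
proof -
  obtain u0 v0 where tw: "twisted_isometries \<theta> M u0 v0"
    and u0: "\<And>b j. b \<in> carrier B \<Longrightarrow> fst u0 (vec b j) =
      A.s ^ j \<odot>\<^bsub>T\<^esub> (vec (U \<otimes>\<^bsub>B\<^esub> (R \<otimes>\<^bsub>B\<^esub> b)) j \<oplus>\<^bsub>T\<^esub> vec (U \<otimes>\<^bsub>B\<^esub> (P \<otimes>\<^bsub>B\<^esub> b)) (Suc j))"
    and v0: "\<And>b j. b \<in> carrier B \<Longrightarrow> fst v0 (vec b j) = cnj A.s ^ j \<odot>\<^bsub>T\<^esub> (vec (P \<otimes>\<^bsub>B\<^esub> (adj B U \<otimes>\<^bsub>B\<^esub> b)) j
      \<oplus>\<^bsub>T\<^esub> cnj A.s \<odot>\<^bsub>T\<^esub> vec (R \<otimes>\<^bsub>B\<^esub> (adj B U \<otimes>\<^bsub>B\<^esub> b)) (Suc j))"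
    and adj_u0: "\<And>b. b \<in> carrier B \<Longrightarrow> fst (adj M u0) (vec b 0) = vec (R \<otimes>\<^bsub>B\<^esub> (adj B U \<otimes>\<^bsub>B\<^esub> b)) 0"
    and adj_v0: "\<And>b. b \<in> carrier B \<Longrightarrow> fst (adj M v0) (vec b 0) = vec (U \<otimes>\<^bsub>B\<^esub> (P \<otimes>\<^bsub>B\<^esub> b)) 0"
    and w0: "\<And>b j. b \<in> carrier B \<Longrightarrow> fst (u0 \<otimes>\<^bsub>M\<^esub> v0) (vec b j) = vec b (Suc j)"
    using ex_twisted_isometries by blast
  obtain h where h: "unital_star_hom A M h" "h u = u0" "h v = v0"
    using free_twist_hom[OF free_twist T.multiplier_algebra_unital_cstar tw] by blast
  then have hom: "star_hom A M h" "h \<one>\<^bsub>A\<^esub> = \<one>\<^bsub>M\<^esub>" by (simp_all add: unital_star_hom_def)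
  interpret h: cstar_hom A M h
    by (intro cstar_hom.intro cstar_hom_axioms.intro A.cstar_algebra_axioms M.cstar_algebra_axioms hom)
  have [simp]: "u0 \<in> carrier M" "v0 \<in> carrier M"
    using tw by (simp_all add: twisted_isometries_def isometry_elem_def)
  define w0 where "w0 = u0 \<otimes>\<^bsub>M\<^esub> v0"
  have hw: "h A.w = w0" by (simp add: A.w_def w0_def h.h_mult h)
  have [simp]: "w0 \<in> carrier M" by (simp add: w0_def)
  note [simp] = T.MA_closed T.MA_D(1) T.MA_simps(1,3,9)
  note lin = T.MA_fst_add T.MA_fst_smult T.smult_add
  have w0_vec: "fst w0 (vec b j) = vec b (Suc j)" if "b \<in> carrier B" for b j
    using w0[OF that] by (simp add: w0_def)
  have adj_w0_0: "fst (adj M w0) (vec b 0) = \<zero>\<^bsub>T\<^esub>" if "b \<in> carrier B" for b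
    using that by (simp add: w0_def M.adj_mult adj_u0 adj_v0)
  have w0w0: "adj M w0 \<otimes>\<^bsub>M\<^esub> w0 = \<one>\<^bsub>M\<^esub>"
    using h.h_mult[of "adj A A.w" A.w] by (simp add: h.h_adj hw hom)
  have adj_w0_Suc: "fst (adj M w0) (vec b (Suc j)) = vec b j" if "b \<in> carrier B" for b j
    using arg_cong[OF w0w0, of "\<lambda>m. fst m (vec b j)"] that by (simp add: w0_vec)
  define q0 where "q0 = h A.q"
  have [simp]: "q0 \<in> carrier M" by (simp add: q0_def)
  have q0: "fst q0 (vec b j) = (if j = 0 then vec b 0 else \<zero>\<^bsub>T\<^esub>)" if b: "b \<in> carrier B" for b j
  proof -
    have "q0 = \<one>\<^bsub>M\<^esub> \<oplus>\<^bsub>M\<^esub> (-1) \<odot>\<^bsub>M\<^esub> (w0 \<otimes>\<^bsub>M\<^esub> adj M w0)"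
      by (simp add: q0_def A.q_def h.h_minus h.h_mult h.h_adj hom hw M.minus_eq_smult)
    then have "fst q0 (vec b j) = vec b j \<oplus>\<^bsub>T\<^esub> (-1) \<odot>\<^bsub>T\<^esub> fst w0 (fst (adj M w0) (vec b j))"
      using b by (simp add: T.MA_simps(7))
    also have "\<dots> = (if j = 0 then vec b 0 else \<zero>\<^bsub>T\<^esub>)"
    proof (cases j)
      case 0
      have "fst w0 \<zero>\<^bsub>T\<^esub> = \<zero>\<^bsub>T\<^esub>" using T.MA_fst_smult[of w0 "\<zero>\<^bsub>T\<^esub>" 0] by simp
      then show ?thesis using b 0 by (simp add: adj_w0_0)
    next
      case (Suc k)
      then show ?thesis using b by (simp add: adj_w0_Suc w0_vec flip: T.minus_eq_smult)
    qed
    finally show ?thesis .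
  qed
  have zero: "fst m \<zero>\<^bsub>T\<^esub> = \<zero>\<^bsub>T\<^esub>" if "m \<in> carrier M" for m
    using T.MA_fst_smult[OF that, of "\<zero>\<^bsub>T\<^esub>" 0] that by simp
  have eqI: "m = T.left_mult (tens c (x 0))"
    if m: "m \<in> carrier M" "m \<otimes>\<^bsub>M\<^esub> q0 = m" and c: "c \<in> carrier B"
      and m0: "\<And>b. b \<in> carrier B \<Longrightarrow> fst m (vec b 0) = vec (c \<otimes>\<^bsub>B\<^esub> b) 0" for m c
  proof (rule multiplier_eqI)
    fix b i assume b: "b \<in> carrier B"
    have "fst m (vec b i) = fst (m \<otimes>\<^bsub>M\<^esub> q0) (vec b i)"
      unfolding m(2) ..
    also have "\<dots> = fst m (fst q0 (vec b i))"
      using b by simp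
    also have "\<dots> = (if i = 0 then vec (c \<otimes>\<^bsub>B\<^esub> b) 0 else \<zero>\<^bsub>T\<^esub>)"
      using b m by (simp add: q0 m0 zero)
    also have "\<dots> = tens c (x 0) \<otimes>\<^bsub>T\<^esub> vec b i"
      using b c K.adj_x_x[of 0 i] by (simp add: vec_def tens_mult)
    finally show "fst m (vec b i) = fst (T.left_mult (tens c (x 0))) (vec b i)"
      using b by simp
  qed (use m c in simp_all)
  have q0q0: "q0 \<otimes>\<^bsub>M\<^esub> q0 = q0"
    using h.h_mult[of A.q A.q] by (simp add: q0_def)
  show ?thesis
  proof (rule that[OF h(1)])
    show "fst (h A.w) (vec b j) = vec b (Suc j)" if "b \<in> carrier B" for b j
      using w0_vec[OF that] by (simp add: hw)
    show "h A.q = T.left_mult (tens \<one>\<^bsub>B\<^esub> (x 0))"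
      unfolding q0_def[symmetric] by (rule eqI) (simp_all add: q0q0 q0)
    show "h A.U' = T.left_mult (tens U (x 0))"
    proof (rule eqI)
      show "h A.U' \<otimes>\<^bsub>M\<^esub> q0 = h A.U'"
        using h.h_mult[of A.U' A.q] by (simp add: q0_def)
      fix b assume b: "b \<in> carrier B"
      have "A.U' = A.q \<otimes>\<^bsub>A\<^esub> u \<oplus>\<^bsub>A\<^esub> adj A v \<otimes>\<^bsub>A\<^esub> A.q"
        using arg_cong[OF A.q_v, of "adj A"] by (simp add: A.U'_eq A.q_u A.adj_mult)
      then have "h A.U' = q0 \<otimes>\<^bsub>M\<^esub> u0 \<oplus>\<^bsub>M\<^esub> adj M v0 \<otimes>\<^bsub>M\<^esub> q0"
        by (simp add: h.h_add h.h_mult h.h_adj h q0_def)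
      then have "fst (h A.U') (vec b 0) = fst q0 (fst u0 (vec b 0)) \<oplus>\<^bsub>T\<^esub> fst (adj M v0) (vec b 0)"
        using b by (simp add: T.MA_simps(7) q0)
      also have "\<dots> = vec (U \<otimes>\<^bsub>B\<^esub> b) 0"
        using b by (simp add: u0 adj_v0 q0 lin flip: vec_add B.mult_add_right)
          (simp flip: B.mult_add_left add: P_add_R)
      finally show "fst (h A.U') (vec b 0) = vec (U \<otimes>\<^bsub>B\<^esub> b) 0" .
    qed simp_all
    show "h A.P' = T.left_mult (tens P (x 0))"
    proof (rule eqI)
      show "h A.P' \<otimes>\<^bsub>M\<^esub> q0 = h A.P'"
        using h.h_mult[of A.P' A.q] by (simp add: q0_def)
      fix b assume b: "b \<in> carrier B"
      have "A.P' = A.P' \<otimes>\<^bsub>A\<^esub> A.q" by simp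
      also have "\<dots> = A.q \<otimes>\<^bsub>A\<^esub> v \<otimes>\<^bsub>A\<^esub> adj A v \<otimes>\<^bsub>A\<^esub> A.q"
        unfolding A.P'_eq A.q_v ..
      finally have "h A.P' = q0 \<otimes>\<^bsub>M\<^esub> v0 \<otimes>\<^bsub>M\<^esub> adj M v0 \<otimes>\<^bsub>M\<^esub> q0"
        by (simp add: h.h_mult h.h_adj h q0_def)
      then have "fst (h A.P') (vec b 0) = fst q0 (fst v0 (fst (adj M v0) (vec b 0)))"
        using b by (simp add: q0)
      also have "\<dots> = vec (P \<otimes>\<^bsub>B\<^esub> b) 0"
        using b by (simp add: v0 adj_v0 q0 lin)
      finally show "fst (h A.P') (vec b 0) = vec (P \<otimes>\<^bsub>B\<^esub> b) 0" .
    qed simp_all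
  qed
qed

end

section \<open>The isomorphism\<close>

text \<open>The homomorphisms \<open>h\<close> from \<open>A\<close> to the multipliers of \<open>T\<close> and \<open>psi\<close> from \<open>B\<close> to the corner of \<open>A\<close> at \<open>q\<close>, obtained
  from the universal properties of \<open>A\<close> and \<open>B\<close>.\<close>

locale represented_free_twist = free_twist_tensor B T K x tens A \<theta> u v U P
  for B :: "('b, 'l) cstar_scheme" and T :: "('t, 'n) cstar_scheme" and K :: "('k, 'm) cstar_scheme"
    and x tens and A :: "('a, 'o) cstar_scheme" and \<theta> u v U P +
  fixes h and psi
  assumes h_unital: "unital_star_hom A M h"
    and h_w: "\<And>b j. b \<in> carrier B \<Longrightarrow> fst (h A.w) (vec b j) = vec b (Suc j)"
    and h_q: "h A.q = T.left_mult (tens \<one>\<^bsub>B\<^esub> (x 0))"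
    and h_U': "h A.U' = T.left_mult (tens U (x 0))"
    and h_P': "h A.P' = T.left_mult (tens P (x 0))"
    and psi_hom: "star_hom B A psi"
    and psi_gen: "psi \<one>\<^bsub>B\<^esub> = A.q" "psi U = A.U'" "psi P = A.P'"
begin

sublocale h: cstar_hom A M h
  using h_unital by unfold_locales (simp add: unital_star_hom_def)

sublocale psi: cstar_hom B A psi
  by unfold_locales (rule psi_hom)

sublocale l: cstar_hom T M T.left_mult
  by unfold_locales (rule T.star_hom_left_mult)

lemma h_one [simp]: "h \<one>\<^bsub>A\<^esub> = \<one>\<^bsub>M\<^esub>"
  using h_unital by (simp add: unital_star_hom_def)

lemma norm_left_mult: "t \<in> carrier T \<Longrightarrow> cnorm M (T.left_mult t) = cnorm T t"
  using l.h_norm_le T.cnorm_le_left_mult by (simp add: antisym)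

lemma norm_x0: "cnorm K (x 0) = 1"
proof -
  have "cnorm K (x 0) * cnorm K (x 0) = cnorm K (x 0)"
    using K.cstar_identity[of "x 0"] by (simp add: power2_eq_square)
  moreover have "cnorm K (x 0) \<noteq> 0" using x0 by (simp add: K.cnorm_eq_0_iff)
  ultimately show ?thesis by simp
qed

text \<open>Both sides are homomorphisms of \<open>B\<close>, so it suffices to compare them on the generators.\<close>

lemma h_psi:
  assumes b: "b \<in> carrier B" shows "h (psi b) = T.left_mult (vec b 0)"
proof (rule star_hom_eq_on_generators[OF _ _ _ _ UP_generate _ b])
  show "star_hom B M (\<lambda>b. h (psi b))"
    by (rule star_hom_comp[OF psi.hom h.hom])
  show "star_hom B M (\<lambda>b. T.left_mult (vec b 0))"
    by (rule star_hom_comp[OF _ l.hom], rule star_homI)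
      (simp_all add: vec_def tens_add_left tens_smult_left tens_mult tens_adj)
  show "h (psi b) = T.left_mult (vec b 0)" if "b \<in> {U, P}" for b
    using that by (auto simp: psi_gen h_U' h_P' vec_def)
qed (rule B.cstar_algebra_axioms M.cstar_algebra_axioms)+

lemma norm_psi: "b \<in> carrier B \<Longrightarrow> cnorm B b \<le> cnorm A (psi b)"
  using h.h_norm_le[of "psi b"] by (simp add: h_psi norm_left_mult vec_def tens_norm norm_x0)

definition image_psi where "image_psi = psi ` carrier B"

lemma image_psi: "cstar_subalgebra image_psi A" "A.q \<in> image_psi" "A.U' \<in> image_psi" "A.P' \<in> image_psi"
proof -
  have "closed_subspace A image_psi"
    unfolding image_psi_def by (rule psi.closed_subspace_image[OF B.closed_subspace_carrier norm_psi])
  then show "cstar_subalgebra image_psi A"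
    by (rule A.cstar_subalgebraI) (auto simp: image_psi_def simp flip: psi.h_mult psi.h_adj)
  show "A.q \<in> image_psi" "A.U' \<in> image_psi" "A.P' \<in> image_psi"
    by (auto simp: image_psi_def simp flip: psi_gen)
qed

text \<open>The preimage of \<open>T\<close> under \<open>h\<close> is a closed ideal containing \<open>q\<close>, and \<open>e = e q\<close>, \<open>f = f q\<close>.\<close>

lemma h_J: "a \<in> A.J \<Longrightarrow> h a \<in> T.left_mult ` carrier T"
proof -
  let ?I = "{a \<in> carrier A. h a \<in> T.left_mult ` carrier T}"
  have "A.closed_two_sided_ideal ?I"
    unfolding A.closed_two_sided_ideal_def
  proof (intro conjI ballI)
    show "closed_subspace A ?I"
      by (rule h.closed_subspace_vimage[OF T.closed_subspace_left_mult])
    fix a y assume a: "a \<in> carrier A" and y: "y \<in> ?I"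
    then obtain t where t: "t \<in> carrier T" "h y = T.left_mult t" by auto
    have "h (a \<otimes>\<^bsub>A\<^esub> y) = T.left_mult (fst (h a) t)"
      using a y t by (simp add: h.h_mult T.mult_left_mult)
    then show "a \<otimes>\<^bsub>A\<^esub> y \<in> ?I" using a y t by (auto simp: T.MA_D)
    have "h y \<otimes>\<^bsub>M\<^esub> h a = adj M (adj M (h a) \<otimes>\<^bsub>M\<^esub> T.left_mult (adj T t))"
      using a t by (simp add: M.adj_mult M.adj_adj l.h_adj)
    also have "adj M (h a) \<otimes>\<^bsub>M\<^esub> T.left_mult (adj T t) = T.left_mult (fst (adj M (h a)) (adj T t))"
      using a t by (intro T.mult_left_mult) simp_all
    also have "adj M \<dots> = T.left_mult (adj T (fst (adj M (h a)) (adj T t)))"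
      using a t by (simp add: T.MA_D(1) l.h_adj)
    finally have "h (y \<otimes>\<^bsub>A\<^esub> a) = T.left_mult (adj T (fst (adj M (h a)) (adj T t)))"
      using a y by (simp add: h.h_mult)
    then show "y \<otimes>\<^bsub>A\<^esub> a \<in> ?I" using a y t by (auto simp: T.MA_D(1))
  qed
  moreover have q: "A.q \<in> ?I" by (auto simp: h_q B.one_closed)
  ultimately have "A.e \<otimes>\<^bsub>A\<^esub> A.q \<in> ?I" "A.f \<otimes>\<^bsub>A\<^esub> A.q \<in> ?I"
    unfolding A.closed_two_sided_ideal_def by simp_all
  moreover have "A.e \<otimes>\<^bsub>A\<^esub> A.q = A.e"
    by (simp add: A.q_eq1 A.mult_add_right A.mult_assoc)
  moreover have "A.f \<otimes>\<^bsub>A\<^esub> A.q = A.f"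
    by (simp add: A.q_eq2 A.mult_add_right A.mult_assoc)
  ultimately have "A.J \<subseteq> ?I"
    using \<open>A.closed_two_sided_ideal ?I\<close> by (intro A.J_least) simp_all
  then show "a \<in> A.J \<Longrightarrow> h a \<in> T.left_mult ` carrier T" by auto
qed

definition phi where "phi a = the_inv_into (carrier T) T.left_mult (h a)"

lemma inj_left_mult: "inj_on T.left_mult (carrier T)"
  by (rule inj_onI) (rule T.left_mult_inj)

lemma phi:
  assumes "a \<in> A.J" shows "phi a \<in> carrier T" "T.left_mult (phi a) = h a"
  using h_J[OF assms] inj_left_mult by (auto simp: phi_def the_inv_into_f_f)

lemma phi_eqI: "t \<in> carrier T \<Longrightarrow> h a = T.left_mult t \<Longrightarrow> phi a = t"
  by (simp add: phi_def the_inv_into_f_f[OF inj_left_mult])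

lemma phi_add: "a \<in> A.J \<Longrightarrow> b \<in> A.J \<Longrightarrow> phi (a \<oplus>\<^bsub>A\<^esub> b) = phi a \<oplus>\<^bsub>T\<^esub> phi b"
  by (rule phi_eqI) (simp_all add: phi A.JD h.h_add l.h_add)

lemma phi_mult: "a \<in> A.J \<Longrightarrow> b \<in> A.J \<Longrightarrow> phi (a \<otimes>\<^bsub>A\<^esub> b) = phi a \<otimes>\<^bsub>T\<^esub> phi b"
  by (rule phi_eqI) (simp_all add: phi A.JD(2) h.h_mult l.h_mult)

lemma phi_smult: "a \<in> A.J \<Longrightarrow> phi (c \<odot>\<^bsub>A\<^esub> a) = c \<odot>\<^bsub>T\<^esub> phi a"
  by (rule phi_eqI) (simp_all add: phi A.JD(2) h.h_smult l.h_smult)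

lemma phi_adj: "a \<in> A.J \<Longrightarrow> phi (adj A a) = adj T (phi a)"
  by (rule phi_eqI) (simp_all add: phi A.JD(2) h.h_adj l.h_adj)

lemma h_w_pow: "b \<in> carrier B \<Longrightarrow> fst (h (A.w [^]\<^bsub>A\<^esub> i)) (vec b j) = vec b (j + i)"
proof (induction i arbitrary: j)
  case (Suc i)
  then show ?case by (simp add: h.h_mult T.MA_simps h_w)
qed (simp add: T.MA_simps)

text \<open>The image of \<open>w\<close> moves \<open>vec b k\<close> to \<open>vec b (k + 1)\<close>, which gives the row index; the column index follows
  by passing to adjoints.\<close>

lemma phi_unit:
  assumes b: "b \<in> carrier B"
  shows "A.w [^]\<^bsub>A\<^esub> i \<otimes>\<^bsub>A\<^esub> psi b \<otimes>\<^bsub>A\<^esub> A.V j \<in> A.J"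
    and "phi (A.w [^]\<^bsub>A\<^esub> i \<otimes>\<^bsub>A\<^esub> psi b \<otimes>\<^bsub>A\<^esub> A.V j) = tens b (K.unit i j)"
proof -
  have shift: "fst (h (A.w [^]\<^bsub>A\<^esub> n)) (tens c (K.unit k m)) = tens c (K.unit (k + n) m)"
    if "c \<in> carrier B" for c k m n
    using that by (simp add: tens_unit T.MA_fst_mult h_w_pow B.one_closed)
  have "psi b = psi b \<otimes>\<^bsub>A\<^esub> A.q"
    using b psi.h_mult[of b "\<one>\<^bsub>B\<^esub>"] by (simp add: psi_gen B.one_closed)
  then have "psi b \<in> A.J"
    using A.J_mult(1)[OF psi.h_closed[OF b] A.q_in_J] by simp
  then show "A.w [^]\<^bsub>A\<^esub> i \<otimes>\<^bsub>A\<^esub> psi b \<otimes>\<^bsub>A\<^esub> A.V j \<in> A.J"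
    by (intro A.J_mult) simp_all
  have "h (A.w [^]\<^bsub>A\<^esub> i \<otimes>\<^bsub>A\<^esub> psi b) = T.left_mult (tens b (K.unit i 0))"
    using b shift[OF b, of i 0 0] by (simp add: h.h_mult h_psi T.mult_left_mult vec_def K.unit_i_0)
  then have "h (A.w [^]\<^bsub>A\<^esub> i \<otimes>\<^bsub>A\<^esub> psi b \<otimes>\<^bsub>A\<^esub> A.V j)
      = T.left_mult (tens b (K.unit i 0)) \<otimes>\<^bsub>M\<^esub> adj M (h (A.w [^]\<^bsub>A\<^esub> j))"
    using b h.h_mult[of "A.w [^]\<^bsub>A\<^esub> i \<otimes>\<^bsub>A\<^esub> psi b" "A.V j"] by (simp add: h.h_adj[symmetric] flip: A.V_def)
  also have "\<dots> = adj M (h (A.w [^]\<^bsub>A\<^esub> j) \<otimes>\<^bsub>M\<^esub> T.left_mult (tens (adj B b) (K.unit 0 i)))"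
    using b by (simp add: M.adj_mult flip: l.h_adj) (simp add: tens_adj B.adj_adj)
  also have "\<dots> = T.left_mult (tens b (K.unit i j))"
    using b by (simp add: T.mult_left_mult shift flip: l.h_adj) (simp add: tens_adj B.adj_adj)
  finally show "phi (A.w [^]\<^bsub>A\<^esub> i \<otimes>\<^bsub>A\<^esub> psi b \<otimes>\<^bsub>A\<^esub> A.V j) = tens b (K.unit i j)"
    using b by (intro phi_eqI) simp_all
qed

lemma phi_column: "b \<in> carrier B \<Longrightarrow> A.w [^]\<^bsub>A\<^esub> i \<otimes>\<^bsub>A\<^esub> psi b \<in> A.J \<and> phi (A.w [^]\<^bsub>A\<^esub> i \<otimes>\<^bsub>A\<^esub> psi b) = tens b (x i)"
  using phi_unit[of b i 0] by (simp add: K.unit_i_0)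

section \<open>Finite corners\<close>

definition E where "E n = phi (A.Q n)"

lemma E [simp]: "E n \<in> carrier T" "adj T (E n) = E n" "E n \<otimes>\<^bsub>T\<^esub> E n = E n" "E 0 = \<zero>\<^bsub>T\<^esub>"
proof -
  show "E n \<in> carrier T" by (simp add: E_def phi A.Q_in_J)
  show "adj T (E n) = E n" "E n \<otimes>\<^bsub>T\<^esub> E n = E n"
    using phi_adj[OF A.Q_in_J[of n]] phi_mult[OF A.Q_in_J[of n] A.Q_in_J[of n]] by (simp_all add: E_def)
  show "E 0 = \<zero>\<^bsub>T\<^esub>" by (simp add: E_def phi_eqI)
qed

lemma E_Suc: "E (Suc n) = E n \<oplus>\<^bsub>T\<^esub> tens \<one>\<^bsub>B\<^esub> (K.unit n n)"
  using phi_add[OF A.Q_in_J phi_unit(1)[OF B.one_closed], of n n n] phi_unit(2)[OF B.one_closed, of n n]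
  by (simp add: E_def A.Q_Suc psi_gen)

definition J_corner where "J_corner n = {a \<in> A.J. A.Q n \<otimes>\<^bsub>A\<^esub> a = a \<and> a \<otimes>\<^bsub>A\<^esub> A.Q n = a}"
definition T_corner where "T_corner n = {t \<in> carrier T. E n \<otimes>\<^bsub>T\<^esub> t = t \<and> t \<otimes>\<^bsub>T\<^esub> E n = t}"

lemma phi_J_corner: "a \<in> J_corner n \<Longrightarrow> phi a \<in> T_corner n"
  using phi_mult[OF A.Q_in_J[of n], of a] phi_mult[OF _ A.Q_in_J[of n], of a]
  by (auto simp: J_corner_def T_corner_def E_def phi)

lemma T_corner_subalgebra: "cstar_subalgebra (T_corner n) T"
  unfolding T_corner_def by (rule T.cstar_subalgebra_corner) simp_all

text \<open>Each entry \<open>q w\<^sup>*\<^sup>i a w\<^sup>j q\<close> is some \<open>psi b\<close>, and it is mapped to \<open>b \<otimes> x 0 = 0\<close>, so all entries vanish.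
  Summing over the rows and then over the columns gives \<open>Q n a Q n = 0\<close>.\<close>

lemma phi_eq_zero_J_corner:
  assumes a: "a \<in> J_corner n" and 0: "phi a = \<zero>\<^bsub>T\<^esub>"
  shows "a = \<zero>\<^bsub>A\<^esub>"
proof -
  have aJ: "a \<in> A.J" and aQ: "A.Q n \<otimes>\<^bsub>A\<^esub> a = a" "a \<otimes>\<^bsub>A\<^esub> A.Q n = a" using a by (simp_all add: J_corner_def)
  note [simp] = A.JD(2)[OF aJ]
  have "h a = \<zero>\<^bsub>M\<^esub>" using phi(2)[OF aJ] 0 by simp
  have entry: "A.q \<otimes>\<^bsub>A\<^esub> (A.V i \<otimes>\<^bsub>A\<^esub> (a \<otimes>\<^bsub>A\<^esub> (A.w [^]\<^bsub>A\<^esub> j \<otimes>\<^bsub>A\<^esub> A.q))) = \<zero>\<^bsub>A\<^esub>" for i j :: nat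
  proof -
    obtain b where b: "b \<in> carrier B" "A.q \<otimes>\<^bsub>A\<^esub> (A.V i \<otimes>\<^bsub>A\<^esub> (a \<otimes>\<^bsub>A\<^esub> (A.w [^]\<^bsub>A\<^esub> j \<otimes>\<^bsub>A\<^esub> A.q))) = psi b"
      using A.corner_entries[OF image_psi, of a i j] by (auto simp: image_psi_def)
    have "T.left_mult (vec b 0) = \<zero>\<^bsub>M\<^esub>"
      using arg_cong[OF b(2), of h] \<open>h a = \<zero>\<^bsub>M\<^esub>\<close> b(1) by (simp add: h.h_mult h_psi)
    then have "cnorm T (vec b 0) = 0"
      using norm_left_mult[of "vec b 0"] b(1) by simp
    then have "b = \<zero>\<^bsub>B\<^esub>"
      using b(1) by (simp add: vec_def tens_norm norm_x0 B.cnorm_eq_0_iff)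
    then show ?thesis using b(2) by simp
  qed
  have col: "a \<otimes>\<^bsub>A\<^esub> (A.w [^]\<^bsub>A\<^esub> j \<otimes>\<^bsub>A\<^esub> A.q) = \<zero>\<^bsub>A\<^esub>" for j :: nat
    using A.Q_mult_eq_zeroI[of "a \<otimes>\<^bsub>A\<^esub> (A.w [^]\<^bsub>A\<^esub> j \<otimes>\<^bsub>A\<^esub> A.q)" n] entry aQ(1)
    by (simp flip: A.mult_assoc)
  have "A.q \<otimes>\<^bsub>A\<^esub> (A.V j \<otimes>\<^bsub>A\<^esub> adj A a) = \<zero>\<^bsub>A\<^esub>" for j
    using arg_cong[OF col[of j], of "adj A"] by (simp add: A.adj_mult A.V_def A.mult_assoc)
  then have "A.Q n \<otimes>\<^bsub>A\<^esub> adj A a = \<zero>\<^bsub>A\<^esub>"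
    by (intro A.Q_mult_eq_zeroI) simp_all
  from arg_cong[OF this, of "adj A"] show ?thesis
    by (simp add: A.adj_mult A.adj_adj aQ)
qed

text \<open>Compressing to one matrix position leaves \<open>b \<otimes> e\<^sub>i\<^sub>j\<close> for a single \<open>b\<close>.  The set of elements for which this holds is
  a closed subspace, because \<open>b \<mapsto> b \<otimes> x 0\<close> is isometric, and it contains the total set.\<close>

lemma compressed_unit:
  assumes t: "t \<in> carrier T"
  shows "tens \<one>\<^bsub>B\<^esub> (K.unit i i) \<otimes>\<^bsub>T\<^esub> t \<otimes>\<^bsub>T\<^esub> tens \<one>\<^bsub>B\<^esub> (K.unit j j) \<in> phi ` A.J"
proof -
  have one [simp]: "\<one>\<^bsub>B\<^esub> \<in> carrier B" by (rule B.one_closed)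
  define N where "N = (\<lambda>b. vec b 0) ` carrier B"
  interpret vec0: cstar_hom B T "\<lambda>b. vec b 0"
    by unfold_locales (rule star_homI, simp_all add: vec_def tens_add_left tens_smult_left tens_mult tens_adj)
  have N: "closed_subspace T N"
    unfolding N_def by (rule vec0.closed_subspace_image[OF B.closed_subspace_carrier])
      (simp add: vec_def tens_norm norm_x0)
  let ?r = "tens \<one>\<^bsub>B\<^esub> (K.unit 0 i)" and ?c = "tens \<one>\<^bsub>B\<^esub> (K.unit j 0)"
  let ?Z = "{t \<in> carrier T. ?r \<otimes>\<^bsub>T\<^esub> t \<in> {y \<in> carrier T. y \<otimes>\<^bsub>T\<^esub> ?c \<in> N}}"
  have "t \<in> ?Z"
  proof (rule tens_total[OF _ _ t])
    show "closed_subspace T ?Z"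
      by (intro T.closed_subspace_mult_left T.closed_subspace_mult_right N) simp_all
    fix b k l assume b: "b \<in> carrier B"
    have v: "vec b 0 = tens b (K.unit 0 0)" by (simp add: vec_def K.unit_i_0)
    have "?r \<otimes>\<^bsub>T\<^esub> tens b (K.unit k l) \<otimes>\<^bsub>T\<^esub> ?c = (if i = k \<and> l = j then vec b 0 else \<zero>\<^bsub>T\<^esub>)"
      unfolding v using b by (simp add: tens_mult K.unit_unit)
    then have "?r \<otimes>\<^bsub>T\<^esub> tens b (K.unit k l) \<otimes>\<^bsub>T\<^esub> ?c \<in> N"
      using b T.closed_subspaceD(3)[OF N] by (simp add: N_def)
    then show "tens b (K.unit k l) \<in> ?Z" using b by simp
  qed
  then obtain b where b: "b \<in> carrier B" "?r \<otimes>\<^bsub>T\<^esub> t \<otimes>\<^bsub>T\<^esub> ?c = tens b (x 0)"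
    by (auto simp: N_def vec_def)
  have "tens \<one>\<^bsub>B\<^esub> (K.unit i i) \<otimes>\<^bsub>T\<^esub> t \<otimes>\<^bsub>T\<^esub> tens \<one>\<^bsub>B\<^esub> (K.unit j j)
      = tens \<one>\<^bsub>B\<^esub> (K.unit i 0) \<otimes>\<^bsub>T\<^esub> (?r \<otimes>\<^bsub>T\<^esub> t \<otimes>\<^bsub>T\<^esub> ?c) \<otimes>\<^bsub>T\<^esub> tens \<one>\<^bsub>B\<^esub> (K.unit 0 j)"
  proof -
    have "tens \<one>\<^bsub>B\<^esub> (K.unit i i) = tens \<one>\<^bsub>B\<^esub> (K.unit i 0) \<otimes>\<^bsub>T\<^esub> ?r"
      "tens \<one>\<^bsub>B\<^esub> (K.unit j j) = ?c \<otimes>\<^bsub>T\<^esub> tens \<one>\<^bsub>B\<^esub> (K.unit 0 j)"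
      by (simp_all add: tens_mult K.unit_unit B.one_mult)
    then show ?thesis using t by (simp add: T.mult_assoc)
  qed
  also have "\<dots> = tens b (K.unit i j)"
    unfolding b(2) using b(1)
    by (simp add: tens_mult K.unit_unit B.one_mult B.mult_one flip: K.unit_i_0[of 0])
  also have "\<dots> \<in> phi ` A.J"
    using phi_unit[OF b(1), of i j] by (metis image_eqI)
  finally show ?thesis .
qed

lemma phi_J_add: "s \<in> phi ` A.J \<Longrightarrow> t \<in> phi ` A.J \<Longrightarrow> s \<oplus>\<^bsub>T\<^esub> t \<in> phi ` A.J"
  by (auto simp flip: phi_add intro!: imageI A.JD(4))

lemma compressed:
  assumes t: "t \<in> carrier T" shows "E m \<otimes>\<^bsub>T\<^esub> t \<otimes>\<^bsub>T\<^esub> E n \<in> phi ` A.J"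
proof -
  note [simp] = t B.one_closed
  have zero: "\<zero>\<^bsub>T\<^esub> \<in> phi ` A.J"
    by (rule rev_image_eqI[OF A.JD(3)]) (rule phi_eqI[symmetric], simp_all)
  have left: "E m \<otimes>\<^bsub>T\<^esub> t \<otimes>\<^bsub>T\<^esub> tens \<one>\<^bsub>B\<^esub> (K.unit j j) \<in> phi ` A.J" for j
  proof (induction m)
    case (Suc m)
    have "E (Suc m) \<otimes>\<^bsub>T\<^esub> t \<otimes>\<^bsub>T\<^esub> tens \<one>\<^bsub>B\<^esub> (K.unit j j) =
        E m \<otimes>\<^bsub>T\<^esub> t \<otimes>\<^bsub>T\<^esub> tens \<one>\<^bsub>B\<^esub> (K.unit j j)
        \<oplus>\<^bsub>T\<^esub> tens \<one>\<^bsub>B\<^esub> (K.unit m m) \<otimes>\<^bsub>T\<^esub> t \<otimes>\<^bsub>T\<^esub> tens \<one>\<^bsub>B\<^esub> (K.unit j j)"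
      by (simp add: E_Suc T.mult_add_left)
    then show ?case using phi_J_add[OF Suc compressed_unit[OF t]] by simp
  qed (simp add: zero)
  show ?thesis
  proof (induction n)
    case (Suc n)
    have "E m \<otimes>\<^bsub>T\<^esub> t \<otimes>\<^bsub>T\<^esub> E (Suc n) = E m \<otimes>\<^bsub>T\<^esub> t \<otimes>\<^bsub>T\<^esub> E n \<oplus>\<^bsub>T\<^esub> E m \<otimes>\<^bsub>T\<^esub> t \<otimes>\<^bsub>T\<^esub> tens \<one>\<^bsub>B\<^esub> (K.unit n n)"
      by (simp add: E_Suc T.mult_add_right)
    then show ?case using phi_J_add[OF Suc left] by simp
  qed (simp add: zero)
qed

lemma J_corner_closed:
  assumes a: "a \<in> J_corner n" and b: "b \<in> J_corner n"
  shows "a \<oplus>\<^bsub>A\<^esub> b \<in> J_corner n" "a \<otimes>\<^bsub>A\<^esub> b \<in> J_corner n" "c \<odot>\<^bsub>A\<^esub> a \<in> J_corner n" "adj A a \<in> J_corner n" "a \<ominus>\<^bsub>A\<^esub> b \<in> J_corner n"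
proof -
  have J: "a \<in> A.J" "b \<in> A.J" and aQ: "A.Q n \<otimes>\<^bsub>A\<^esub> a = a" "a \<otimes>\<^bsub>A\<^esub> A.Q n = a"
    and bQ: "A.Q n \<otimes>\<^bsub>A\<^esub> b = b" "b \<otimes>\<^bsub>A\<^esub> A.Q n = b"
    using a b by (simp_all add: J_corner_def)
  note [simp] = A.JD(2)[OF J(1)] A.JD(2)[OF J(2)]
  show "a \<oplus>\<^bsub>A\<^esub> b \<in> J_corner n" "c \<odot>\<^bsub>A\<^esub> a \<in> J_corner n" "a \<ominus>\<^bsub>A\<^esub> b \<in> J_corner n"
    using J A.JD aQ bQ unfolding J_corner_def
    by (simp_all add: A.mult_add_left A.mult_add_right A.smult_mult_left A.smult_mult_right
        A.mult_minus_left A.mult_minus_right)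
  have "A.Q n \<otimes>\<^bsub>A\<^esub> (a \<otimes>\<^bsub>A\<^esub> b) = a \<otimes>\<^bsub>A\<^esub> b" using aQ(1) by (simp flip: A.mult_assoc)
  moreover have "a \<otimes>\<^bsub>A\<^esub> b \<otimes>\<^bsub>A\<^esub> A.Q n = a \<otimes>\<^bsub>A\<^esub> b" using bQ(2) by (simp add: A.mult_assoc)
  ultimately show "a \<otimes>\<^bsub>A\<^esub> b \<in> J_corner n" using A.J_mult(1)[OF _ J(2), of a] by (simp add: J_corner_def)
  show "adj A a \<in> J_corner n"
    using A.J_adj[OF J(1)] arg_cong[OF aQ(1), of "adj A"] arg_cong[OF aQ(2), of "adj A"]
    unfolding J_corner_def by (simp add: A.adj_mult)
qed

text \<open>Surjectivity holds because \<open>E n t E n\<close> is a finite sum of compressions of \<open>t\<close> to single matrix positions, each of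
  which is attained.\<close>

lemma bij_betw_phi: "bij_betw phi (J_corner n) (T_corner n)"
proof (rule bij_betw_imageI)
  show "inj_on phi (J_corner n)"
  proof (rule inj_onI)
    fix a b assume a: "a \<in> J_corner n" and b: "b \<in> J_corner n" and eq: "phi a = phi b"
    have J: "a \<in> A.J" "b \<in> A.J" using a b by (simp_all add: J_corner_def)
    have "phi (a \<ominus>\<^bsub>A\<^esub> b) = \<zero>\<^bsub>T\<^esub>"
      by (rule phi_eqI) (use J eq phi[OF J(1)] phi(2)[OF J(2)] in \<open>simp_all add: A.JD(2) h.h_minus\<close>)
    then show "a = b"
      using phi_eq_zero_J_corner[OF J_corner_closed(5)[OF a b]] J by (simp add: A.minus_eq_zero_iff A.JD(2))
  qed
  show "phi ` J_corner n = T_corner n"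
  proof (intro antisym subsetI)
    fix t assume t: "t \<in> T_corner n"
    then have tT: "t \<in> carrier T" "E n \<otimes>\<^bsub>T\<^esub> t \<otimes>\<^bsub>T\<^esub> E n = t" by (simp_all add: T_corner_def)
    obtain a where a: "a \<in> A.J" "phi a = t"
      using compressed[OF tT(1), of n n] tT(2) by auto
    let ?a = "A.Q n \<otimes>\<^bsub>A\<^esub> a \<otimes>\<^bsub>A\<^esub> A.Q n"
    have "?a \<in> A.J" using a by (intro A.J_mult) simp_all
    moreover have "A.Q n \<otimes>\<^bsub>A\<^esub> ?a = ?a" using A.JD(2)[OF a(1)] by (simp flip: A.mult_assoc)
    moreover have "?a \<otimes>\<^bsub>A\<^esub> A.Q n = ?a" using A.JD(2)[OF a(1)] by (simp add: A.mult_assoc)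
    ultimately have "?a \<in> J_corner n" by (simp add: J_corner_def)
    moreover have "phi ?a = t"
      using a tT A.J_mult(1)[OF _ a(1), of "A.Q n"] by (simp add: phi_mult A.Q_in_J E_def)
    ultimately show "t \<in> phi ` J_corner n" by blast
  qed (use phi_J_corner in blast)
qed

text \<open>The inverse of \<open>phi\<close> on a corner is a *-homomorphism defined on a C*-subalgebra of \<open>T\<close>, hence contractive.\<close>

lemma norm_J_corner:
  assumes a: "a \<in> J_corner n" shows "cnorm A a \<le> cnorm T (phi a)"
proof -
  define g where "g = the_inv_into (J_corner n) phi"
  have inj: "inj_on phi (J_corner n)" and im: "phi ` J_corner n = T_corner n"
    using bij_betw_phi[of n] by (simp_all add: bij_betw_def)
  have g: "g (phi a) = a" if "a \<in> J_corner n" for a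
    using that inj by (simp add: g_def the_inv_into_f_f)
  have J_corner: "a \<in> A.J" "a \<in> carrier A" if "a \<in> J_corner n" for a
    using that A.JD(2) by (auto simp: J_corner_def)
  have "star_hom (T\<lparr>carrier := T_corner n\<rparr>) A g"
  proof (rule star_homI)
    fix s assume "s \<in> carrier (T\<lparr>carrier := T_corner n\<rparr>)"
    then obtain a where a: "a \<in> J_corner n" "s = phi a" using im by auto
    then show "g s \<in> carrier A" using g J_corner by simp
    show "g (c \<odot>\<^bsub>T\<lparr>carrier := T_corner n\<rparr>\<^esub> s) = c \<odot>\<^bsub>A\<^esub> g s" for c
      using a g[OF J_corner_closed(3)[OF a(1) a(1)], of c] by (simp add: g J_corner phi_smult)
    show "g (adj (T\<lparr>carrier := T_corner n\<rparr>) s) = adj A (g s)"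
      using a g[OF J_corner_closed(4)[OF a(1) a(1)]] by (simp add: g J_corner phi_adj)
    fix t assume "t \<in> carrier (T\<lparr>carrier := T_corner n\<rparr>)"
    then obtain b where b: "b \<in> J_corner n" "t = phi b" using im by auto
    show "g (s \<oplus>\<^bsub>T\<lparr>carrier := T_corner n\<rparr>\<^esub> t) = g s \<oplus>\<^bsub>A\<^esub> g t"
      using a b g[OF J_corner_closed(1)[OF a(1) b(1)]] by (simp add: g J_corner phi_add)
    show "g (s \<otimes>\<^bsub>T\<lparr>carrier := T_corner n\<rparr>\<^esub> t) = g s \<otimes>\<^bsub>A\<^esub> g t"
      using a b g[OF J_corner_closed(2)[OF a(1) b(1)]] by (simp add: g J_corner phi_mult)
  qed
  from star_hom_contractive[OF T.cstar_algebra_axioms A.cstar_algebra_axioms T_corner_subalgebra this phi_J_corner[OF a]]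
  show ?thesis by (simp add: g[OF a])
qed

text \<open>Compress to the corners and pass to the limit along the approximate unit.\<close>

lemma norm_le_phi:
  assumes a: "a \<in> A.J" shows "cnorm A a \<le> cnorm T (phi a)"
proof (rule A.cstar_lim_norm_le[OF A.Q_approximate_unit[OF a]])
  fix n
  note [simp] = A.JD(2)[OF a] phi(1)[OF a]
  let ?a = "A.Q n \<otimes>\<^bsub>A\<^esub> a \<otimes>\<^bsub>A\<^esub> A.Q n"
  have "?a \<in> A.J" using a by (intro A.J_mult) simp_all
  moreover have "A.Q n \<otimes>\<^bsub>A\<^esub> ?a = ?a" by (simp flip: A.mult_assoc)
  moreover have "?a \<otimes>\<^bsub>A\<^esub> A.Q n = ?a" by (simp add: A.mult_assoc)
  ultimately have "?a \<in> J_corner n" by (simp add: J_corner_def)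
  then have "cnorm A ?a \<le> cnorm T (phi ?a)" by (rule norm_J_corner)
  also have "phi ?a = E n \<otimes>\<^bsub>T\<^esub> phi a \<otimes>\<^bsub>T\<^esub> E n"
    using a A.J_mult(1)[OF _ a, of "A.Q n"] by (simp add: phi_mult A.Q_in_J E_def)
  also have "cnorm T \<dots> \<le> cnorm T (E n) * cnorm T (phi a) * cnorm T (E n)"
    by (rule order_trans[OF T.cnorm_mult mult_right_mono[OF T.cnorm_mult]]) simp_all
  also have "\<dots> \<le> 1 * cnorm T (phi a) * 1"
    by (intro mult_mono T.cnorm_projection_le_1) simp_all
  finally show "cnorm A ?a \<le> cnorm T (phi a)" by simp
qed

lemma phi_surj: "t \<in> carrier T \<Longrightarrow> t \<in> phi ` A.J"
proof -
  assume t: "t \<in> carrier T"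
  have "closed_subspace M (h ` A.J)"
  proof (rule h.closed_subspace_image[OF A.J_closed_subspace])
    fix a assume a: "a \<in> A.J"
    show "cnorm A a \<le> cnorm M (h a)"
      using norm_le_phi[OF a] norm_left_mult[OF phi(1)[OF a]] phi(2)[OF a] by simp
  qed
  then have "closed_subspace T {t \<in> carrier T. T.left_mult t \<in> h ` A.J}"
    by (rule l.closed_subspace_vimage)
  then have "T.left_mult t \<in> h ` A.J"
  proof -
    assume V: "closed_subspace T {t \<in> carrier T. T.left_mult t \<in> h ` A.J}"
    have "T.left_mult (tens b (K.unit i j)) \<in> h ` A.J" if "b \<in> carrier B" for b i j
      using phi(2)[OF phi_unit(1)[OF that, of i j]] phi_unit[OF that, of i j] by (metis image_eqI)
    then show ?thesis
      using tens_total[OF V _ t] by simp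
  qed
  then show ?thesis using phi_eqI[OF t] by force
qed

theorem star_iso_phi: "star_iso (A\<lparr>carrier := A.J\<rparr>) T phi"
  unfolding star_iso_def
proof (rule conjI)
  show "star_hom (A\<lparr>carrier := A.J\<rparr>) T phi"
    by (rule star_homI) (simp_all add: phi phi_add phi_mult phi_smult phi_adj)
  have "inj_on phi A.J"
  proof (rule inj_onI)
    fix a b assume ab: "a \<in> A.J" "b \<in> A.J" and eq: "phi a = phi b"
    note [simp] = A.JD(2)[OF ab(1)] A.JD(2)[OF ab(2)]
    have "phi (a \<ominus>\<^bsub>A\<^esub> b) = \<zero>\<^bsub>T\<^esub>"
      by (rule phi_eqI) (use eq phi[OF ab(1)] phi(2)[OF ab(2)] in \<open>simp_all add: h.h_minus\<close>)
    then have "cnorm A (a \<ominus>\<^bsub>A\<^esub> b) = 0"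
      using norm_le_phi[OF A.JD(6)[OF ab]] by (intro antisym) simp_all
    then show "a = b" by (simp add: A.cnorm_eq_0_iff A.minus_eq_zero_iff)
  qed
  moreover have "phi ` A.J = carrier T"
    using phi phi_surj by blast
  ultimately show "bij_betw phi (carrier (A\<lparr>carrier := A.J\<rparr>)) (carrier T)"
    by (simp add: bij_betw_def)
qed

end

text \<open>If \<open>x 0 = 0\<close>, both sides vanish: the columns \<open>w\<^sup>i q\<close> satisfy the relations of \<open>K\<close> in \<open>A\<close>,
  so \<open>q\<close> is the image of \<open>x 0\<close>.\<close>

lemma (in twisted_pair) matrix_column_relations_w_q: "matrix_column_relations A (\<lambda>i. w [^] (i::nat) \<otimes> q)"
proof -
  have "adj A (w [^] i \<otimes> q) \<otimes> (w [^] j \<otimes> q) = q \<otimes> (V i \<otimes> (w [^] j \<otimes> q))" for i j :: nat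
    by (simp add: V_def adj_mult mult_assoc)
  then show ?thesis
    unfolding matrix_column_relations_def by (auto simp: V_q)
qed

lemma (in twisted_pair) defect_ideal_trivial:
  assumes "q = \<zero>" shows "J = {\<zero>}"
proof -
  have "closed_two_sided_ideal {\<zero>}"
    by (simp add: closed_two_sided_ideal_def closed_subspace_zero)
  moreover have "e = e \<otimes> q" by (simp add: q_eq1 mult_add_right mult_assoc)
  moreover have "f = f \<otimes> q" by (simp add: q_eq2 mult_add_right mult_assoc)
  ultimately have "J \<subseteq> {\<zero>}" using assms by (intro J_least) simp_all
  then show ?thesis using JD(3) by blast
qed

theorem theorem4p5:
  fixes \<theta> :: real
    and A :: "'a cstar" and u v :: 'a
    and B :: "'b cstar" and U P :: 'b
    and K :: "'k cstar" and x :: "nat \<Rightarrow> 'k"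
    and T :: "'t cstar" and tens :: "'b \<Rightarrow> 'k \<Rightarrow> 't"
  assumes "is_free_twist \<theta> A u v"
    and "is_free_unitary_projection B U P"
    and "is_compacts K x"
    and "is_cstar_tensor B K T tens"
  shows "\<exists>\<phi>. star_iso (A\<lparr>carrier := defect_ideal A u v\<rparr>) T \<phi> \<and>
    (\<forall>i::nat.
      (u \<otimes>\<^bsub>A\<^esub> v) [^]\<^bsub>A\<^esub> i \<otimes>\<^bsub>A\<^esub> ubar A u v \<in> defect_ideal A u v \<and>
      \<phi> ((u \<otimes>\<^bsub>A\<^esub> v) [^]\<^bsub>A\<^esub> i \<otimes>\<^bsub>A\<^esub> ubar A u v) = tens U (x i) \<and>
      (u \<otimes>\<^bsub>A\<^esub> v) [^]\<^bsub>A\<^esub> i \<otimes>\<^bsub>A\<^esub> pbar A u v \<in> defect_ideal A u v \<and>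
      \<phi> ((u \<otimes>\<^bsub>A\<^esub> v) [^]\<^bsub>A\<^esub> i \<otimes>\<^bsub>A\<^esub> pbar A u v) = tens P (x i))"
proof -
  interpret A: twisted_pair A \<theta> u v
    using assms(1) by (intro twisted_pair.intro twisted_pair_axioms.intro) (auto simp: is_free_twist_def)
  interpret tensor_compacts B T K x tens
    using assms(2-4)
    by (intro tensor_compacts.intro tensor_compacts_axioms.intro matrix_column.intro matrix_column_axioms.intro)
      (auto simp: is_free_unitary_projection_def is_compacts_def is_cstar_tensor_def)
  have UP_carrier: "U \<in> carrier B" "P \<in> carrier B"
    using assms(2) by (auto simp: is_free_unitary_projection_def unitary_elem_def projection_elem_def)
  show ?thesis
  proof (cases "x 0 = \<zero>\<^bsub>K\<^esub>")
    case True
    obtain k where k: "star_hom K A k" "\<And>i. k (x i) = A.w [^]\<^bsub>A\<^esub> i \<otimes>\<^bsub>A\<^esub> A.q"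
      using compacts_hom[OF assms(3) A.cstar_algebra_axioms A.matrix_column_relations_w_q] by blast
    interpret k: cstar_hom K A k by unfold_locales (rule k(1))
    have "A.q = \<zero>\<^bsub>A\<^esub>" using k(2)[of 0] True by simp
    then have J: "A.J = {\<zero>\<^bsub>A\<^esub>}" by (rule A.defect_ideal_trivial)
    have xi: "x i = \<zero>\<^bsub>K\<^esub>" for i using K.x_x0[of i] True by simp
    have unit: "K.unit i j = \<zero>\<^bsub>K\<^esub>" for i j by (simp add: K.unit_def xi)
    have "t \<in> {\<zero>\<^bsub>T\<^esub>}" if "t \<in> carrier T" for t
      by (rule tens_total[OF T.closed_subspace_zero _ that]) (simp add: unit)
    then have T: "carrier T = {\<zero>\<^bsub>T\<^esub>}" by auto
    have "A.q \<otimes>\<^bsub>A\<^esub> A.U' = \<zero>\<^bsub>A\<^esub>" "A.q \<otimes>\<^bsub>A\<^esub> A.P' = \<zero>\<^bsub>A\<^esub>"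
      unfolding \<open>A.q = \<zero>\<^bsub>A\<^esub>\<close> by simp_all
    then have bar: "A.U' = \<zero>\<^bsub>A\<^esub>" "A.P' = \<zero>\<^bsub>A\<^esub>"
      unfolding A.q_U' A.q_P'(1) .
    have w: "A.w [^]\<^bsub>A\<^esub> i \<otimes>\<^bsub>A\<^esub> A.U' = \<zero>\<^bsub>A\<^esub>" "A.w [^]\<^bsub>A\<^esub> i \<otimes>\<^bsub>A\<^esub> A.P' = \<zero>\<^bsub>A\<^esub>" for i :: nat
      unfolding bar by simp_all
    have "star_iso (A\<lparr>carrier := A.J\<rparr>) T (\<lambda>_. \<zero>\<^bsub>T\<^esub>)"
      unfolding star_iso_def by (auto simp: J T bij_betw_def intro!: star_homI)
    then show ?thesis
      using UP_carrier w[unfolded A.w_def] by (intro exI[of _ "\<lambda>_. \<zero>\<^bsub>T\<^esub>"]) (simp add: J xi)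
  next
    case False
    interpret free_twist_tensor B T K x tens A \<theta> u v U P
      using assms(1,2) False by unfold_locales
    obtain h where h: "unital_star_hom A M h"
      "\<And>b j. b \<in> carrier B \<Longrightarrow> fst (h A.w) (vec b j) = vec b (Suc j)"
      "h A.q = T.left_mult (tens \<one>\<^bsub>B\<^esub> (x 0))" "h A.U' = T.left_mult (tens U (x 0))"
      "h A.P' = T.left_mult (tens P (x 0))"
      using ex_representation by blast
    obtain psi where psi: "star_hom B A psi" "psi \<one>\<^bsub>B\<^esub> = A.q" "psi U = A.U'" "psi P = A.P'"
      by (rule free_unitary_projection_hom[OF assms(2) A.cstar_algebra_axioms, of A.q A.U' A.P'])
        (auto simp: projection_elem_def)
    interpret represented_free_twist B T K x tens A \<theta> u v U P h psi
      by unfold_locales (use h psi in auto)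
    show ?thesis
      using star_iso_phi phi_column[OF UP_carrier(1)] phi_column[OF UP_carrier(2)]
      unfolding psi_gen A.w_def by (intro exI[of _ phi]) simp
  qed
qed

end
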